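(* Consider an instance generated by an IMLSBM in $\mathcal P_n(\rho,\{p_\ell\},\{q_\ell\},\beta)$ with $\rho\in(0,1/2)$, $\rho=o(1)$, $p_\ell\asymp q_\ell=o(1)$ for all $\ell$, $\beta=1+o(1)$ and $L\le n^c$ for a constant $c>0$. Suppose the procedure Init satisfies the consistent-initialization assumption, and that for some constant $c'\in(0,1)$, $$\log L+Le^{-c'J_\rho}=o\Big(\min_{S\subseteq[L]}\mathcal I_S\Big)\quad\text{and}\quad\min_{S\subseteq[L]}\mathcal I_S\to\infty.$$ Then there is a sequence $\bar\delta_n=o(1)$ such that the global estimator $\hat{\mathbf z}^\star$ output by Algorithm 3 satisfies $$\lim_{n\to\infty}\inf_{\mathbf z^\star\in\mathcal P_n}\mathbb P\Big(\mathcal L(\hat{\mathbf z}^\star,\mathbf z^\star)\le\exp\Big\{-(1-\bar\delta_n)\min_{S\subseteq[L]}\mathcal I_S\Big\}\Big)=1.$$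
   Context: Inhomogeneous multilayer SBM (IMLSBM). Fix integers $n,L\ge1$, a global label vector $\mathbf z^\star\in\{\pm1\}^n$, $\rho\in[0,1/2]$, and $0<q_\ell<p_\ell<1$ for $\ell\in[L]$. Individual label vectors $\mathbf z^{(\ell)}_i=\mathbf z^\star_i\xi_{\ell i}$ with $\xi_{\ell i}$ i.i.d., $P(\xi_{\ell i}=1)=1-\rho$, $P(\xi_{\ell i}=-1)=\rho$. Given the labels, the symmetric adjacency matrices $A^{(\ell)}\in\{0,1\}^{n\times n}$ have zero diagonal and independent entries $A^{(\ell)}_{ij}=A^{(\ell)}_{ji}$ ($i<j$), Bern$(p_\ell)$ if $\mathbf z^{(\ell)}_i=\mathbf z^{(\ell)}_j$ and Bern$(q_\ell)$ otherwise. $\mathcal P_n(\rho,\{p_\ell\},\{q_\ell\},\beta)$: such models with $n/(2\beta)\le\#\{i:\mathbf z^\star_i=\pm1\}\le n\beta/2$; an infimum "over $\mathbf z^\star\in\mathcal P_n$" ranges over all such $\mathbf z^\star$. Loss $\mathcal L(\hat{\mathbf z},\mathbf z)=n^{-1}\min\{d_H(\hat{\mathbf z},\mathbf z),d_H(-\hat{\mathbf z},\mathbf z)\}$. Probabilities are over labels and edges; asymptotics as $n\to\infty$; "$p_\ell\asymp q_\ell=o(1)$" means $q_\ell<p_\ell\le Cq_\ell$ for a constant $C$ independent of $n,\ell$ and $\max_\ell p_\ell\to0$. Information quantities: $I^{(\ell)}_t=-\log\big\{[p_\ell^{1-t}q_\ell^t+(1-p_\ell)^{1-t}(1-q_\ell)^t][p_\ell^tq_\ell^{1-t}+(1-p_\ell)^t(1-q_\ell)^{1-t}]\big\}$;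 $\psi_S(t)=-\frac n2\sum_{\ell\in S}I^{(\ell)}_t$; $\psi_S^\star(a)=\sup_{0\le t\le1}\{at-\psi_S(t)\}$; $J_\rho=-\log(2\sqrt{\rho(1-\rho)})$; $\mathcal I_S=|S^c|J_\rho+\psi^\star_S(0)$ if $|S^c|$ is even and $(|S^c|+1)J_\rho+\psi_S^\star(-2J_\rho)$ if $|S^c|$ is odd, $S^c=[L]\setminus S$. Algorithm 3 (inputs $\{A^{(\ell)}\}$, $\{p_\ell,q_\ell\}$, $\rho$, and a procedure Init). For $i\in[n]$, $\ell\in[L]$, $s_\star,s_\ell\in\{\pm1\}$ and a vector $\tilde{\mathbf z}$ indexed by $[n]\setminus\{i\}$, set $f^{(\ell)}_i(s_\star,s_\ell,\tilde{\mathbf z})=\log\frac{1-\rho}{\rho}\mathbf 1\{s_\ell=s_\star\}+\sum_{j\ne i:\tilde{\mathbf z}_j=s_\ell}\big[\log\frac{p_\ell(1-q_\ell)}{q_\ell(1-p_\ell)}A^{(\ell)}_{ij}+\log\frac{1-p_\ell}{1-q_\ell}\big]$. Stage I: for each $i$, run Init on the multilayer network $\{A^{(\ell)}_{-i,-i}\}$ obtained by deleting node $i$, obtaining $\tilde{\mathbf z}^{(-i)}\in\{\pm1\}^{[n]\setminus\{i\}}$. Stage II: for each $i$, compute $(\bar s^{\star}_i,\bar s^{1}_i,\dots,\bar s^{L}_i)\in\arg\max_{s_\star,s_1,\dots,s_L\in\{\pm1\}}\sum_\ell f^{(\ell)}_i(s_\star,s_\ell,\tilde{\mathbf z}^{(-i)})$;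 define $\bar{\mathbf z}^{\star,-i}\in\{\pm1\}^n$ by $\bar{\mathbf z}^{\star,-i}_j=\tilde{\mathbf z}^{(-i)}_j$ for $j\ne i$ and $\bar{\mathbf z}^{\star,-i}_i=\bar s^\star_i$, and $\bar{\mathbf z}^{\ell,-i}$ likewise with $\bar{\mathbf z}^{\ell,-i}_i=\bar s^\ell_i$. Stage III (alignment): $\hat{\mathbf z}^\star_1=\bar{\mathbf z}^{\star,-1}_1$, $\hat{\mathbf z}^{(\ell)}_1=\bar{\mathbf z}^{\ell,-1}_1$; for $i\ge2$, $\hat{\mathbf z}^\star_i\in\arg\max_{s\in\{\pm1\}}\#\big(\{j:\bar{\mathbf z}^{\star,-1}_j=s\}\cap\{j:\bar{\mathbf z}^{\star,-i}_j=\bar{\mathbf z}^{\star,-i}_i\}\big)$ and $\hat{\mathbf z}^{(\ell)}_i\in\arg\max_{s\in\{\pm1\}}\#\big(\{j:\bar{\mathbf z}^{\ell,-1}_j=s\}\cap\{j:\bar{\mathbf z}^{\ell,-i}_j=\bar{\mathbf z}^{\ell,-i}_i\}\big)$. Output $\hat{\mathbf z}^\star$ and $\hat{\mathbf z}^{(1)},\dots,\hat{\mathbf z}^{(L)}$ (ties broken arbitrarily). Consistent-initialization assumption: there exist $\delta_n=o(1)$ and constants $\varepsilon_{\mathrm{init}}>0$, $C'>0$ such that for every model in $\mathcal P_n$ and every $i\in[n]$, $\mathbb P\big(\min_{\pi\in\{\pm1\}}d_H(\pi\tilde{\mathbf z}^{(-i)},\mathbf z^\star_{-i})>n\delta_n\big)\le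 C'n^{-(1+\varepsilon_{\mathrm{init}})}$, where $\mathbf z^\star_{-i}$ is $\mathbf z^\star$ with coordinate $i$ removed. *)

theory Defs
  imports "HOL-Probability.Probability" "HOL-Library.Landau_Symbols"
begin

(* Conventions: nodes are 0..<n, layers are 0..<L (0-based indexing).
   Labels are ints in {-1,1}.  A multilayer adjacency is A :: nat => nat => nat => bool,
   A l i j = "edge between i and j in layer l". *)

type_synonym mnet = "nat \<Rightarrow> nat \<Rightarrow> nat \<Rightarrow> bool"

(* flip (l,i) = True  iff  xi_{l i} = -1  (probability rho) *)
definition flips_pmf :: "nat \<Rightarrow> nat \<Rightarrow> real \<Rightarrow> (nat \<times> nat \<Rightarrow> bool) pmf" where
  "flips_pmf n L \<rho> = Pi_pmf ({..<L} \<times> {..<n}) False (\<lambda>_. bernoulli_pmf \<rho>)"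

definition layer_labels :: "(nat \<Rightarrow> int) \<Rightarrow> (nat \<times> nat \<Rightarrow> bool) \<Rightarrow> nat \<Rightarrow> nat \<Rightarrow> int" where
  "layer_labels z \<xi> l i = z i * (if \<xi> (l, i) then -1 else 1)"

definition edges_pmf :: "nat \<Rightarrow> nat \<Rightarrow> (nat \<Rightarrow> real) \<Rightarrow> (nat \<Rightarrow> real)
    \<Rightarrow> (nat \<Rightarrow> nat \<Rightarrow> int) \<Rightarrow> (nat \<times> nat \<times> nat \<Rightarrow> bool) pmf" where
  "edges_pmf n L p q zl = Pi_pmf {(l, i, j). l < L \<and> i < j \<and> j < n} False
     (\<lambda>(l, i, j). bernoulli_pmf (if zl l i = zl l j then p l else q l))"

definition adj_of :: "(nat \<times> nat \<times> nat \<Rightarrow> bool) \<Rightarrow> mnet" where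
  "adj_of E l i j = (i \<noteq> j \<and> E (l, min i j, max i j))"

definition imlsbm_pmf :: "nat \<Rightarrow> nat \<Rightarrow> (nat \<Rightarrow> real) \<Rightarrow> (nat \<Rightarrow> real) \<Rightarrow> real
    \<Rightarrow> (nat \<Rightarrow> int) \<Rightarrow> mnet pmf" where
  "imlsbm_pmf n L p q \<rho> z =
     bind_pmf (flips_pmf n L \<rho>) (\<lambda>\<xi>.
     map_pmf adj_of (edges_pmf n L p q (layer_labels z \<xi>)))"

definition prob_event :: "nat \<Rightarrow> nat \<Rightarrow> (nat \<Rightarrow> real) \<Rightarrow> (nat \<Rightarrow> real) \<Rightarrow> real
    \<Rightarrow> (nat \<Rightarrow> int) \<Rightarrow> (mnet \<Rightarrow> bool) \<Rightarrow> real" where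
  "prob_event n L p q \<rho> z P = measure_pmf.prob (imlsbm_pmf n L p q \<rho> z) {A. P A}"

definition in_Pn :: "nat \<Rightarrow> real \<Rightarrow> (nat \<Rightarrow> int) \<Rightarrow> bool" where
  "in_Pn n \<beta> z \<longleftrightarrow> (\<forall>i<n. z i \<in> {-1, 1}) \<and>
     (\<forall>s\<in>{-1, 1::int}. real n / (2 * \<beta>) \<le> real (card {i. i < n \<and> z i = s}) \<and>
                      real (card {i. i < n \<and> z i = s}) \<le> real n * \<beta> / 2)"

definition hamming :: "nat set \<Rightarrow> (nat \<Rightarrow> int) \<Rightarrow> (nat \<Rightarrow> int) \<Rightarrow> nat" where
  "hamming V x y = card {j \<in> V. x j \<noteq> y j}"

definition loss :: "nat \<Rightarrow> (nat \<Rightarrow> int) \<Rightarrow> (nat \<Rightarrow> int) \<Rightarrow> real" where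
  "loss n zh z = real (min (hamming {..<n} zh z) (hamming {..<n} (\<lambda>i. - zh i) z)) / real n"

definition Ilayer :: "real \<Rightarrow> real \<Rightarrow> real \<Rightarrow> real" where
  "Ilayer p q t = - ln ((p powr (1 - t) * q powr t + (1 - p) powr (1 - t) * (1 - q) powr t) *
                        (p powr t * q powr (1 - t) + (1 - p) powr t * (1 - q) powr (1 - t)))"

definition psiS :: "nat \<Rightarrow> (nat \<Rightarrow> real) \<Rightarrow> (nat \<Rightarrow> real) \<Rightarrow> nat set \<Rightarrow> real \<Rightarrow> real" where
  "psiS n p q S t = - (real n / 2) * (\<Sum>l\<in>S. Ilayer (p l) (q l) t)"

definition psiS_star :: "nat \<Rightarrow> (nat \<Rightarrow> real) \<Rightarrow> (nat \<Rightarrow> real) \<Rightarrow> nat set \<Rightarrow> real \<Rightarrow> real" where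
  "psiS_star n p q S a = (SUP t\<in>{0..1}. a * t - psiS n p q S t)"

definition Jrho :: "real \<Rightarrow> real" where
  "Jrho \<rho> = - ln (2 * sqrt (\<rho> * (1 - \<rho>)))"

definition IS :: "nat \<Rightarrow> nat \<Rightarrow> (nat \<Rightarrow> real) \<Rightarrow> (nat \<Rightarrow> real) \<Rightarrow> real \<Rightarrow> nat set \<Rightarrow> real" where
  "IS n L p q \<rho> S =
     (let k = card ({..<L} - S) in
      if even k then real k * Jrho \<rho> + psiS_star n p q S 0
      else real (k + 1) * Jrho \<rho> + psiS_star n p q S (- 2 * Jrho \<rho>))"

definition minIS :: "nat \<Rightarrow> nat \<Rightarrow> (nat \<Rightarrow> real) \<Rightarrow> (nat \<Rightarrow> real) \<Rightarrow> real \<Rightarrow> real" where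
  "minIS n L p q \<rho> = Min (IS n L p q \<rho> ` Pow {..<L})"

definition delete_node :: "nat \<Rightarrow> mnet \<Rightarrow> mnet" where
  "delete_node i A l j k = (j \<noteq> i \<and> k \<noteq> i \<and> A l j k)"

definition init_minus :: "(nat \<Rightarrow> nat set \<Rightarrow> mnet \<Rightarrow> (nat \<Rightarrow> int)) \<Rightarrow> nat \<Rightarrow> nat \<Rightarrow> mnet \<Rightarrow> (nat \<Rightarrow> int)" where
  "init_minus Init n i A = Init n ({..<n} - {i}) (delete_node i A)"

definition f_alg :: "nat \<Rightarrow> (nat \<Rightarrow> real) \<Rightarrow> (nat \<Rightarrow> real) \<Rightarrow> real \<Rightarrow> mnet
    \<Rightarrow> nat \<Rightarrow> nat \<Rightarrow> int \<Rightarrow> int \<Rightarrow> (nat \<Rightarrow> int) \<Rightarrow> real" where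
  "f_alg n p q \<rho> A i l s_star s_l zt =
     ln ((1 - \<rho>) / \<rho>) * of_bool (s_l = s_star) +
     (\<Sum>j\<in>{j. j < n \<and> j \<noteq> i \<and> zt j = s_l}.
        ln (p l * (1 - q l) / (q l * (1 - p l))) * of_bool (A l i j) + ln ((1 - p l) / (1 - q l)))"

definition stage2_obj :: "nat \<Rightarrow> nat \<Rightarrow> (nat \<Rightarrow> real) \<Rightarrow> (nat \<Rightarrow> real) \<Rightarrow> real \<Rightarrow> mnet
    \<Rightarrow> nat \<Rightarrow> (nat \<Rightarrow> int) \<Rightarrow> int \<Rightarrow> (nat \<Rightarrow> int) \<Rightarrow> real" where
  "stage2_obj n L p q \<rho> A i zt s_star s = (\<Sum>l<L. f_alg n p q \<rho> A i l s_star (s l) zt)"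

definition stage2_global_argmax :: "nat \<Rightarrow> nat \<Rightarrow> (nat \<Rightarrow> real) \<Rightarrow> (nat \<Rightarrow> real) \<Rightarrow> real \<Rightarrow> mnet
    \<Rightarrow> nat \<Rightarrow> (nat \<Rightarrow> int) \<Rightarrow> int \<Rightarrow> bool" where
  "stage2_global_argmax n L p q \<rho> A i zt s_star \<longleftrightarrow>
     s_star \<in> {-1, 1} \<and>
     (\<exists>s. (\<forall>l<L. s l \<in> {-1, 1}) \<and>
          (\<forall>t t'. t \<in> {-1, 1} \<longrightarrow> (\<forall>l<L. t' l \<in> {-1, 1}) \<longrightarrow>
              stage2_obj n L p q \<rho> A i zt t t' \<le> stage2_obj n L p q \<rho> A i zt s_star s))"

(* zh is a possible global output of Algorithm 3 (for some admissible tie breaking) *)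
definition alg3_global_output :: "nat \<Rightarrow> nat \<Rightarrow> (nat \<Rightarrow> real) \<Rightarrow> (nat \<Rightarrow> real) \<Rightarrow> real
    \<Rightarrow> (nat \<Rightarrow> nat set \<Rightarrow> mnet \<Rightarrow> (nat \<Rightarrow> int)) \<Rightarrow> mnet \<Rightarrow> (nat \<Rightarrow> int) \<Rightarrow> bool" where
  "alg3_global_output n L p q \<rho> Init A zh \<longleftrightarrow>
     (\<exists>sb :: nat \<Rightarrow> int.
        (\<forall>i<n. stage2_global_argmax n L p q \<rho> A i (init_minus Init n i A) (sb i)) \<and>
        (let zbar = (\<lambda>i j. if j = i then sb i else init_minus Init n i A j);
             cnt = (\<lambda>i s. card {j. j < n \<and> zbar 0 j = s \<and> zbar i j = zbar i i})
         in (0 < n \<longrightarrow> zh 0 = zbar 0 0) \<and>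
            (\<forall>i. 1 \<le> i \<and> i < n \<longrightarrow>
                 zh i \<in> {-1, 1} \<and> (\<forall>s\<in>{-1, 1}. cnt i s \<le> cnt i (zh i)))))"

end

theory Submission
  imports Defs "HOL-Real_Asymp.Real_Asymp"
begin

text \<open>
  Maximising out the layer labels, Stage II misclassifies node \<open>i\<close> only if
  \<open>\<Sum>l<L. clip lam (D l) \<le> 0\<close>, where \<open>D l\<close> is the log-likelihood ratio of layer \<open>l\<close> for the two
  labels and \<open>lam = ln ((1 - \<rho>) / \<rho>) \<ge> 2 J\<close>. Conditionally on the labels and edges away from \<open>i\<close> the
  layers are independent, a layer label is flipped with probability \<open>\<rho> \<le> exp (- lam)\<close>, and otherwise
  \<open>E exp (- t D l) \<le> exp (- (1 - \<eta>) (n/2) I\<^sub>t)\<close> for \<open>t\<close> bounded away from \<open>0\<close> and \<open>1\<close>: initialisation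
  errors and flips at other nodes affect only \<open>o(n)\<close> factors.

  Let \<open>I\<close> be the minimal rate. If \<open>J\<close> is small compared with \<open>I\<close>, the parity in the definition of the rate is
  immaterial and Chernoff's bound at \<open>t = 1/2\<close> suffices. Otherwise \<open>I / J\<close> is bounded, and up to
  negligible probability only boundedly many layers are flipped or saturated (\<open>\<bar>D l\<bar> \<ge> lam\<close>). Since
  \<open>ln L\<close> is negligible, one can take a union bound over the sets \<open>A\<close>, \<open>B\<close> of layers saturated at
  \<open>- lam\<close>, \<open>lam\<close>, and choose the Chernoff parameter for each \<open>S = - (A \<union> B)\<close> separately; a single
  \<open>t\<close> for all patterns would lose a constant factor in the exponent. Markov's inequality turns the
  per-node bound into the bound on the loss.
\<close>

section \<open>Renyi information of a layer\<close>

text \<open>The initialiser used at node \<open>i\<close> sees no edge at \<open>i\<close>, so given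
  the rest it is a constant and only its error count matters. A misplaced or flipped neighbour costs
  a chi-square factor, the exponential of a multiple of the information at 1/2, while the gain is
  the information at the Chernoff parameter \<open>t\<close>. Concavity makes the two comparable for
  \<open>t\<close> in [\<eta>, 1 - \<eta>], so parameters are kept there. Origin of the parity: with
  \<open>m\<close> layers at \<open>- lam\<close>, \<open>b\<close> at \<open>lam\<close> and
  \<open>k = m + b\<close>, the saturated layers cost \<open>lam * (m * (1 - t) + b * t)\<close>.
  For \<open>m = b\<close> this is \<open>lam * k / 2\<close> whatever \<open>t\<close> is; for odd
  \<open>k\<close> and \<open>b < m\<close>, \<open>t <= 1/2\<close>, it is at least
  \<open>lam * ((k + 1) / 2 - t)\<close>, and with \<open>lam >= 2 * J\<close> the term in
  \<open>t\<close> becomes the argument \<open>- 2 * J\<close> of the conjugate. If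
  \<open>J > \<eta> * I\<close>, then \<open>K\<close> about 1/\<eta> saturated layers, each costing
  \<open>exp (- J)\<close> up to \<eta>, already account for \<open>exp (- I)\<close>; this is where
  the bounded number comes from. Every step loses a multiple of \<eta>, and \<eta> is sent to 0
  along a diagonal at the end.\<close>

definition hell :: "real \<Rightarrow> real \<Rightarrow> real \<Rightarrow> real" where
  "hell p q t = p powr (1 - t) * q powr t + (1 - p) powr (1 - t) * (1 - q) powr t"

text \<open>\<open>hell\<close> is the Chernoff affinity of the Bernoulli laws with parameters
  \<open>p\<close> and \<open>q\<close>. Its values at \<open>t\<close> and \<open>1 - t\<close> are
  the tilted moments of one neighbour with the same and with the opposite label; about
  \<open>n / 2\<close> neighbours are of each kind, hence the product.\<close>

lemma Ilayer_hell: "Ilayer p q t = - ln (hell p q t * hell p q (1 - t))"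
  by (simp add: Ilayer_def hell_def)

lemma Ilayer_sym: "Ilayer p q (1 - t) = Ilayer p q t"
  by (simp add: Ilayer_hell mult.commute)

lemma hell_pos:
  assumes "0 < p" "p < 1" "0 < q" "q < 1"
  shows "0 < hell p q t"
  using assms by (simp add: hell_def add_pos_pos)

lemma hell_le_1:
  assumes "0 < p" "p < 1" "0 < q" "q < 1" "0 \<le> t" "t \<le> 1"
  shows "hell p q t \<le> 1"
proof -
  have "p powr (1 - t) * q powr t \<le> (1 - t) * p + t * q"
    using assms by (intro Youngs_inequality_0) auto
  moreover have "(1-p) powr (1 - t) * (1-q) powr t \<le> (1 - t) * (1-p) + t * (1-q)"
    using assms by (intro Youngs_inequality_0) auto
  ultimately show ?thesis unfolding hell_def by (simp add: algebra_simps)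
qed

text \<open>Once both pairs are normalised to total mass 1, weighted AM-GM applies termwise and its
  right-hand sides add up to 1.\<close>

lemma Hoelder_two:
  fixes x1 x2 y1 y2 u :: real
  assumes "0 < x1" "0 < x2" "0 < y1" "0 < y2" "0 \<le> u" "u \<le> 1"
  shows "x1 powr (1 - u) * y1 powr u + x2 powr (1 - u) * y2 powr u
         \<le> (x1 + x2) powr (1 - u) * (y1 + y2) powr u"
proof -
  define X Y where "X = x1 + x2" and "Y = y1 + y2"
  have XY: "X > 0" "Y > 0" using assms by (auto simp: X_def Y_def)
  have 1: "(x1 / X) powr (1 - u) * (y1 / Y) powr u \<le> (1 - u) * (x1 / X) + u * (y1 / Y)"
    using assms XY by (intro Youngs_inequality_0) auto
  have 2: "(x2 / X) powr (1 - u) * (y2 / Y) powr u \<le> (1 - u) * (x2 / X) + u * (y2 / Y)"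
    using assms XY by (intro Youngs_inequality_0) auto
  have "(1 - u) * (x1 / X) + u * (y1 / Y) + ((1 - u) * (x2 / X) + u * (y2 / Y))
      = (1 - u) * ((x1 + x2) / X) + u * ((y1 + y2) / Y)"
    by (simp add: algebra_simps add_divide_distrib)
  also have "\<dots> = 1" using XY by (simp add: X_def[symmetric] Y_def[symmetric])
  finally have "(x1 / X) powr (1 - u) * (y1 / Y) powr u + (x2 / X) powr (1 - u) * (y2 / Y) powr u \<le> 1"
    using 1 2 by linarith
  hence "(x1 powr (1 - u) * y1 powr u + x2 powr (1 - u) * y2 powr u) / (X powr (1 - u) * Y powr u) \<le> 1"
    using assms XY by (simp add: powr_divide add_divide_distrib)
  thus ?thesis using XY by (simp add: divide_le_eq X_def Y_def)
qed

lemma hell_log_convex: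
  assumes "0 < p" "p < 1" "0 < q" "q < 1" "0 \<le> u" "u \<le> 1"
  shows "hell p q ((1 - u) * s + u * t) \<le> hell p q s powr (1 - u) * hell p q t powr u"
proof -
  have *: "a powr (1 - ((1 - u) * s + u * t)) * b powr ((1 - u) * s + u * t)
     = (a powr (1 - s) * b powr s) powr (1 - u) * (a powr (1 - t) * b powr t) powr u"
    if "0 < a" "0 < b" for a b :: real
    using that by (simp add: powr_def exp_add[symmetric] ln_mult algebra_simps)
  show ?thesis
    unfolding hell_def using assms
    by (subst (1 2) *) (auto intro!: Hoelder_two)
qed

text \<open>\<open>hell\<close> is log-convex by Hoelder, and the reflected factor inherits this
  because reflection at 1/2 is affine.\<close>

lemma Ilayer_concave:
  assumes "0 < p" "p < 1" "0 < q" "q < 1" "0 \<le> u" "u \<le> 1"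
  shows "(1 - u) * Ilayer p q s + u * Ilayer p q t \<le> Ilayer p q ((1 - u) * s + u * t)"
proof -
  note pos = hell_pos[OF assms(1-4)]
  have lc: "ln (hell p q ((1 - u) * s + u * t)) \<le> (1 - u) * ln (hell p q s) + u * ln (hell p q t)" for s t
  proof -
    have "ln (hell p q ((1 - u) * s + u * t)) \<le> ln (hell p q s powr (1 - u) * hell p q t powr u)"
      using hell_log_convex[OF assms] pos by (simp add: ln_mono less_imp_neq[symmetric])
    also have "\<dots> = (1 - u) * ln (hell p q s) + u * ln (hell p q t)"
      using pos[of s] pos[of t] by (simp add: ln_mult ln_powr)
    finally show ?thesis .
  qed
  have eq: "1 - ((1 - u) * s + u * t) = (1 - u) * (1 - s) + u * (1 - t)"
    by (simp add: algebra_simps)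
  have L: "Ilayer p q r = - ln (hell p q r) - ln (hell p q (1 - r))" for r
    using pos[of r] pos[of "1 - r"] by (simp add: Ilayer_hell ln_mult)
  show ?thesis
    using lc[of s t] lc[of "1 - s" "1 - t"] unfolding L eq by (simp add: algebra_simps)
qed

lemma Ilayer_nonneg:
  assumes "0 < p" "p < 1" "0 < q" "q < 1" "0 \<le> t" "t \<le> 1"
  shows "0 \<le> Ilayer p q t"
proof -
  have "hell p q t * hell p q (1 - t) \<le> 1"
    using hell_le_1[OF assms] hell_le_1[OF assms(1-4), of "1 - t"] assms
      hell_pos[OF assms(1-4), of t] hell_pos[OF assms(1-4), of "1-t"]
    by (intro mult_le_one) auto
  thus ?thesis
    using hell_pos[OF assms(1-4), of t] hell_pos[OF assms(1-4), of "1-t"]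
    by (simp add: Ilayer_hell)
qed

text \<open>Concavity together with symmetry: \<open>t\<close> is the convex combination, with
  weight \<open>u\<close>, of \<open>s\<close> and \<open>1 - s\<close>, where the values
  agree.\<close>

lemma Ilayer_mono_half:
  assumes "0 < p" "p < 1" "0 < q" "q < 1" "s \<le> t" "t \<le> 1/2"
  shows "Ilayer p q s \<le> Ilayer p q t"
proof (cases "s = t")
  case False
  define u where "u = (t - s) / (1 - 2 * s)"
  have s: "1 - 2 * s > 0" using assms False by linarith
  have u: "0 \<le> u" "u \<le> 1" using s assms by (auto simp: u_def divide_le_eq)
  have "u * (1 - 2 * s) = t - s" using s by (simp add: u_def)
  hence "(1 - u) * s + u * (1 - s) = t" by (simp add: algebra_simps)
  with Ilayer_concave[OF assms(1-4) u, of s "1 - s"] show ?thesis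
    by (simp add: Ilayer_sym algebra_simps)
qed simp

lemma Ilayer_le_half:
  assumes "0 < p" "p < 1" "0 < q" "q < 1"
  shows "Ilayer p q t \<le> Ilayer p q (1/2)"
proof (cases "t \<le> 1/2")
  case False
  thus ?thesis using Ilayer_mono_half[OF assms, of "1 - t" "1/2"] by (simp add: Ilayer_sym)
qed (use Ilayer_mono_half[OF assms] in auto)

text \<open>Concavity between 0, where the value is nonnegative, and 1/2. This allows errors
  measured by the information at 1/2 to be absorbed into the rate at the Chernoff parameter.\<close>

lemma Ilayer_ge_half:
  assumes pq: "0 < p" "p < 1" "0 < q" "q < 1" and t: "0 \<le> \<eta>" "\<eta> \<le> t" "t \<le> 1 - \<eta>"
  shows "2 * \<eta> * Ilayer p q (1/2) \<le> Ilayer p q t"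
proof -
  have main: "2 * \<eta> * Ilayer p q (1/2) \<le> Ilayer p q s" if s: "\<eta> \<le> s" "s \<le> 1/2" for s
  proof -
    have "2 * s * Ilayer p q (1/2) \<le> (1 - 2 * s) * Ilayer p q 0 + 2 * s * Ilayer p q (1/2)"
      using Ilayer_nonneg[OF pq, of 0] s by simp
    also have "\<dots> \<le> Ilayer p q s"
      using Ilayer_concave[OF pq, of "2 * s" 0 "1/2"] s t by simp
    finally show ?thesis
      using mult_right_mono[of "2 * \<eta>" "2 * s", OF _ Ilayer_nonneg[OF pq, of "1/2"]] s by simp
  qed
  show ?thesis
  proof (cases "t \<le> 1/2")
    case False
    thus ?thesis using main[of "1 - t"] t by (simp add: Ilayer_sym)
  qed (use main t in auto)
qed

text \<open>The information at 1/2 dominates the squared Hellinger distance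
  \<open>2 * (1 - h)\<close>, and factoring \<open>p - q\<close> through square roots brings in
  \<open>4 * p\<close>. Together with \<open>p <= C * q\<close> it will dominate the chi-square cost
  of a misplaced neighbour.\<close>

lemma Ilayer_half_lower:
  assumes "0 < q" "q < p" "p < 1"
  shows "(p - q)\<^sup>2 / (4 * p) \<le> Ilayer p q (1/2)"
proof -
  define h where "h = hell p q (1/2)"
  have h: "h = sqrt p * sqrt q + sqrt (1 - p) * sqrt (1 - q)"
    using assms by (simp add: h_def hell_def powr_half_sqrt)
  have hp: "h > 0" using hell_pos[of p q "1/2"] assms by (simp add: h_def)
  have "Ilayer p q (1/2) = - 2 * ln h"
    using hp by (simp add: Ilayer_hell h_def[symmetric] ln_mult)
  moreover have "ln h \<le> h - 1" using hp by (rule ln_le_minus_one)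
  ultimately have 1: "2 * (1 - h) \<le> Ilayer p q (1/2)" by simp
  have "(sqrt p - sqrt q)\<^sup>2 + (sqrt (1 - p) - sqrt (1 - q))\<^sup>2 = 2 * (1 - h)"
    using assms by (simp add: h power2_eq_square algebra_simps)
  hence 2: "(sqrt p - sqrt q)\<^sup>2 \<le> 2 * (1 - h)"
    using zero_le_power2[of "sqrt (1 - p) - sqrt (1 - q)"] by linarith
  have "p - q = (sqrt p - sqrt q) * (sqrt p + sqrt q)"
    using assms by (simp add: algebra_simps)
  hence "(p - q)\<^sup>2 = (sqrt p - sqrt q)\<^sup>2 * (sqrt p + sqrt q)\<^sup>2"
    by (simp add: power_mult_distrib)
  also have "\<dots> \<le> (sqrt p - sqrt q)\<^sup>2 * (2 * sqrt p)\<^sup>2"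
    using assms by (intro mult_left_mono power_mono) auto
  also have "\<dots> = (sqrt p - sqrt q)\<^sup>2 * (4 * p)" using assms by (simp add: power_mult_distrib)
  finally have "(p - q)\<^sup>2 / (4 * p) \<le> (sqrt p - sqrt q)\<^sup>2"
    using assms by (simp add: divide_le_eq)
  with 1 2 show ?thesis by linarith
qed

lemma Ilayer_continuous:
  assumes "0 < p" "p < 1" "0 < q" "q < 1"
  shows "continuous_on A (Ilayer p q)"
proof -
  have h: "continuous_on A (hell p q)" for A
    unfolding hell_def[abs_def] using assms by (intro continuous_intros) auto
  have "continuous_on A (\<lambda>t. hell p q (1 - t))"
    by (rule continuous_on_compose2[OF h[of UNIV]]) (auto intro!: continuous_intros)
  hence "continuous_on A (\<lambda>t. - ln (hell p q t * hell p q (1 - t)))"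
    using hell_pos[OF assms] by (intro continuous_intros h) (auto simp: less_imp_neq[symmetric])
  thus ?thesis unfolding Ilayer_hell[symmetric] .
qed

section \<open>Conjugates of the summed layer rates\<close>

definition rate_layer :: "nat \<Rightarrow> (nat \<Rightarrow> real) \<Rightarrow> (nat \<Rightarrow> real) \<Rightarrow> nat \<Rightarrow> real \<Rightarrow> real" where
  "rate_layer n p q l t = real n / 2 * Ilayer (p l) (q l) t"

lemma psiS_rate: "psiS n p q S t = - (\<Sum>l\<in>S. rate_layer n p q l t)"
  by (simp add: psiS_def rate_layer_def sum_distrib_left sum_negf)

text \<open>For \<open>a <= 0\<close>, reflecting a point of (1/2, 1] at 1/2 keeps the rates and
  does not decrease \<open>a * t\<close>, so a maximiser on the compact interval [0, 1/2] dominates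
  the whole supremum. It later serves as Chernoff parameter.\<close>

lemma psiS_star_attained:
  assumes S: "\<And>l. l \<in> S \<Longrightarrow> 0 < q l \<and> q l < p l \<and> p l < 1" and a: "a \<le> 0"
  obtains t where "0 \<le> t" "t \<le> 1/2" "psiS_star n p q S a \<le> a * t + (\<Sum>l\<in>S. rate_layer n p q l t)"
proof -
  have pq: "0 < p l \<and> p l < 1 \<and> 0 < q l \<and> q l < 1" if "l \<in> S" for l
    using S[OF that] by linarith
  define F where "F t = a * t + (\<Sum>l\<in>S. rate_layer n p q l t)" for t
  have cont: "continuous_on {0..1/2} F"
    unfolding F_def rate_layer_def using pq
    by (intro continuous_intros Ilayer_continuous) auto
  have "\<exists>t\<in>{0..1/2}. \<forall>s\<in>{0..1/2}. F s \<le> F t"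
    by (rule continuous_attains_sup[OF _ _ cont]) simp_all
  then obtain t where t: "t \<in> {0..1/2}" "\<And>s. s \<in> {0..1/2} \<Longrightarrow> F s \<le> F t"
    by blast
  have "psiS_star n p q S a \<le> F t"
    unfolding psiS_star_def
  proof (rule cSUP_least)
    fix s :: real assume s: "s \<in> {0..1}"
    have eq: "a * s - psiS n p q S s = F s" by (simp add: psiS_rate F_def)
    show "a * s - psiS n p q S s \<le> F t"
    proof (cases "s \<le> 1/2")
      case True thus ?thesis using t(2)[of s] s eq by simp
    next
      case False
      have "a * s \<le> a * (1 - s)" using False a by (intro mult_left_mono_neg) auto
      hence "F s \<le> F (1 - s)" by (simp add: F_def rate_layer_def Ilayer_sym)
      also have "\<dots> \<le> F t" using t(2)[of "1 - s"] s False by simp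
      finally show ?thesis using eq by simp
    qed
  qed simp
  thus thesis using t(1) by (intro that[of t]) (simp_all add: F_def)
qed

lemma psiS_star_le_half:
  assumes S: "\<And>l. l \<in> S \<Longrightarrow> 0 < q l \<and> q l < p l \<and> p l < 1" and a: "a \<le> 0"
  shows "psiS_star n p q S a \<le> (\<Sum>l\<in>S. rate_layer n p q l (1/2))"
proof -
  have pq: "0 < p l \<and> p l < 1 \<and> 0 < q l \<and> q l < 1" if "l \<in> S" for l
    using S[OF that] by linarith
  obtain t where t: "0 \<le> t" "t \<le> 1/2" "psiS_star n p q S a \<le> a * t + (\<Sum>l\<in>S. rate_layer n p q l t)"
    by (rule psiS_star_attained[where n = n, OF S a])
  have "(\<Sum>l\<in>S. rate_layer n p q l t) \<le> (\<Sum>l\<in>S. rate_layer n p q l (1/2))"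
    unfolding rate_layer_def using pq
    by (intro sum_mono mult_left_mono Ilayer_le_half) auto
  moreover have "a * t \<le> 0" using a t by (simp add: mult_nonpos_nonneg)
  ultimately show ?thesis using t by linarith
qed

section \<open>Independent layers and clipped statistics\<close>

text \<open>No layer votes with more weight than the price \<open>lam\<close> of letting its label
  differ from the global one.\<close>

definition clip :: "real \<Rightarrow> real \<Rightarrow> real" where
  "clip lam d = max (- lam) (min d lam)"

text \<open>Independence enters only through product test functions, one factor per layer. The flip
  bound is stated with \<open>exp (- lam)\<close>, which equals \<rho> / (1 - \<rho>) in the
  application, so that flips and saturation at \<open>- lam\<close> are paid in the same
  currency.\<close>

locale indep_layers =
  fixes M :: "'a pmf" and L :: nat and fl :: "nat \<Rightarrow> 'a \<Rightarrow> bool"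
    and D :: "nat \<Rightarrow> 'a \<Rightarrow> real" and lam :: real
  assumes finM: "finite (set_pmf M)"
    and prod_expectation: "\<And>g :: nat \<Rightarrow> bool \<Rightarrow> real \<Rightarrow> real.
      measure_pmf.expectation M (\<lambda>x. \<Prod>l<L. g l (fl l x) (D l x))
      = (\<Prod>l<L. measure_pmf.expectation M (\<lambda>x. g l (fl l x) (D l x)))"
    and flip_prob: "\<And>l. l < L \<Longrightarrow> measure_pmf.prob M {x. fl l x} \<le> exp (- lam)"
    and lam_pos: "0 < lam"
begin

text \<open>The moment is restricted to the unflipped layer: a flipped layer is charged its
  probability and the worst clipped value, so no moment under a flip is ever estimated.\<close>

definition mgf :: "nat \<Rightarrow> real \<Rightarrow> real" where
  "mgf l t = measure_pmf.expectation M (\<lambda>x. of_bool (\<not> fl l x) * exp (- t * D l x))"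

definition err :: "'a set" where
  "err = {x. (\<Sum>l<L. clip lam (D l x)) \<le> 0}"

lemma integrable_M [simp]: "integrable (measure_pmf M) (f :: 'a \<Rightarrow> real)"
  by (rule integrable_measure_pmf_finite[OF finM])

lemma mgf_nonneg: "0 \<le> mgf l t"
  unfolding mgf_def by (rule integral_nonneg_AE) (simp add: AE_measure_pmf_iff)

text \<open>Markov's inequality in product form: a nonnegative product that dominates the indicator
  of the event factors over the layers.\<close>

lemma prob_le_prod:
  fixes g :: "nat \<Rightarrow> bool \<Rightarrow> real \<Rightarrow> real"
  assumes nonneg: "\<And>l b d. 0 \<le> g l b d"
    and one: "\<And>x. x \<in> X \<Longrightarrow> 1 \<le> (\<Prod>l<L. g l (fl l x) (D l x))"
    and bound: "\<And>l. l < L \<Longrightarrow> measure_pmf.expectation M (\<lambda>x. g l (fl l x) (D l x)) \<le> h l"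
  shows "measure_pmf.prob M X \<le> (\<Prod>l<L. h l)"
proof -
  have "measure_pmf.prob M X = measure_pmf.expectation M (indicator X)"
    by simp
  also have "\<dots> \<le> measure_pmf.expectation M (\<lambda>x. \<Prod>l<L. g l (fl l x) (D l x))"
    using one nonneg by (intro integral_mono) (auto simp: indicator_def prod_nonneg)
  also have "\<dots> = (\<Prod>l<L. measure_pmf.expectation M (\<lambda>x. g l (fl l x) (D l x)))"
    by (rule prod_expectation)
  also have "\<dots> \<le> (\<Prod>l<L. h l)"
    using bound nonneg by (intro prod_mono conjI integral_nonneg_AE) (simp_all add: AE_measure_pmf_iff)
  finally show ?thesis .
qed

text \<open>Template for one layer: \<open>c\<close> is the worst value under a flip,
  \<open>k\<close> a weight on the tilted unflipped part, and \<open>r\<close> a constant remainder,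
  typically from saturation at \<open>lam\<close>.\<close>

lemma expectation_bound:
  fixes g :: "bool \<Rightarrow> real \<Rightarrow> real"
  assumes l: "l < L" and c: "0 \<le> c"
    and le: "\<And>b d. g b d \<le> of_bool b * c + of_bool (\<not> b) * exp (- t * d) * k + r"
  shows "measure_pmf.expectation M (\<lambda>x. g (fl l x) (D l x)) \<le> exp (- lam) * c + mgf l t * k + r"
proof -
  have "measure_pmf.expectation M (\<lambda>x. g (fl l x) (D l x))
     \<le> measure_pmf.expectation M (\<lambda>x. indicator {x. fl l x} x * c
          + of_bool (\<not> fl l x) * exp (- t * D l x) * k + r)"
    using le by (intro integral_mono) (auto simp: indicator_def split: if_splits)
  also have "\<dots> = measure_pmf.prob M {x. fl l x} * c + mgf l t * k + r"
    by (simp add: mgf_def)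
  also have "\<dots> \<le> exp (- lam) * c + mgf l t * k + r"
    using flip_prob[OF l] c by (simp add: mult_right_mono)
  finally show ?thesis .
qed

lemma prod_exp_clip:
  "(\<Prod>l<L. exp (- clip lam (D l x) / 2)) = exp (- (\<Sum>l<L. clip lam (D l x)) / 2)"
  by (simp only: exp_sum[OF finite_lessThan, symmetric] sum_negf sum_divide_distrib[symmetric])

lemma exp_clip_half_le:
  "exp (- clip lam d / 2)
     \<le> of_bool b * exp (lam / 2) + of_bool (\<not> b) * exp (- (1/2) * d) * 1 + exp (- lam / 2)"
proof (cases b)
  case True
  have "exp (- clip lam d / 2) \<le> exp (lam / 2)" using lam_pos by (simp add: clip_def)
  thus ?thesis using True by (simp add: add_increasing2)
next
  case False
  have "exp (- clip lam d / 2) \<le> max (exp (- (1/2) * d)) (exp (- lam / 2))"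
    using lam_pos by (auto simp: clip_def max_def min_def)
  also have "\<dots> \<le> exp (- (1/2) * d) + exp (- lam / 2)" by (simp add: max_def)
  finally show ?thesis using False by simp
qed

text \<open>At 1/2 the two exceptional costs coincide: a flip contributes
  \<open>exp (- lam) * exp (lam / 2)\<close> and saturation at \<open>lam\<close> contributes
  \<open>exp (- lam / 2)\<close>. Hence the factor 2.\<close>

lemma expectation_exp_clip:
  assumes "l < L"
  shows "measure_pmf.expectation M (\<lambda>x. exp (- clip lam (D l x) / 2)) \<le> mgf l (1/2) + 2 * exp (- lam / 2)"
proof -
  have "measure_pmf.expectation M (\<lambda>x. exp (- clip lam (D l x) / 2))
    \<le> exp (- lam) * exp (lam / 2) + mgf l (1/2) * 1 + exp (- lam / 2)"
    using assms exp_clip_half_le by (intro expectation_bound[where g = "\<lambda>b d. exp (- clip lam d / 2)"]) auto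
  also have "exp (- lam) * exp (lam / 2) = exp (- lam / 2)"
    by (simp add: exp_add[symmetric])
  finally show ?thesis by simp
qed

lemma prob_err_le_half:
  "measure_pmf.prob M err \<le> (\<Prod>l<L. mgf l (1/2) + 2 * exp (- lam / 2))"
proof (rule prob_le_prod[where g = "\<lambda>l b d. exp (- clip lam d / 2)"])
  fix x assume "x \<in> err"
  thus "1 \<le> (\<Prod>l<L. exp (- clip lam (D l x) / 2))"
    unfolding prod_exp_clip by (simp add: err_def)
qed (simp_all only: expectation_exp_clip exp_ge_zero)

text \<open>A layer of \<open>C\<close> has three ways to be exceptional: flipped, at
  \<open>lam\<close>, or at \<open>- lam\<close>. In the last case the clipped value costs
  \<open>exp (lam / 2)\<close>, which Markov with tilt \<open>1 - \<eta>\<close> repays with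
  \<open>exp (- (1 - \<eta>) * lam)\<close>. Tilt 1 would lose nothing, but the moments are
  controlled only away from the endpoints.\<close>

lemma prob_err_saturated_le:
  assumes C: "C \<subseteq> {..<L}" and \<eta>: "0 \<le> \<eta>" "\<eta> \<le> 1/2"
    and mgf1: "\<And>l. l < L \<Longrightarrow> mgf l (1/2) \<le> 1" "\<And>l. l < L \<Longrightarrow> mgf l (1 - \<eta>) \<le> 1"
  shows "measure_pmf.prob M {x \<in> err. \<forall>l\<in>C. fl l x \<or> lam \<le> \<bar>D l x\<bar>}
         \<le> (3 * exp (- (1/2 - \<eta>) * lam)) ^ card C * (1 + 2 * exp (- lam / 2)) ^ L"
proof -
  define g where "g l b d = (if l \<in> C then of_bool (b \<or> lam \<le> \<bar>d\<bar>) else 1) * exp (- clip lam d / 2)"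
    for l :: nat and b and d :: real
  define h where "h l = (if l \<in> C then 3 * exp (- (1/2 - \<eta>) * lam) else 1 + 2 * exp (- lam / 2))" for l
  have "measure_pmf.prob M {x \<in> err. \<forall>l\<in>C. fl l x \<or> lam \<le> \<bar>D l x\<bar>} \<le> (\<Prod>l<L. h l)"
  proof (rule prob_le_prod[where g = g])
    show "0 \<le> g l b d" for l b d by (simp add: g_def)
    fix x assume x: "x \<in> {x \<in> err. \<forall>l\<in>C. fl l x \<or> lam \<le> \<bar>D l x\<bar>}"
    have "(\<Prod>l<L. g l (fl l x) (D l x)) = (\<Prod>l<L. exp (- clip lam (D l x) / 2))"
      using x by (intro prod.cong) (auto simp: g_def)
    thus "1 \<le> (\<Prod>l<L. g l (fl l x) (D l x))"
      using x unfolding prod_exp_clip by (simp add: err_def)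
  next
    fix l assume l: "l < L"
    show "measure_pmf.expectation M (\<lambda>x. g l (fl l x) (D l x)) \<le> h l"
    proof (cases "l \<in> C")
      case False
      have "measure_pmf.expectation M (\<lambda>x. g l (fl l x) (D l x)) \<le> mgf l (1/2) + 2 * exp (- lam / 2)"
        using expectation_exp_clip[OF l] False by (simp add: g_def)
      thus ?thesis using mgf1(1)[OF l] False by (simp add: h_def)
    next
      case True
      have "measure_pmf.expectation M (\<lambda>x. g l (fl l x) (D l x))
        \<le> exp (- lam) * exp (lam / 2) + mgf l (1 - \<eta>) * exp (- (1/2 - \<eta>) * lam) + exp (- lam / 2)"
      proof (rule expectation_bound[OF l])
        fix b d
        have 1: "exp (- clip lam d / 2) \<le> exp (lam / 2)" using lam_pos by (simp add: clip_def)
        have 2: "exp (- clip lam d / 2) \<le> exp (- lam / 2)" if "lam \<le> d"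
          using lam_pos that by (simp add: clip_def)
        have 3: "exp (- clip lam d / 2) \<le> exp (- (1 - \<eta>) * d) * exp (- (1/2 - \<eta>) * lam)" if "d \<le> - lam"
        proof -
          have "(1 - \<eta>) * lam \<le> (1 - \<eta>) * (- d)" using that \<eta> by (intro mult_left_mono) auto
          moreover have "clip lam d = - lam" using that lam_pos by (simp add: clip_def)
          ultimately show ?thesis by (simp add: exp_add[symmetric] algebra_simps)
        qed
        show "g l b d \<le> of_bool b * exp (lam / 2)
          + of_bool (\<not> b) * exp (- (1 - \<eta>) * d) * exp (- (1/2 - \<eta>) * lam) + exp (- lam / 2)"
        proof (cases b)
          case b: True
          thus ?thesis using 1 True by (simp add: g_def add_increasing2)
        next
          case b: False
          consider "lam \<le> d" | "d \<le> - lam" | "\<bar>d\<bar> < lam" by linarith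
          thus ?thesis
          proof cases
            case 1
            have "0 \<le> exp (- (1 - \<eta>) * d) * exp (- (1/2 - \<eta>) * lam)" by simp
            moreover have "g l b d = exp (- clip lam d / 2)"
              using 1 True lam_pos by (simp add: g_def)
            ultimately show ?thesis using 2[OF 1] b by (simp only: of_bool_eq simp_thms)
          next
            case 2
            have "g l b d = exp (- clip lam d / 2)"
              using 2 True lam_pos by (simp add: g_def)
            moreover have "0 \<le> exp (- lam / 2)" by simp
            ultimately show ?thesis using 3[OF 2] b by (simp only: of_bool_eq simp_thms)
          next
            case 3
            hence "g l b d = 0" using True b by (simp add: g_def)
            thus ?thesis by simp
          qed
        qed
      qed simp
      also have "exp (- lam) * exp (lam / 2) = exp (- lam / 2)"
        by (simp add: exp_add[symmetric])
      finally have "measure_pmf.expectation M (\<lambda>x. g l (fl l x) (D l x))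
        \<le> 2 * exp (- lam / 2) + mgf l (1 - \<eta>) * exp (- (1/2 - \<eta>) * lam)" by simp
      moreover have "exp (- lam / 2) \<le> exp (- (1/2 - \<eta>) * lam)"
        using \<eta> lam_pos by (simp add: algebra_simps)
      moreover have "mgf l (1 - \<eta>) * exp (- (1/2 - \<eta>) * lam) \<le> exp (- (1/2 - \<eta>) * lam)"
        using mgf1(2)[OF l] by (simp add: mult_left_le_one_le mgf_nonneg)
      moreover have "h l = 3 * exp (- (1/2 - \<eta>) * lam)" using True by (simp add: h_def)
      ultimately show ?thesis by linarith
    qed
  qed
  also have "(\<Prod>l<L. h l) = (\<Prod>l\<in>C. h l) * (\<Prod>l\<in>{..<L} - C. h l)"
    using prod.subset_diff[OF C, of h] by simp
  also have "\<dots> = (3 * exp (- (1/2 - \<eta>) * lam)) ^ card C * (1 + 2 * exp (- lam / 2)) ^ card ({..<L} - C)"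
    by (simp add: h_def)
  also have "\<dots> \<le> (3 * exp (- (1/2 - \<eta>) * lam)) ^ card C * (1 + 2 * exp (- lam / 2)) ^ L"
    using card_mono[of "{..<L}" "{..<L} - C"] by (intro mult_left_mono power_increasing) simp_all
  finally show ?thesis .
qed

text \<open>A flipped layer is put into \<open>A\<close> whatever its statistic is, since its
  clipped value is at least \<open>- lam\<close> and nothing better is known. With this convention
  every outcome has a pattern with \<open>A\<close> and \<open>B\<close> disjoint.\<close>

definition pattern :: "nat set \<Rightarrow> nat set \<Rightarrow> 'a set" where
  "pattern A B = {x. (\<forall>l\<in>A. fl l x \<or> D l x \<le> - lam) \<and> (\<forall>l\<in>B. \<not> fl l x \<and> lam \<le> D l x) \<and>
                     (\<forall>l\<in>{..<L} - A - B. \<not> fl l x \<and> \<bar>D l x\<bar> < lam)}"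

text \<open>On the event, \<open>lam * card A - lam * card B\<close> is at least the sum of the
  unclipped statistics, and this inequality is exponentiated with parameter \<open>t\<close>. Layers
  in \<open>A\<close> also pay their probability, layers in \<open>B\<close> only the deterministic
  factor \<open>exp (- t * lam)\<close>.\<close>

lemma prob_err_pattern_le:
  assumes A: "A \<subseteq> {..<L}" and B: "B \<subseteq> {..<L}" and AB: "A \<inter> B = {}"
    and \<eta>: "\<eta> \<le> 1" "0 \<le> \<eta>" and t: "0 \<le> t" and mgf1: "\<And>l. l < L \<Longrightarrow> mgf l (1 - \<eta>) \<le> 1"
  shows "measure_pmf.prob M (err \<inter> pattern A B)
         \<le> exp (t * lam * (real (card A) - real (card B))) * (2 * exp (- (1 - \<eta>) * lam)) ^ card A
            * (\<Prod>l\<in>{..<L} - A - B. mgf l t)"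
proof -
  define S where "S = {..<L} - A - B"
  have fin: "finite A" "finite B" "finite S" using finite_subset[OF A] finite_subset[OF B] by (simp_all add: S_def)
  have L_eq: "{..<L} = (A \<union> B) \<union> S" "(A \<union> B) \<inter> S = {}"
    using A B unfolding S_def by blast+
  have split: "(\<Sum>l<L. f l) = sum f A + sum f B + sum f S" for f :: "nat \<Rightarrow> real"
    unfolding L_eq(1) using fin L_eq(2) AB by (subst sum.union_disjoint) (simp_all add: sum.union_disjoint)
  have psplit: "(\<Prod>l<L. f l) = prod f A * prod f B * prod f S" for f :: "nat \<Rightarrow> real"
    unfolding L_eq(1) using fin L_eq(2) AB by (subst prod.union_disjoint) (simp_all add: prod.union_disjoint)
  define g where "g l b d = (if l \<in> A then exp (t * lam) * of_bool (b \<or> d \<le> - lam)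
      else if l \<in> B then exp (- t * lam) else of_bool (\<not> b) * exp (- t * d))"
    for l :: nat and b and d :: real
  define h where "h l = (if l \<in> A then exp (t * lam) * (2 * exp (- (1 - \<eta>) * lam))
      else if l \<in> B then exp (- t * lam) else mgf l t)" for l
  have "measure_pmf.prob M (err \<inter> pattern A B) \<le> (\<Prod>l<L. h l)"
  proof (rule prob_le_prod[where g = g])
    show "0 \<le> g l b d" for l b d by (simp add: g_def)
    fix x assume x: "x \<in> err \<inter> pattern A B"
    have "(\<Prod>l\<in>A. g l (fl l x) (D l x)) = (\<Prod>l\<in>A. exp (t * lam))"
      using x by (intro prod.cong) (auto simp: g_def pattern_def)
    moreover have "(\<Prod>l\<in>B. g l (fl l x) (D l x)) = (\<Prod>l\<in>B. exp (- t * lam))"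
      using AB by (intro prod.cong) (auto simp: g_def)
    moreover have "(\<Prod>l\<in>S. g l (fl l x) (D l x)) = (\<Prod>l\<in>S. exp (- t * D l x))"
      using x by (intro prod.cong) (auto simp: g_def pattern_def S_def)
    ultimately have eq: "(\<Prod>l<L. g l (fl l x) (D l x))
       = exp (t * (lam * card A - lam * card B - (\<Sum>l\<in>S. D l x)))"
      unfolding psplit exp_sum[OF fin(3), symmetric]
      by (simp add: exp_of_nat_mult[symmetric] exp_add[symmetric] sum_negf sum_distrib_left[symmetric] algebra_simps)
    have "- lam * card A = (\<Sum>l\<in>A. - lam)" by simp
    also have "\<dots> \<le> (\<Sum>l\<in>A. clip lam (D l x))" by (intro sum_mono) (auto simp: clip_def)
    finally have "- lam * card A \<le> (\<Sum>l\<in>A. clip lam (D l x))" .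
    moreover have "(\<Sum>l\<in>B. clip lam (D l x)) = (\<Sum>l\<in>B. lam)"
      using x lam_pos by (intro sum.cong) (auto simp: clip_def pattern_def)
    moreover have "(\<Sum>l\<in>S. clip lam (D l x)) = (\<Sum>l\<in>S. D l x)"
    proof (rule sum.cong)
      fix l assume "l \<in> S"
      hence "\<bar>D l x\<bar> < lam" using x by (simp add: pattern_def S_def)
      thus "clip lam (D l x) = D l x" by (auto simp: clip_def abs_less_iff min_def max_def)
    qed simp
    moreover have "(\<Sum>l<L. clip lam (D l x)) \<le> 0" using x by (simp add: err_def)
    ultimately have "0 \<le> lam * card A - lam * card B - (\<Sum>l\<in>S. D l x)"
      unfolding split by (simp add: mult.commute)
    thus "1 \<le> (\<Prod>l<L. g l (fl l x) (D l x))" unfolding eq using t by simp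
  next
    fix l assume l: "l < L"
    consider "l \<in> A" | "l \<notin> A" "l \<in> B" | "l \<notin> A" "l \<notin> B" by blast
    thus "measure_pmf.expectation M (\<lambda>x. g l (fl l x) (D l x)) \<le> h l"
    proof cases
      case 1
      \<comment> \<open>The flip and the saturation at \<open>- lam\<close>, the latter by Markov
        with tilt \<open>1 - \<eta>\<close>, are charged separately; this gives the factor
        2.\<close>
      have "measure_pmf.expectation M (\<lambda>x. of_bool (fl l x \<or> D l x \<le> - lam))
         \<le> exp (- lam) * 1 + mgf l (1 - \<eta>) * exp (- (1 - \<eta>) * lam) + 0"
      proof (rule expectation_bound[OF l, where g = "\<lambda>b d. of_bool (b \<or> d \<le> - lam)"])
        fix b and d :: real
        have "1 \<le> exp (- (1 - \<eta>) * d) * exp (- (1 - \<eta>) * lam)" if "d \<le> - lam"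
        proof -
          have "0 \<le> (1 - \<eta>) * (- d - lam)" using that \<eta> by (intro mult_nonneg_nonneg) auto
          thus ?thesis by (simp add: exp_add[symmetric] algebra_simps)
        qed
        thus "of_bool (b \<or> d \<le> - lam) \<le> of_bool b * 1
          + of_bool (\<not> b) * exp (- (1 - \<eta>) * d) * exp (- (1 - \<eta>) * lam) + 0" by auto
      qed simp
      also have "\<dots> \<le> 2 * exp (- (1 - \<eta>) * lam)"
      proof -
        have "exp (- lam) \<le> exp (- (1 - \<eta>) * lam)" using \<eta> lam_pos by (simp add: algebra_simps)
        moreover have "mgf l (1 - \<eta>) * exp (- (1 - \<eta>) * lam) \<le> exp (- (1 - \<eta>) * lam)"
          using mgf1[OF l] by (simp add: mult_left_le_one_le mgf_nonneg)
        ultimately show ?thesis by linarith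
      qed
      finally show ?thesis using 1 by (simp add: g_def h_def)
    next
      case 2 thus ?thesis by (simp add: g_def h_def)
    next
      case 3 thus ?thesis by (simp add: g_def h_def mgf_def)
    qed
  qed
  also have "(\<Prod>l<L. h l) = (\<Prod>l\<in>A. exp (t * lam) * (2 * exp (- (1 - \<eta>) * lam))) * (\<Prod>l\<in>B. exp (- t * lam))
      * (\<Prod>l\<in>S. mgf l t)"
    unfolding psplit using AB by (intro arg_cong2[where f = "(*)"] prod.cong) (auto simp: h_def S_def)
  also have "\<dots> = exp (t * lam) ^ card A * exp (- t * lam) ^ card B * (2 * exp (- (1 - \<eta>) * lam)) ^ card A
      * (\<Prod>l\<in>S. mgf l t)"
    by (simp add: power_mult_distrib mult_ac)
  also have "exp (t * lam) ^ card A * exp (- t * lam) ^ card B = exp (t * lam * (real (card A) - real (card B)))"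
    by (simp add: exp_of_nat_mult[symmetric] exp_add[symmetric] algebra_simps)
  finally show ?thesis by (simp add: S_def)
qed

end

section \<open>Comparison with the optimal rate\<close>

lemma minIS_le_IS: "S \<subseteq> {..<L} \<Longrightarrow> minIS n L p q \<rho> \<le> IS n L p q \<rho> S"
  unfolding minIS_def by (intro Min_le) auto

lemma card_small_subsets:
  fixes L :: nat
  assumes "1 \<le> L"
  shows "card {A. A \<subseteq> {..<L} \<and> card A < K} \<le> K * L ^ K"
proof -
  have "{A. A \<subseteq> {..<L} \<and> card A < K} = (\<Union>j<K. {A. A \<subseteq> {..<L} \<and> card A = j})" by auto
  also have "card \<dots> \<le> (\<Sum>j<K. card {A. A \<subseteq> {..<L} \<and> card A = j})" by (rule card_UN_le) simp
  also have "\<dots> \<le> (\<Sum>j<K. L ^ K)"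
  proof (rule sum_mono)
    fix j assume j: "j \<in> {..<K}"
    have "card {A. A \<subseteq> {..<L} \<and> card A = j} = L choose j" using n_subsets[of "{..<L}" j] by simp
    also have "\<dots> \<le> L ^ j" by (cases "j \<le> L") (simp_all add: binomial_le_pow binomial_eq_0)
    also have "\<dots> \<le> L ^ K" using j assms by (intro power_increasing) auto
    finally show "card {A. A \<subseteq> {..<L} \<and> card A = j} \<le> L ^ K" .
  qed
  finally show ?thesis by simp
qed

context
  fixes n L :: nat and p q :: "nat \<Rightarrow> real" and \<rho> :: real
  assumes pq: "\<And>l. l < L \<Longrightarrow> 0 < q l \<and> q l < p l \<and> p l < 1"
    and J_nonneg: "0 \<le> Jrho \<rho>"
begin

private abbreviation (input) "J \<equiv> Jrho \<rho>"
private abbreviation (input) "r \<equiv> rate_layer n p q"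
private abbreviation (input) "I \<equiv> minIS n L p q \<rho>"

lemma pq_bounds: "l < L \<Longrightarrow> 0 < p l" "l < L \<Longrightarrow> p l < 1" "l < L \<Longrightarrow> 0 < q l" "l < L \<Longrightarrow> q l < 1"
  using pq[of l] by linarith+

lemma rate_nonneg: "l < L \<Longrightarrow> 0 \<le> t \<Longrightarrow> t \<le> 1 \<Longrightarrow> 0 \<le> r l t"
  unfolding rate_layer_def using pq_bounds by (intro mult_nonneg_nonneg Ilayer_nonneg) auto

text \<open>With \<open>S\<close> the layers whose rate at 1/2 is at most \<open>J\<close>, the sum
  is \<open>k * J\<close> plus the rates on \<open>S\<close>. The rate of this \<open>S\<close>
  exceeds that by at most the additional \<open>J\<close> of the odd case.\<close>

lemma sum_min_ge_minIS: "I - J \<le> (\<Sum>l<L. min (r l (1/2)) J)"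
proof -
  define S where "S = {l. l < L \<and> r l (1/2) \<le> J}"
  define k where "k = card ({..<L} - S)"
  have S: "S \<subseteq> {..<L}" by (auto simp: S_def)
  have "(\<Sum>l<L. min (r l (1/2)) J)
      = (\<Sum>l\<in>{..<L} - S. min (r l (1/2)) J) + (\<Sum>l\<in>S. min (r l (1/2)) J)"
    using S by (intro sum.subset_diff) auto
  also have "(\<Sum>l\<in>{..<L} - S. min (r l (1/2)) J) = (\<Sum>l\<in>{..<L} - S. J)"
    by (intro sum.cong) (auto simp: S_def)
  also have "(\<Sum>l\<in>S. min (r l (1/2)) J) = (\<Sum>l\<in>S. r l (1/2))"
    by (intro sum.cong) (auto simp: S_def)
  finally have sum_eq: "(\<Sum>l<L. min (r l (1/2)) J) = real k * J + (\<Sum>l\<in>S. r l (1/2))"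
    by (simp add: k_def)
  have "psiS_star n p q S a \<le> (\<Sum>l\<in>S. r l (1/2))" if "a \<le> 0" for a
    using pq S that by (intro psiS_star_le_half) auto
  from this[of 0] this[of "- 2 * J"] have "IS n L p q \<rho> S \<le> real k * J + J + (\<Sum>l\<in>S. r l (1/2))"
    using J_nonneg by (auto simp: IS_def k_def[symmetric] Let_def algebra_simps)
  thus ?thesis using minIS_le_IS[OF S, of n p q \<rho>] sum_eq by linarith
qed

text \<open>The Chernoff parameter \<open>t\<close> is the maximiser in \<open>psiS_star\<close>, moved into \<open>[\<eta>, 1/2]\<close>;
  when more layers saturate at \<open>lam\<close> than at \<open>- lam\<close>, it is reflected at \<open>1/2\<close>.\<close>

lemma pattern_exponent_half:
  assumes m: "b < m" and odd: "odd (m + b)" and lam: "2 * J \<le> lam" and \<eta>: "0 \<le> \<eta>" "\<eta> \<le> 1/2"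
    and S: "S \<subseteq> {..<L}" "card ({..<L} - S) = m + b"
  obtains t where "\<eta> \<le> t" "t \<le> 1/2"
    "(1 - 2 * \<eta>) * I \<le> lam * (real m * (1 - t) + real b * t) + (\<Sum>l\<in>S. r l t)"
proof -
  have pqS: "\<And>l. l \<in> S \<Longrightarrow> 0 < q l \<and> q l < p l \<and> p l < 1" using pq S by auto
  have J2: "- 2 * J \<le> 0" using J_nonneg by simp
  obtain s where s: "0 \<le> s" "s \<le> 1/2"
    "psiS_star n p q S (- 2 * J) \<le> - 2 * J * s + (\<Sum>l\<in>S. r l s)"
    by (rule psiS_star_attained[where n = n, OF pqS J2])
  define t where "t = max s \<eta>"
  have t: "s \<le> t" "\<eta> \<le> t" "t \<le> 1/2" "t \<le> s + \<eta>" using s \<eta> by (auto simp: t_def)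
  define k where "k = m + b"
  have k: "1 \<le> real k" using m by (simp add: k_def)
  have "real m * (1 - t) + real b * t = real m * (1 - 2 * t) + real k * t"
    by (simp add: k_def algebra_simps)
  \<comment> \<open>\<open>b < m\<close> gives \<open>2 * m >= k + 1\<close>, and
    \<open>1 - 2 * t\<close> is nonnegative.\<close>
  also have "\<dots> \<ge> (real k + 1) / 2 * (1 - 2 * t) + real k * t"
    using m t by (intro add_mono mult_right_mono) (auto simp: k_def)
  also have "(real k + 1) / 2 * (1 - 2 * t) + real k * t = (real k + 1) / 2 - t"
    by (simp add: field_simps)
  finally have X: "(real k + 1) / 2 - t \<le> real m * (1 - t) + real b * t" .
  have "(real k + 1) * J - 2 * J * t = 2 * J * ((real k + 1) / 2 - t)"
    by (simp add: field_simps)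
  also have "\<dots> \<le> 2 * J * (real m * (1 - t) + real b * t)"
    using X J_nonneg by (intro mult_left_mono) auto
  also have "\<dots> \<le> lam * (real m * (1 - t) + real b * t)"
    using lam t \<eta> by (intro mult_right_mono) auto
  finally have X2: "(real k + 1) * J - 2 * J * t \<le> lam * (real m * (1 - t) + real b * t)" .
  \<comment> \<open>\<open>Y\<close> is the part of the rate due to \<open>J\<close> at the
    maximiser \<open>s\<close>. Raising \<open>s\<close> to \<open>t\<close> loses at most
    \<open>2 * J * \<eta>\<close>, a relative loss because \<open>J <= Y\<close>; the layer rates
    can only grow, being increasing on [0, 1/2].\<close>
  define Y where "Y = (real k + 1) * J - 2 * J * s"
  have "J * t \<le> J * (s + \<eta>)" using J_nonneg t by (intro mult_left_mono) auto
  hence X3: "Y - 2 * J * \<eta> \<le> lam * (real m * (1 - t) + real b * t)"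
    using X2 by (simp add: Y_def algebra_simps)
  have "J * s \<le> J * (1/2)" using J_nonneg s by (intro mult_left_mono) auto
  moreover have "2 * J \<le> (real k + 1) * J" using k J_nonneg by (intro mult_right_mono) auto
  ultimately have "J \<le> Y" by (simp add: Y_def)
  hence "2 * \<eta> * J \<le> 2 * \<eta> * Y" using \<eta> by (intro mult_left_mono) auto
  hence X4: "(1 - 2 * \<eta>) * Y \<le> lam * (real m * (1 - t) + real b * t)"
    using X3 by (simp add: algebra_simps)
  have r0: "0 \<le> (\<Sum>l\<in>S. r l s)" using S s by (intro sum_nonneg rate_nonneg) auto
  have "(1 - 2 * \<eta>) * (\<Sum>l\<in>S. r l s) \<le> 1 * (\<Sum>l\<in>S. r l s)"
    using r0 \<eta> by (intro mult_right_mono) auto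
  also have "1 * (\<Sum>l\<in>S. r l s) \<le> (\<Sum>l\<in>S. r l t)"
    unfolding rate_layer_def mult_1 using S t pq_bounds
    by (intro sum_mono mult_left_mono Ilayer_mono_half) auto
  finally have X5: "(1 - 2 * \<eta>) * (\<Sum>l\<in>S. r l s) \<le> (\<Sum>l\<in>S. r l t)" .
  have "I \<le> IS n L p q \<rho> S" by (rule minIS_le_IS[OF S(1)])
  also have "IS n L p q \<rho> S = (real k + 1) * J + psiS_star n p q S (- 2 * J)"
    using odd by (auto simp: IS_def S(2) Let_def k_def algebra_simps)
  also have "\<dots> \<le> Y + (\<Sum>l\<in>S. r l s)"
    using s(3) by (simp add: Y_def)
  finally have "(1 - 2 * \<eta>) * I \<le> (1 - 2 * \<eta>) * (Y + (\<Sum>l\<in>S. r l s))"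
    using \<eta> by (intro mult_left_mono) auto
  also have "\<dots> \<le> lam * (real m * (1 - t) + real b * t) + (\<Sum>l\<in>S. r l t)"
    using X4 X5 by (simp add: distrib_left)
  finally show thesis using t by (intro that[of t]) auto
qed

text \<open>The left-hand side of the last inequality is the exponent supplied by
  \<open>prob_err_pattern_le\<close>. For even \<open>m + b\<close> the choice 1/2 weights each
  saturated layer by \<open>lam / 2\<close>; for odd \<open>m + b\<close> the majority among
  \<open>m\<close> and \<open>b\<close> decides the side of 1/2 on which \<open>t\<close>
  lies.\<close>

lemma pattern_exponent:
  assumes lam: "2 * J \<le> lam" "0 < lam" and \<eta>: "0 \<le> \<eta>" "\<eta> \<le> 1/2" and I: "0 \<le> I"
    and S: "S \<subseteq> {..<L}" "card ({..<L} - S) = m + b"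
  obtains t where "\<eta> \<le> t" "t \<le> 1 - \<eta>"
    "t * lam * (real m - real b) - (1 - \<eta>) * lam * real m - (1 - \<eta>) * (\<Sum>l\<in>S. r l t) \<le> - (1 - 4 * \<eta>) * I"
proof -
  obtain t where t: "\<eta> \<le> t" "t \<le> 1 - \<eta>" "(b \<le> m \<and> t \<le> 1/2) \<or> (m \<le> b \<and> 1/2 \<le> t)"
    and E: "(1 - 2 * \<eta>) * I \<le> lam * (real m * (1 - t) + real b * t) + (\<Sum>l\<in>S. r l t)"
  proof -
    consider "even (m + b)" | "odd (m + b)" "b < m" | "odd (m + b)" "m < b"
      by (metis even_add linorder_neqE_nat)
    thus thesis
    proof cases
      case 1
      have "\<And>l. l \<in> S \<Longrightarrow> 0 < q l \<and> q l < p l \<and> p l < 1" using pq S by auto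
      hence "psiS_star n p q S 0 \<le> (\<Sum>l\<in>S. r l (1/2))" by (rule psiS_star_le_half) simp_all
      hence "IS n L p q \<rho> S \<le> real (m + b) * J + (\<Sum>l\<in>S. r l (1/2))"
        using 1 by (simp add: IS_def S(2) Let_def)
      also have "real (m + b) * J \<le> real (m + b) * (lam / 2)"
        using lam by (intro mult_left_mono) auto
      finally have "I \<le> real (m + b) * (lam / 2) + (\<Sum>l\<in>S. r l (1/2))"
        using minIS_le_IS[OF S(1), of n p q \<rho>] by linarith
      moreover have "(1 - 2 * \<eta>) * I \<le> I"
        using I \<eta> by (intro mult_left_le_one_le) auto
      ultimately have "(1 - 2 * \<eta>) * I \<le> lam * (real m * (1 - 1/2) + real b * (1/2)) + (\<Sum>l\<in>S. r l (1/2))"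
        by (simp add: algebra_simps add_divide_distrib)
      thus thesis using \<eta> by (intro that[of "1/2"]) auto
    next
      case 2
      then obtain t where t: "\<eta> \<le> t" "t \<le> 1/2"
        "(1 - 2 * \<eta>) * I \<le> lam * (real m * (1 - t) + real b * t) + (\<Sum>l\<in>S. r l t)"
        using pattern_exponent_half[OF 2(2,1) lam(1) \<eta> S] by blast
      thus thesis using 2 \<eta> by (intro that[of t]) auto
    next
      case 3
      have *: "odd (b + m)" "card ({..<L} - S) = b + m" using 3 S by (simp_all add: add.commute)
      obtain t where t: "\<eta> \<le> t" "t \<le> 1/2"
        "(1 - 2 * \<eta>) * I \<le> lam * (real b * (1 - t) + real m * t) + (\<Sum>l\<in>S. r l t)"
        using pattern_exponent_half[OF 3(2) *(1) lam(1) \<eta> S(1) *(2)] by blast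
      have "(\<Sum>l\<in>S. r l (1 - t)) = (\<Sum>l\<in>S. r l t)"
        by (simp add: rate_layer_def Ilayer_sym)
      thus thesis using 3 \<eta> t by (intro that[of "1 - t"]) (auto simp: add.commute)
    qed
  qed
  define X where "X = lam * (real m * (1 - t) + real b * t)"
  define R where "R = (\<Sum>l\<in>S. r l t)"
  have R: "0 \<le> R" unfolding R_def using S t \<eta> by (intro sum_nonneg rate_nonneg) auto
  \<comment> \<open>As \<open>t\<close> lies on the side of 1/2 matching the majority, the loss
    \<open>\<eta> * lam * m\<close> from using tilt \<open>1 - \<eta>\<close> instead of 1 is at
    most a fraction \<open>2 * \<eta>\<close> of \<open>X\<close>.\<close>
  have "real m \<le> 2 * (real m * (1 - t) + real b * t)"
    using t(3)
  proof
    assume *: "b \<le> m \<and> t \<le> 1/2"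
    have "real m * t \<le> real m * (1/2)" using * by (intro mult_left_mono) auto
    moreover have "0 \<le> real b * t" using t \<eta> by simp
    ultimately show ?thesis by (simp add: algebra_simps)
  next
    assume *: "m \<le> b \<and> 1/2 \<le> t"
    have "real m * t \<le> real b * t" using * by (intro mult_right_mono) auto
    thus ?thesis by (simp add: algebra_simps)
  qed
  hence "\<eta> * lam * real m \<le> \<eta> * lam * (2 * (real m * (1 - t) + real b * t))"
    using \<eta> lam by (intro mult_left_mono) auto
  hence 1: "\<eta> * lam * real m \<le> 2 * \<eta> * X" by (simp add: X_def mult_ac)
  have "0 \<le> \<eta> * R" using R \<eta> by simp
  have "t * lam * (real m - real b) - (1 - \<eta>) * lam * real m - (1 - \<eta>) * R
      = - X + \<eta> * lam * real m - (1 - \<eta>) * R"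
    by (simp add: X_def algebra_simps)
  also have "\<dots> \<le> - ((1 - 2 * \<eta>) * (X + R))"
    using 1 \<open>0 \<le> \<eta> * R\<close> by (simp add: algebra_simps)
  also have "\<dots> \<le> - ((1 - 2 * \<eta>) * ((1 - 2 * \<eta>) * I))"
    using E \<eta> unfolding X_def R_def by (intro le_imp_neg_le mult_left_mono) auto
  also have "\<dots> \<le> - (1 - 4 * \<eta>) * I"
    using I \<eta> mult_nonneg_nonneg[of "4 * \<eta> * \<eta>" I] by (simp add: algebra_simps)
  finally show thesis using t(1,2) by (intro that[of t]) (auto simp: R_def)
qed

end

section \<open>Error bounds in the two regimes of \<open>Jrho\<close>\<close>

context indep_layers
begin

text \<open>With parameter 1/2 a layer contributes about \<open>exp (- min rate J)\<close>. The
  defect \<open>J\<close> in \<open>sum_min_ge_minIS\<close> is harmless since it is at most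
  \<open>\<eta> * I\<close>.\<close>

lemma prob_err_le_many_layers:
  assumes pq: "\<And>l. l < L \<Longrightarrow> 0 < q l \<and> q l < p l \<and> p l < 1"
    and J: "0 \<le> Jrho \<rho>" "2 * Jrho \<rho> \<le> lam"
    and mgf: "\<And>l. l < L \<Longrightarrow> mgf l (1/2) \<le> exp (- (1 - \<eta>) * rate_layer n p q l (1/2))"
    and \<eta>: "0 \<le> \<eta>" "\<eta> \<le> 1" and c': "c' \<le> 1"
    and J_large: "2 \<le> \<eta> * (1 - \<eta>) * (1 - c') * Jrho \<rho>"
    and I: "Jrho \<rho> \<le> \<eta> * minIS n L p q \<rho>" "2 * (real L * exp (- c' * Jrho \<rho>)) \<le> \<eta> * minIS n L p q \<rho>"
  shows "measure_pmf.prob M err \<le> exp (- (1 - 4 * \<eta>) * minIS n L p q \<rho>)"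
proof -
  define J where "J = Jrho \<rho>"
  define I where "I = minIS n L p q \<rho>"
  define u where "u l = min (rate_layer n p q l (1/2)) J" for l
  have u: "0 \<le> u l" if "l < L" for l
    using rate_nonneg[OF pq J(1) that, where n = n and t = "1/2"] J by (simp add: u_def J_def)
  have step: "mgf l (1/2) + 2 * exp (- lam / 2) \<le> exp (- (1 - \<eta>)\<^sup>2 * u l + 2 * exp (- c' * J))" if l: "l < L" for l
  proof -
    define x where "x = (1 - \<eta>) * u l"
    have x: "0 \<le> x" "x \<le> u l"
      using u[OF l] \<eta> mult_left_le_one_le[of "u l" "1 - \<eta>"] by (simp_all add: x_def)
    have uJ: "u l \<le> J" "u l \<le> rate_layer n p q l (1/2)" by (simp_all add: u_def)
    have "mgf l (1/2) \<le> exp (- (1 - \<eta>) * rate_layer n p q l (1/2))" by (rule mgf[OF l])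
    also have "\<dots> \<le> exp (- x)"
      using mult_left_mono[OF uJ(2), of "1 - \<eta>"] \<eta>
      by (simp only: exp_le_cancel_iff mult_minus_left neg_le_iff_le x_def diff_ge_0_iff_ge)
    finally have 1: "mgf l (1/2) \<le> exp (- x)" .
    have 2: "exp (- lam / 2) \<le> exp (- x) * exp (x - J)" using J by (simp add: J_def exp_add[symmetric])
    have "mgf l (1/2) + 2 * exp (- lam / 2) \<le> exp (- x) * (1 + 2 * exp (x - J))"
      using 1 2 by (simp add: distrib_left)
    also have "\<dots> \<le> exp (- x) * exp (2 * exp (x - J))" by (intro mult_left_mono exp_ge_add_one_self) auto
    also have "\<dots> = exp (- x + 2 * exp (x - J))" by (rule exp_add[symmetric])
    also have "- x + 2 * exp (x - J) \<le> - (1 - \<eta>) * x + 2 * exp (- c' * J)"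
    \<comment> \<open>Well below \<open>J\<close>, the correction is at most
      \<open>exp (- c' * J)\<close> per layer, and the sum of these over the layers is assumed
      small. Close to \<open>J\<close> it may be of order one, but then
      \<open>\<eta> * x >= 2\<close> absorbs it.\<close>
    proof (cases "u l \<le> (1 - c') * J")
      case True
      hence "exp (x - J) \<le> exp (- c' * J)" using x by (simp add: algebra_simps)
      moreover have "0 \<le> \<eta> * x" using x \<eta> by simp
      moreover have "- (1 - \<eta>) * x = - x + \<eta> * x" by (simp add: algebra_simps)
      ultimately show ?thesis by linarith
    next
      case False
      hence "\<eta> * ((1 - \<eta>) * ((1 - c') * J)) \<le> \<eta> * x" unfolding x_def
        using \<eta> by (intro mult_left_mono) auto
      hence "2 \<le> \<eta> * x" using J_large by (simp add: J_def mult_ac)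
      moreover have "exp (x - J) \<le> 1" using x uJ by simp
      moreover have "0 \<le> exp (- c' * J)" by simp
      moreover have "- (1 - \<eta>) * x = - x + \<eta> * x" by (simp add: algebra_simps)
      ultimately show ?thesis by linarith
    qed
    also have "- (1 - \<eta>) * x = - (1 - \<eta>)\<^sup>2 * u l" by (simp add: x_def power2_eq_square algebra_simps)
    finally show ?thesis by this simp
  qed
  have "measure_pmf.prob M err \<le> (\<Prod>l<L. mgf l (1/2) + 2 * exp (- lam / 2))"
    by (rule prob_err_le_half)
  also have "\<dots> \<le> (\<Prod>l<L. exp (- (1 - \<eta>)\<^sup>2 * u l + 2 * exp (- c' * J)))"
    using step mgf_nonneg by (intro prod_mono) auto
  also have "\<dots> = exp (\<Sum>l<L. - (1 - \<eta>)\<^sup>2 * u l + 2 * exp (- c' * J))"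
    by (rule exp_sum[symmetric]) simp
  finally have P: "measure_pmf.prob M err \<le> exp (\<Sum>l<L. - (1 - \<eta>)\<^sup>2 * u l + 2 * exp (- c' * J))" .
  have "(\<Sum>l<L. - (1 - \<eta>)\<^sup>2 * u l + 2 * exp (- c' * J))
     = - (1 - \<eta>)\<^sup>2 * (\<Sum>l<L. u l) + 2 * (real L * exp (- c' * J))"
    by (simp add: sum_subtractf sum_distrib_left[symmetric])
  also have "\<dots> \<le> - (1 - \<eta>)\<^sup>2 * ((1 - \<eta>) * I) + \<eta> * I"
  proof (intro add_mono)
    have "(1 - \<eta>) * I \<le> I - J" using I by (simp add: I_def J_def algebra_simps)
    also have "\<dots> \<le> (\<Sum>l<L. u l)" using sum_min_ge_minIS[OF pq J(1), where n = n] by (simp add: u_def I_def J_def)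
    finally show "- (1 - \<eta>)\<^sup>2 * (\<Sum>l<L. u l) \<le> - (1 - \<eta>)\<^sup>2 * ((1 - \<eta>) * I)"
      by (intro mult_left_mono_neg) auto
  qed (use I in \<open>simp add: I_def J_def\<close>)
  also have "\<dots> \<le> - (1 - 4 * \<eta>) * I"
  proof -
    have "0 \<le> J" using J by (simp add: J_def)
    have I0: "0 \<le> \<eta> * I" using \<open>0 \<le> J\<close> I by (simp add: I_def J_def)
    \<comment> \<open>This is the gap between the cube of \<open>1 - \<eta>\<close> and
      \<open>1 - 3 * \<eta>\<close>, times \<open>I\<close>.\<close>
    have "0 \<le> (\<eta> * I) * (\<eta> * (3 - \<eta>))"
      using mult_nonneg_nonneg[OF I0, of "\<eta> * (3 - \<eta>)"] \<eta> by simp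
    hence "(1 - 3 * \<eta>) * I \<le> (1 - \<eta>)\<^sup>2 * ((1 - \<eta>) * I)"
      by (simp add: algebra_simps power2_eq_square power3_eq_cube)
    thus ?thesis by (simp add: algebra_simps)
  qed
  finally have "exp (\<Sum>l<L. - (1 - \<eta>)\<^sup>2 * u l + 2 * exp (- c' * J)) \<le> exp (- (1 - 4 * \<eta>) * I)"
    by (simp only: exp_le_cancel_iff)
  with P show ?thesis unfolding I_def by linarith
qed

text \<open>Since \<open>I <= K * J\<close>, the event that some \<open>K\<close> layers are flipped
  or saturated is already rare enough with the crude cost, so only patterns with
  \<open>card A + card B < K\<close> need the exact exponent. Both unions have a number of members
  polynomial in \<open>L\<close> with degree fixed by \<open>K\<close>, which the bound on
  \<open>ln (3 * real L)\<close> pays for.\<close>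

lemma prob_err_le_few_layers:
  assumes pq: "\<And>l. l < L \<Longrightarrow> 0 < q l \<and> q l < p l \<and> p l < 1"
    and J: "0 \<le> Jrho \<rho>" "2 * Jrho \<rho> \<le> lam"
    and mgf: "\<And>l t. l < L \<Longrightarrow> \<eta> \<le> t \<Longrightarrow> t \<le> 1 - \<eta> \<Longrightarrow> mgf l t \<le> exp (- (1 - \<eta>) * rate_layer n p q l t)"
    and \<eta>: "0 \<le> \<eta>" "\<eta> \<le> 1/2" and L: "1 \<le> L" and K: "1 \<le> K"
    and I: "0 \<le> minIS n L p q \<rho>" "minIS n L p q \<rho> \<le> real K * Jrho \<rho>"
      "2 * (real L * exp (- Jrho \<rho>)) \<le> \<eta> * minIS n L p q \<rho>"
      "2 * real K * ln (3 * real L) + 2 * ln (real K) + ln 2 \<le> \<eta> * minIS n L p q \<rho>"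
  shows "measure_pmf.prob M err \<le> exp (- (1 - 6 * \<eta>) * minIS n L p q \<rho>)"
proof -
  define J where "J = Jrho \<rho>"
  define I where "I = minIS n L p q \<rho>"
  have I0: "0 \<le> I" "I \<le> real K * J" using I by (simp_all add: I_def J_def)
  have ln3L: "ln (3 * real L) = ln 3 + ln (real L)" using L by (simp add: ln_mult)
  have pos: "0 < real L" "0 < real K" "0 \<le> ln (real L)" "0 \<le> ln (real K)" using L K by simp_all
  have rate0: "0 \<le> rate_layer n p q l t" if "l < L" "0 \<le> t" "t \<le> 1" for l t
    using rate_nonneg[OF pq J(1) that, where n = n] by simp
  have mgf1: "mgf l t \<le> 1" if "l < L" "\<eta> \<le> t" "t \<le> 1 - \<eta>" for l t
  proof -
    have "0 \<le> (1 - \<eta>) * rate_layer n p q l t"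
      using that \<eta> rate0[of l t] by (intro mult_nonneg_nonneg) auto
    hence "- (1 - \<eta>) * rate_layer n p q l t \<le> 0" by (simp only: mult_minus_left neg_le_0_iff_le)
    hence "exp (- (1 - \<eta>) * rate_layer n p q l t) \<le> 1" by (simp only: exp_le_one_iff)
    thus ?thesis using mgf[OF that] by linarith
  qed
  define sat where "sat x = {l. l < L \<and> (fl l x \<or> lam \<le> \<bar>D l x\<bar>)}" for x
  define \<C> where "\<C> = {C. C \<subseteq> {..<L} \<and> card C = K}"
  define \<P> where "\<P> = {(A, B). A \<subseteq> {..<L} \<and> B \<subseteq> {..<L} \<and> A \<inter> B = {} \<and> card A + card B < K}"
  define ev1 where "ev1 C = {x \<in> err. \<forall>l\<in>C. fl l x \<or> lam \<le> \<bar>D l x\<bar>}" for C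
  define ev2 where "ev2 = (\<lambda>(A, B). err \<inter> pattern A B)"
  have "\<C> \<subseteq> Pow {..<L}" "\<P> \<subseteq> Pow {..<L} \<times> Pow {..<L}" by (auto simp: \<C>_def \<P>_def)
  hence fin: "finite \<C>" "finite \<P>" by (simp_all add: finite_subset)
  have "err \<subseteq> (\<Union>C\<in>\<C>. ev1 C) \<union> (\<Union>P\<in>\<P>. ev2 P)"
  proof
    fix x assume x: "x \<in> err"
    show "x \<in> (\<Union>C\<in>\<C>. ev1 C) \<union> (\<Union>P\<in>\<P>. ev2 P)"
    proof (cases "K \<le> card (sat x)")
      case True
      then obtain C where C: "C \<subseteq> sat x" "card C = K"
        by (rule obtain_subset_with_card_n)
      have "C \<in> \<C>" "x \<in> ev1 C" using C x by (auto simp: \<C>_def ev1_def sat_def)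
      thus ?thesis by blast
    next
      case False
      define A where "A = {l. l < L \<and> (fl l x \<or> D l x \<le> - lam)}"
      define B where "B = {l. l < L \<and> \<not> fl l x \<and> lam \<le> D l x}"
      have AB: "A \<inter> B = {}" "finite A" "finite B" using lam_pos by (auto simp: A_def B_def)
      have "sat x = A \<union> B" by (auto simp: sat_def A_def B_def abs_real_def split: if_splits)
      hence "card A + card B < K" using False AB by (simp add: card_Un_disjoint)
      hence "(A, B) \<in> \<P>" using AB by (auto simp: \<P>_def A_def B_def)
      moreover have "x \<in> pattern A B"
        by (auto simp: pattern_def A_def B_def abs_less_iff not_le)
      ultimately show ?thesis using x by (auto simp: ev2_def)
    qed
  qed
  hence "measure_pmf.prob M err \<le> measure_pmf.prob M ((\<Union>C\<in>\<C>. ev1 C) \<union> (\<Union>P\<in>\<P>. ev2 P))"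
    by (intro measure_pmf.finite_measure_mono) auto
  also have "\<dots> \<le> measure_pmf.prob M (\<Union>C\<in>\<C>. ev1 C) + measure_pmf.prob M (\<Union>P\<in>\<P>. ev2 P)"
    by (intro measure_Un_le) auto
  also have "\<dots> \<le> (\<Sum>C\<in>\<C>. measure_pmf.prob M (ev1 C)) + (\<Sum>P\<in>\<P>. measure_pmf.prob M (ev2 P))"
    using fin by (intro add_mono measure_UNION_le) auto
  also have "(\<Sum>C\<in>\<C>. measure_pmf.prob M (ev1 C)) \<le> exp (- (1 - 6 * \<eta>) * I) / 2"
  proof -
    \<comment> \<open>\<open>lam / 2 >= J\<close> and \<open>K * J >= I\<close> turn the
      \<open>K\<close> factors into the exponent; the layers outside \<open>C\<close> contribute the
      term \<open>\<eta> * I\<close>.\<close>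
    have "measure_pmf.prob M (ev1 C) \<le> exp (real K * ln 3 - (1 - 2 * \<eta>) * I + \<eta> * I)" if C: "C \<in> \<C>" for C
    proof -
      have "measure_pmf.prob M (ev1 C)
         \<le> (3 * exp (- (1/2 - \<eta>) * lam)) ^ card C * (1 + 2 * exp (- lam / 2)) ^ L"
        unfolding ev1_def using C \<eta> mgf1 by (intro prob_err_saturated_le) (auto simp: \<C>_def)
      also have "card C = K" using C by (simp add: \<C>_def)
      also have "(3 * exp (- (1/2 - \<eta>) * lam)) ^ K \<le> (exp (ln 3) * exp (- (1 - 2 * \<eta>) * J)) ^ K"
      proof -
        have "(1/2 - \<eta>) * (2 * J) \<le> (1/2 - \<eta>) * lam" using J \<eta> by (intro mult_left_mono) (auto simp: J_def)
        hence "- (1/2 - \<eta>) * lam \<le> - (1 - 2 * \<eta>) * J" by (simp add: algebra_simps)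
        thus ?thesis by (intro power_mono mult_mono) auto
      qed
      also have "\<dots> = exp (real K * ln 3 - (1 - 2 * \<eta>) * (real K * J))"
        by (simp only: exp_add[symmetric] exp_of_nat_mult[symmetric]) (simp add: algebra_simps)
      also have "\<dots> \<le> exp (real K * ln 3 - (1 - 2 * \<eta>) * I)"
        using I0 \<eta> by (auto intro!: mult_left_mono)
      also have "(1 + 2 * exp (- lam / 2)) ^ L \<le> exp (2 * exp (- J)) ^ L"
      proof -
        have "exp (- lam / 2) \<le> exp (- J)" using J by (simp add: J_def)
        moreover have "1 + 2 * exp (- J) \<le> exp (2 * exp (- J))" by (rule exp_ge_add_one_self)
        ultimately have "1 + 2 * exp (- lam / 2) \<le> exp (2 * exp (- J))" by linarith
        moreover have "0 \<le> 1 + 2 * exp (- lam / 2)" by (intro add_nonneg_nonneg) simp_all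
        ultimately show ?thesis by (rule power_mono)
      qed
      also have "exp (2 * exp (- J)) ^ L = exp (2 * (real L * exp (- J)))"
        by (simp add: exp_of_nat_mult[symmetric] mult_ac)
      also have "\<dots> \<le> exp (\<eta> * I)" using I(3) by (simp add: I_def J_def)
      finally show ?thesis by (simp add: exp_add[symmetric] mult_right_mono)
    qed
    hence "(\<Sum>C\<in>\<C>. measure_pmf.prob M (ev1 C)) \<le> real (card \<C>) * exp (real K * ln 3 - (1 - 2 * \<eta>) * I + \<eta> * I)"
      by (rule sum_bounded_above)
    also have "\<dots> \<le> real (L ^ K) * exp (real K * ln 3 - (1 - 2 * \<eta>) * I + \<eta> * I)"
    proof (rule mult_right_mono)
      have "card \<C> = L choose K" unfolding \<C>_def using n_subsets[of "{..<L}" K] by simp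
      also have "\<dots> \<le> L ^ K" by (cases "K \<le> L") (simp_all add: binomial_le_pow binomial_eq_0)
      finally show "real (card \<C>) \<le> real (L ^ K)" by (simp only: of_nat_le_iff)
    qed simp
    also have "real (L ^ K) = exp (real K * ln (real L))"
      using pos by (simp add: exp_of_nat_mult)
    also have "exp (real K * ln (real L)) * exp (real K * ln 3 - (1 - 2 * \<eta>) * I + \<eta> * I)
        = exp (real K * ln (3 * real L) - (1 - 3 * \<eta>) * I)"
      unfolding ln3L exp_add[symmetric] by (simp add: algebra_simps)
    also have "\<dots> \<le> exp (- (1 - 6 * \<eta>) * I - ln 2)"
    proof -
      have "0 \<le> real K * ln (3 * real L)" using L by (intro mult_nonneg_nonneg) auto
      moreover have "0 \<le> \<eta> * I" using \<eta> I0 by simp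
      moreover have "- (1 - 6 * \<eta>) * I = - (1 - 3 * \<eta>) * I + 3 * (\<eta> * I)" by (simp add: algebra_simps)
      ultimately have "real K * ln (3 * real L) - (1 - 3 * \<eta>) * I \<le> - (1 - 6 * \<eta>) * I - ln 2"
        using I(4) pos unfolding I_def[symmetric] by linarith
      thus ?thesis by (simp only: exp_le_cancel_iff)
    qed
    also have "\<dots> = exp (- (1 - 6 * \<eta>) * I) / 2" by (simp only: exp_diff exp_ln[OF zero_less_numeral])
    finally show ?thesis .
  qed
  also have "(\<Sum>P\<in>\<P>. measure_pmf.prob M (ev2 P)) \<le> exp (- (1 - 6 * \<eta>) * I) / 2"
  proof -
    have "measure_pmf.prob M (ev2 P) \<le> exp (real K * ln 2 - (1 - 4 * \<eta>) * I)" if P: "P \<in> \<P>" for P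
    proof -
      obtain A B where P_eq: "P = (A, B)" by (cases P)
      have AB: "A \<subseteq> {..<L}" "B \<subseteq> {..<L}" "A \<inter> B = {}" "card A + card B < K"
        using P by (auto simp: \<P>_def P_eq)
      define S where "S = {..<L} - A - B"
      have "{..<L} - S = A \<union> B" using AB by (auto simp: S_def)
      hence cS: "card ({..<L} - S) = card A + card B"
        using AB by (simp add: card_Un_disjoint finite_subset[OF _ finite_lessThan])
      have SL: "S \<subseteq> {..<L}" by (auto simp: S_def)
      obtain t where t: "\<eta> \<le> t" "t \<le> 1 - \<eta>" and
        E: "t * lam * (real (card A) - real (card B)) - (1 - \<eta>) * lam * real (card A)
             - (1 - \<eta>) * (\<Sum>l\<in>S. rate_layer n p q l t) \<le> - (1 - 4 * \<eta>) * I"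
        using pattern_exponent[OF pq J lam_pos \<eta> I(1) SL cS] unfolding I_def by blast
      have "measure_pmf.prob M (ev2 P)
         \<le> exp (t * lam * (real (card A) - real (card B))) * (2 * exp (- (1 - \<eta>) * lam)) ^ card A
            * (\<Prod>l\<in>S. mgf l t)"
        unfolding ev2_def P_eq prod.case S_def using AB \<eta> t mgf1
        by (intro prob_err_pattern_le) auto
      also have "\<dots> \<le> exp (t * lam * (real (card A) - real (card B))) * (2 * exp (- (1 - \<eta>) * lam)) ^ card A
            * (\<Prod>l\<in>S. exp (- (1 - \<eta>) * rate_layer n p q l t))"
        using SL t mgf mgf_nonneg by (intro mult_left_mono prod_mono) auto
      also have "(\<Prod>l\<in>S. exp (- (1 - \<eta>) * rate_layer n p q l t)) = exp (- (1 - \<eta>) * (\<Sum>l\<in>S. rate_layer n p q l t))"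
        unfolding sum_distrib_left by (rule exp_sum[symmetric]) (simp add: S_def)
      also have "(2 * exp (- (1 - \<eta>) * lam)) ^ card A = 2 ^ card A * exp (- (1 - \<eta>) * lam * real (card A))"
        by (simp add: power_mult_distrib exp_of_nat_mult[symmetric] mult_ac)
      also have "exp (t * lam * (real (card A) - real (card B))) * (2 ^ card A * exp (- (1 - \<eta>) * lam * real (card A)))
           * exp (- (1 - \<eta>) * (\<Sum>l\<in>S. rate_layer n p q l t))
         = 2 ^ card A * exp (t * lam * (real (card A) - real (card B)) - (1 - \<eta>) * lam * real (card A)
             - (1 - \<eta>) * (\<Sum>l\<in>S. rate_layer n p q l t))"
        by (simp add: exp_add exp_diff exp_minus field_simps)
      also have "\<dots> \<le> 2 ^ K * exp (- (1 - 4 * \<eta>) * I)"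
        using E AB by (intro mult_mono power_increasing) auto
      also have "(2::real) ^ K = exp (real K * ln 2)" by (simp add: exp_of_nat_mult)
      also have "exp (real K * ln 2) * exp (- (1 - 4 * \<eta>) * I) = exp (real K * ln 2 - (1 - 4 * \<eta>) * I)"
        unfolding exp_add[symmetric] by (simp add: algebra_simps)
      finally show ?thesis .
    qed
    hence "(\<Sum>P\<in>\<P>. measure_pmf.prob M (ev2 P)) \<le> real (card \<P>) * exp (real K * ln 2 - (1 - 4 * \<eta>) * I)"
      by (rule sum_bounded_above)
    also have "\<dots> \<le> real ((K * L ^ K) * (K * L ^ K)) * exp (real K * ln 2 - (1 - 4 * \<eta>) * I)"
    proof (rule mult_right_mono)
      define \<S> where "\<S> = {A. A \<subseteq> {..<L} \<and> card A < K}"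
      have "\<P> \<subseteq> \<S> \<times> \<S>" by (auto simp: \<P>_def \<S>_def)
      moreover have "finite \<S>" unfolding \<S>_def by (rule finite_subset[of _ "Pow {..<L}"]) auto
      ultimately have "card \<P> \<le> card \<S> * card \<S>"
        using card_mono[of "\<S> \<times> \<S>" \<P>] by (simp add: card_cartesian_product)
      also have "\<dots> \<le> (K * L ^ K) * (K * L ^ K)"
        unfolding \<S>_def using card_small_subsets[OF L, of K] by (intro mult_mono) auto
      finally show "real (card \<P>) \<le> real ((K * L ^ K) * (K * L ^ K))" by (simp only: of_nat_le_iff)
    qed simp
    also have "real ((K * L ^ K) * (K * L ^ K)) = exp (2 * ln (real K) + 2 * real K * ln (real L))"
    proof -
      have "real (K * L ^ K) = exp (ln (real K) + real K * ln (real L))"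
        using pos by (simp add: exp_add exp_of_nat_mult)
      thus ?thesis by (simp only: of_nat_mult exp_add[symmetric]) (simp add: exp_add[symmetric])
    qed
    also have "exp (2 * ln (real K) + 2 * real K * ln (real L)) * exp (real K * ln 2 - (1 - 4 * \<eta>) * I)
        = exp (2 * ln (real K) + 2 * real K * ln (real L) + real K * ln 2 - (1 - 4 * \<eta>) * I)"
      by (simp add: exp_add[symmetric])
    also have "\<dots> \<le> exp (- (1 - 6 * \<eta>) * I - ln 2)"
    proof -
      \<comment> \<open>The factor \<open>2 ^ K\<close> coming from the layers in \<open>A\<close>
        fits into the slack left by the 3 in \<open>ln (3 * real L)\<close>.\<close>
      have "real K * ln 2 \<le> real K * (2 * ln 3)"
        by (intro mult_left_mono) (auto intro: order_trans[OF ln_mono[of 2 3]])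
      moreover have "0 \<le> \<eta> * I" using \<eta> I0 by simp
      moreover have "- (1 - 6 * \<eta>) * I = - (1 - 4 * \<eta>) * I + 2 * (\<eta> * I)" by (simp add: algebra_simps)
      moreover have "2 * real K * ln (3 * real L) = 2 * real K * ln (real L) + real K * (2 * ln 3)"
        unfolding ln3L by (simp add: algebra_simps)
      ultimately have "2 * ln (real K) + 2 * real K * ln (real L) + real K * ln 2 - (1 - 4 * \<eta>) * I
          \<le> - (1 - 6 * \<eta>) * I - ln 2"
        using I(4) unfolding I_def[symmetric] by linarith
      thus ?thesis by (simp only: exp_le_cancel_iff)
    qed
    also have "\<dots> = exp (- (1 - 6 * \<eta>) * I) / 2" by (simp only: exp_diff exp_ln[OF zero_less_numeral])
    finally show ?thesis .
  qed
  finally show ?thesis by (simp add: I_def)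
qed

end

section \<open>Conditioning on everything away from one node\<close>

lemma expectation_bind_pmf_finite:
  fixes h :: "'b \<Rightarrow> real"
  assumes "finite (set_pmf p)" "\<And>x. x \<in> set_pmf p \<Longrightarrow> finite (set_pmf (f x))"
  shows "measure_pmf.expectation (bind_pmf p f) h
         = measure_pmf.expectation p (\<lambda>x. measure_pmf.expectation (f x) h)"
proof -
  have "measure_pmf.expectation (bind_pmf p f) h
      = (\<Sum>a\<in>set_pmf p. pmf p a *\<^sub>R measure_pmf.expectation (f a) h)"
    using assms by (intro pmf_expectation_bind) auto
  also have "\<dots> = measure_pmf.expectation p (\<lambda>x. measure_pmf.expectation (f x) h)"
    using assms(1) by (subst integral_measure_pmf_real[of "set_pmf p"]) (auto simp: mult.commute)
  finally show ?thesis .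
qed

lemma prob_bind_pmf_le:
  assumes le: "\<And>x. x \<in> set_pmf p \<Longrightarrow> measure_pmf.prob (f x) X \<le> c" and c: "0 \<le> c"
  shows "measure_pmf.prob (bind_pmf p f) X \<le> c"
proof -
  have "emeasure (bind_pmf p f) X = (\<integral>\<^sup>+x. emeasure (f x) X \<partial>measure_pmf p)" by simp
  also have "\<dots> \<le> (\<integral>\<^sup>+x. ennreal c \<partial>measure_pmf p)"
    using le by (intro nn_integral_mono_AE)
      (auto simp: AE_measure_pmf_iff measure_pmf.emeasure_eq_measure intro: ennreal_leI)
  also have "\<dots> = ennreal c" by simp
  finally show ?thesis using c by (simp add: measure_pmf.emeasure_eq_measure)
qed

lemma finite_set_Pi_pmf:
  fixes P :: "'a \<Rightarrow> bool pmf"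
  assumes "finite A"
  shows "finite (set_pmf (Pi_pmf A d P))"
  using assms by (simp add: set_Pi_pmf finite_PiE_dflt)

lemma expectation_Pi_pmf_restrict:
  fixes P :: "'a \<Rightarrow> bool pmf" and h :: "('a \<Rightarrow> bool) \<Rightarrow> real"
  assumes fin: "finite B" and sub: "A \<subseteq> B"
    and dep: "\<And>E E'. (\<And>x. x \<in> A \<Longrightarrow> E x = E' x) \<Longrightarrow> h E = h E'"
  shows "measure_pmf.expectation (Pi_pmf B d P) h = measure_pmf.expectation (Pi_pmf A d P) h"
proof -
  have "Pi_pmf A d P = map_pmf (\<lambda>f x. if x \<in> A then f x else d) (Pi_pmf B d P)"
    using fin sub by (rule Pi_pmf_subset)
  hence "measure_pmf.expectation (Pi_pmf A d P) h
     = measure_pmf.expectation (Pi_pmf B d P) (\<lambda>f. h (\<lambda>x. if x \<in> A then f x else d))"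
    by simp
  also have "\<dots> = measure_pmf.expectation (Pi_pmf B d P) h"
    by (intro arg_cong[where f = "integral\<^sup>L _"] ext dep) auto
  finally show ?thesis by simp
qed

text \<open>Induction on the number of blocks: the last block is an independent draw, and each
  factor depends on only one of the two draws.\<close>

lemma expectation_Pi_pmf_blocks:
  fixes P :: "'a \<Rightarrow> bool pmf" and h :: "nat \<Rightarrow> ('a \<Rightarrow> bool) \<Rightarrow> real"
  assumes fin: "\<And>l. l < L \<Longrightarrow> finite (C l)" and disj: "\<And>k l. k < l \<Longrightarrow> l < L \<Longrightarrow> C k \<inter> C l = {}"
    and dep: "\<And>l E E'. l < L \<Longrightarrow> (\<And>x. x \<in> C l \<Longrightarrow> E x = E' x) \<Longrightarrow> h l E = h l E'"
  shows "measure_pmf.expectation (Pi_pmf (\<Union>l<L. C l) d P) (\<lambda>E. \<Prod>l<L. h l E)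
       = (\<Prod>l<L. measure_pmf.expectation (Pi_pmf (C l) d P) (h l))"
  using fin disj dep
proof (induction L)
  case (Suc L)
  define A where "A = (\<Union>l<L. C l)"
  have finA: "finite A" "finite (C L)" using Suc.prems(1) by (auto simp: A_def)
  have AC: "A \<inter> C L = {}" using Suc.prems(2) by (auto simp: A_def)
  have "(\<Union>l<Suc L. C l) = A \<union> C L" by (auto simp: A_def lessThan_Suc)
  hence "Pi_pmf (\<Union>l<Suc L. C l) d P
      = bind_pmf (Pi_pmf A d P) (\<lambda>f. map_pmf (\<lambda>g x. if x \<in> A then f x else g x) (Pi_pmf (C L) d P))"
    using finA AC by (simp add: Pi_pmf_union pair_pmf_def map_bind_pmf map_pmf_def bind_assoc_pmf bind_return_pmf)
  hence "measure_pmf.expectation (Pi_pmf (\<Union>l<Suc L. C l) d P) (\<lambda>E. \<Prod>l<Suc L. h l E)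
    = measure_pmf.expectation (Pi_pmf A d P) (\<lambda>f. measure_pmf.expectation (Pi_pmf (C L) d P)
        (\<lambda>g. \<Prod>l<Suc L. h l (\<lambda>x. if x \<in> A then f x else g x)))"
    using finA by (simp add: expectation_bind_pmf_finite finite_set_Pi_pmf)
  also have "\<dots> = measure_pmf.expectation (Pi_pmf A d P) (\<lambda>f. measure_pmf.expectation (Pi_pmf (C L) d P)
        (\<lambda>g. (\<Prod>l<L. h l f) * h L g))"
  proof (intro arg_cong[where f = "integral\<^sup>L _"] ext)
    fix f g :: "'a \<Rightarrow> bool"
    have "h l (\<lambda>x. if x \<in> A then f x else g x) = h l f" if "l < L" for l
      using that by (intro Suc.prems(3)) (auto simp: A_def)
    moreover have "h L (\<lambda>x. if x \<in> A then f x else g x) = h L g"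
      using AC by (intro Suc.prems(3)) auto
    ultimately show "(\<Prod>l<Suc L. h l (\<lambda>x. if x \<in> A then f x else g x)) = (\<Prod>l<L. h l f) * h L g"
      by simp
  qed
  also have "\<dots> = measure_pmf.expectation (Pi_pmf A d P) (\<lambda>f. \<Prod>l<L. h l f)
      * measure_pmf.expectation (Pi_pmf (C L) d P) (h L)"
    by simp
  also have "measure_pmf.expectation (Pi_pmf A d P) (\<lambda>f. \<Prod>l<L. h l f)
     = (\<Prod>l<L. measure_pmf.expectation (Pi_pmf (C l) d P) (h l))"
    unfolding A_def
  proof (rule Suc.IH)
    show "h l E = h l E'" if "l < L" "\<And>x. x \<in> C l \<Longrightarrow> E x = E' x" for l E E'
      using that by (intro Suc.prems(3)) simp_all
  qed (simp_all add: Suc.prems(1,2))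
  finally show ?case by simp
qed simp

text \<open>The half-open range of layers serves both the whole star of \<open>i\<close>, as
  \<open>0 L\<close>, and a single layer of it, as \<open>l (Suc l)\<close>.\<close>

definition node_edges :: "nat \<Rightarrow> nat \<Rightarrow> nat \<Rightarrow> nat \<Rightarrow> (nat \<times> nat \<times> nat) set" where
  "node_edges n i l k = {(l', a, b). l \<le> l' \<and> l' < k \<and> a < b \<and> b < n \<and> (a = i \<or> b = i)}"

definition edge :: "nat \<Rightarrow> nat \<Rightarrow> nat \<Rightarrow> nat \<times> nat \<times> nat" where
  "edge i l j = (l, min i j, max i j)"

definition edge_pmf :: "(nat \<Rightarrow> real) \<Rightarrow> (nat \<Rightarrow> real) \<Rightarrow> (nat \<Rightarrow> nat \<Rightarrow> int) \<Rightarrow> nat \<times> nat \<times> nat \<Rightarrow> bool pmf" where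
  "edge_pmf p q zl = (\<lambda>(l, a, b). bernoulli_pmf (if zl l a = zl l b then p l else q l))"

definition merge_on :: "'a set \<Rightarrow> ('a \<Rightarrow> 'b) \<Rightarrow> ('a \<Rightarrow> 'b) \<Rightarrow> 'a \<Rightarrow> 'b" where
  "merge_on A f g x = (if x \<in> A then f x else g x)"

text \<open>The conditional law of all randomness at \<open>i\<close> given the rest. The edges away
  from \<open>i\<close> do not enter, as edges are independent given the labels.\<close>

definition node_law :: "nat \<Rightarrow> nat \<Rightarrow> (nat \<Rightarrow> real) \<Rightarrow> (nat \<Rightarrow> real) \<Rightarrow> real \<Rightarrow> (nat \<Rightarrow> int) \<Rightarrow> nat
    \<Rightarrow> (nat \<times> nat \<Rightarrow> bool) \<Rightarrow> ((nat \<times> nat \<Rightarrow> bool) \<times> (nat \<times> nat \<times> nat \<Rightarrow> bool)) pmf" where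
  "node_law n L p q \<rho> z i \<xi> =
     bind_pmf (Pi_pmf ({..<L} \<times> {i}) False (\<lambda>_. bernoulli_pmf \<rho>)) (\<lambda>\<eta>.
     map_pmf (Pair \<eta>) (Pi_pmf (node_edges n i 0 L) False
       (edge_pmf p q (layer_labels z (merge_on ({..<L} \<times> {i}) \<eta> \<xi>)))))"

text \<open>Keeps the flips, which \<open>imlsbm_pmf\<close> discards, so that events may refer to
  the latent layer labels.\<close>

definition joint_pmf :: "nat \<Rightarrow> nat \<Rightarrow> (nat \<Rightarrow> real) \<Rightarrow> (nat \<Rightarrow> real) \<Rightarrow> real
    \<Rightarrow> (nat \<Rightarrow> int) \<Rightarrow> ((nat \<times> nat \<Rightarrow> bool) \<times> (nat \<times> nat \<times> nat \<Rightarrow> bool)) pmf" where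
  "joint_pmf n L p q \<rho> z =
     bind_pmf (flips_pmf n L \<rho>) (\<lambda>\<xi>. map_pmf (Pair \<xi>) (edges_pmf n L p q (layer_labels z \<xi>)))"

lemma imlsbm_joint: "imlsbm_pmf n L p q \<rho> z = map_pmf (\<lambda>(\<xi>, E). adj_of E) (joint_pmf n L p q \<rho> z)"
  unfolding imlsbm_pmf_def joint_pmf_def by (simp add: map_bind_pmf pmf.map_comp o_def)

lemma prob_event_joint:
  "prob_event n L p q \<rho> z P = measure_pmf.prob (joint_pmf n L p q \<rho> z) {(\<xi>, E). P (adj_of E)}"
  unfolding prob_event_def imlsbm_joint by (simp add: measure_map_pmf vimage_def case_prod_unfold)

lemma finite_node_edges: "finite (node_edges n i l k)"
  by (rule finite_subset[of _ "{..<k} \<times> {..<n} \<times> {..<n}"]) (auto simp: node_edges_def)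

text \<open>The edges away from \<open>i\<close> have a law that ignores the flips at
  \<open>i\<close>, so the draws can be reordered until everything at \<open>i\<close> comes
  last.\<close>

lemma joint_node_decomposition:
  assumes i: "i < n"
  shows "joint_pmf n L p q \<rho> z =
    bind_pmf (Pi_pmf ({..<L} \<times> ({..<n} - {i})) False (\<lambda>_. bernoulli_pmf \<rho>)) (\<lambda>\<xi>.
    bind_pmf (Pi_pmf {(l, a, b). l < L \<and> a < b \<and> b < n \<and> a \<noteq> i \<and> b \<noteq> i} False (edge_pmf p q (layer_labels z \<xi>))) (\<lambda>E.
    map_pmf (\<lambda>(\<eta>, E'). (merge_on ({..<L} \<times> {i}) \<eta> \<xi>, merge_on (node_edges n i 0 L) E' E))
      (node_law n L p q \<rho> z i \<xi>)))"
proof -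
  define A where "A = {..<L} \<times> {i}"
  define B where "B = {..<L} \<times> ({..<n} - {i})"
  define C where "C = node_edges n i 0 L"
  define D where "D = {(l, a, b). l < L \<and> a < b \<and> b < n \<and> a \<noteq> i \<and> b \<noteq> i}"
  define F where "F X = Pi_pmf X False (\<lambda>_::nat\<times>nat. bernoulli_pmf \<rho>)" for X
  define G where "G X \<xi> = Pi_pmf X False (edge_pmf p q (layer_labels z \<xi>))" for X \<xi>
  have "finite D"
    by (rule finite_subset[of _ "{..<L} \<times> {..<n} \<times> {..<n}"]) (auto simp: D_def)
  hence fin: "finite A" "finite B" "finite C" "finite D"
    by (simp_all add: A_def B_def C_def finite_node_edges)
  have AB: "{..<L} \<times> {..<n} = A \<union> B" "A \<inter> B = {}" using i by (auto simp: A_def B_def)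
  have CD: "{(l, a, b). l < L \<and> a < b \<and> b < n} = C \<union> D" "C \<inter> D = {}"
    by (auto simp: C_def D_def node_edges_def)
  have fl: "flips_pmf n L \<rho> = bind_pmf (F B) (\<lambda>\<xi>. bind_pmf (F A) (\<lambda>\<eta>. return_pmf (merge_on A \<eta> \<xi>)))"
    unfolding flips_pmf_def AB(1) F_def Pi_pmf_union[OF fin(1,2) AB(2)]
    by (subst bind_commute_pmf)
       (simp add: pair_pmf_def map_pmf_def bind_assoc_pmf bind_return_pmf merge_on_def[abs_def])
  have ed: "edges_pmf n L p q (layer_labels z \<xi>)
     = bind_pmf (G D \<xi>) (\<lambda>E. bind_pmf (G C \<xi>) (\<lambda>E'. return_pmf (merge_on C E' E)))" for \<xi>
    unfolding edges_pmf_def CD(1) G_def edge_pmf_def Pi_pmf_union[OF fin(3,4) CD(2)]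
    by (subst bind_commute_pmf)
       (simp add: pair_pmf_def map_pmf_def bind_assoc_pmf bind_return_pmf merge_on_def[abs_def])
  have GD: "G D (merge_on A \<eta> \<xi>) = G D \<xi>" for \<eta> \<xi>
    unfolding G_def
    by (intro Pi_pmf_cong) (auto simp: D_def edge_pmf_def layer_labels_def merge_on_def A_def)
  have "joint_pmf n L p q \<rho> z = bind_pmf (F B) (\<lambda>\<xi>. bind_pmf (F A) (\<lambda>\<eta>. bind_pmf (G D \<xi>) (\<lambda>E.
     bind_pmf (G C (merge_on A \<eta> \<xi>)) (\<lambda>E'. return_pmf (merge_on A \<eta> \<xi>, merge_on C E' E)))))"
    unfolding joint_pmf_def fl ed
    by (simp add: map_pmf_def bind_assoc_pmf bind_return_pmf GD)
  also have "\<dots> = bind_pmf (F B) (\<lambda>\<xi>. bind_pmf (G D \<xi>) (\<lambda>E. bind_pmf (F A) (\<lambda>\<eta>.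
     bind_pmf (G C (merge_on A \<eta> \<xi>)) (\<lambda>E'. return_pmf (merge_on A \<eta> \<xi>, merge_on C E' E)))))"
    by (intro bind_pmf_cong refl bind_commute_pmf)
  also have "\<dots> = bind_pmf (F B) (\<lambda>\<xi>. bind_pmf (G D \<xi>) (\<lambda>E.
     map_pmf (\<lambda>(\<eta>, E'). (merge_on A \<eta> \<xi>, merge_on C E' E)) (node_law n L p q \<rho> z i \<xi>)))"
    by (simp add: node_law_def map_pmf_def bind_assoc_pmf bind_return_pmf A_def C_def F_def G_def)
  finally show ?thesis by (simp add: A_def B_def C_def D_def F_def G_def)
qed

text \<open>The log-likelihood ratio of label \<open>s\<close> against \<open>- s\<close> for node
  \<open>i\<close> in layer \<open>l\<close>, with the estimate \<open>zt\<close> in place of the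
  other labels.\<close>

definition layer_stat :: "nat \<Rightarrow> (nat \<Rightarrow> real) \<Rightarrow> (nat \<Rightarrow> real) \<Rightarrow> nat \<Rightarrow> (nat \<Rightarrow> int) \<Rightarrow> int \<Rightarrow> nat
    \<Rightarrow> (nat \<times> nat \<times> nat \<Rightarrow> bool) \<Rightarrow> real" where
  "layer_stat n p q i zt s l E = (\<Sum>j\<in>{..<n} - {i}. (if zt j = s then 1 else -1) *
     (ln (p l * (1 - q l) / (q l * (1 - p l))) * of_bool (E (edge i l j)) + ln ((1 - p l) / (1 - q l))))"

lemma edge_image: "i < n \<Longrightarrow> edge i l ` ({..<n} - {i}) = node_edges n i l (Suc l)"
proof (intro equalityI subsetI)
  fix x assume i: "i < n" and "x \<in> node_edges n i l (Suc l)"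
  then obtain a b where x: "x = (l, a, b)" "a < b" "b < n" "a = i \<or> b = i"
    by (auto simp: node_edges_def less_Suc_eq_le)
  have "x = edge i l (if a = i then b else a)" "(if a = i then b else a) \<in> {..<n} - {i}"
    using x by (auto simp: edge_def)
  thus "x \<in> edge i l ` ({..<n} - {i})" by blast
qed (auto simp: edge_def node_edges_def min_def max_def split: if_splits)

lemma inj_on_edge: "inj_on (edge i l) ({..<n} - {i})"
  by (rule inj_onI) (auto simp: edge_def min_def max_def split: if_splits)

lemma layer_stat_cong:
  assumes "i < n" "\<And>x. x \<in> node_edges n i l (Suc l) \<Longrightarrow> E x = E' x"
  shows "layer_stat n p q i zt s l E = layer_stat n p q i zt s l E'"
proof -
  have "E (edge i l j) = E' (edge i l j)" if "j \<in> {..<n} - {i}" for j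
    using assms(2) that edge_image[OF assms(1), of l] by blast
  thus ?thesis unfolding layer_stat_def by (intro sum.cong) auto
qed

text \<open>The flip of \<open>i\<close> is set to \<open>b\<close> in every layer, which is
  harmless because the edges of layer \<open>l\<close> depend only on the flips of that
  layer.\<close>

definition layer_pmf :: "nat \<Rightarrow> nat \<Rightarrow> (nat \<Rightarrow> real) \<Rightarrow> (nat \<Rightarrow> real) \<Rightarrow> (nat \<Rightarrow> int) \<Rightarrow> nat
    \<Rightarrow> (nat \<times> nat \<Rightarrow> bool) \<Rightarrow> nat \<Rightarrow> bool \<Rightarrow> (nat \<times> nat \<times> nat \<Rightarrow> bool) pmf" where
  "layer_pmf n L p q z i \<xi> l b = Pi_pmf (node_edges n i l (Suc l)) False
     (edge_pmf p q (layer_labels z (merge_on ({..<L} \<times> {i}) (\<lambda>_. b) \<xi>)))"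

lemma finite_set_node_law: "finite (set_pmf (node_law n L p q \<rho> z i \<xi>))"
  by (simp add: node_law_def finite_set_Pi_pmf finite_node_edges)

text \<open>Two factorisations: given the flips at \<open>i\<close>, the layers use disjoint edges;
  the resulting factors depend on one flip each, and these flips are independent.\<close>

lemma node_law_expectation_prod:
  fixes g :: "nat \<Rightarrow> bool \<Rightarrow> real \<Rightarrow> real"
    and n i :: nat and p q :: "nat \<Rightarrow> real" and zt :: "nat \<Rightarrow> int" and s :: int
  assumes i: "i < n" and \<rho>: "0 \<le> \<rho>" "\<rho> \<le> 1"
  defines "S \<equiv> layer_stat n p q i zt s"
  shows "measure_pmf.expectation (node_law n L p q \<rho> z i \<xi>) (\<lambda>x. \<Prod>l<L. g l (fst x (l, i)) (S l (snd x)))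
    = (\<Prod>l<L. measure_pmf.expectation (layer_pmf n L p q z i \<xi> l True) (\<lambda>E. g l True (S l E)) * \<rho>
           + measure_pmf.expectation (layer_pmf n L p q z i \<xi> l False) (\<lambda>E. g l False (S l E)) * (1 - \<rho>))"
proof -
  define A where "A = {..<L} \<times> {i}"
  define K where "K l b = measure_pmf.expectation (layer_pmf n L p q z i \<xi> l b) (\<lambda>E. g l b (S l E))" for l b
  have edges: "node_edges n i 0 L = (\<Union>l<L. node_edges n i l (Suc l))"
    by (auto simp: node_edges_def)
  have A: "A = (\<Union>l<L. {(l, i)})" by (auto simp: A_def)
  have inner: "measure_pmf.expectation (Pi_pmf (node_edges n i 0 L) False (edge_pmf p q (layer_labels z (merge_on A \<eta> \<xi>))))
      (\<lambda>E. \<Prod>l<L. g l (\<eta> (l, i)) (S l E)) = (\<Prod>l<L. K l (\<eta> (l, i)))" for \<eta>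
  proof -
    have "measure_pmf.expectation (Pi_pmf (\<Union>l<L. node_edges n i l (Suc l)) False (edge_pmf p q (layer_labels z (merge_on A \<eta> \<xi>))))
        (\<lambda>E. \<Prod>l<L. g l (\<eta> (l, i)) (S l E))
      = (\<Prod>l<L. measure_pmf.expectation (Pi_pmf (node_edges n i l (Suc l)) False (edge_pmf p q (layer_labels z (merge_on A \<eta> \<xi>))))
          (\<lambda>E. g l (\<eta> (l, i)) (S l E)))"
    proof (rule expectation_Pi_pmf_blocks)
      show "g l (\<eta> (l, i)) (S l E) = g l (\<eta> (l, i)) (S l E')"
        if "\<And>x. x \<in> node_edges n i l (Suc l) \<Longrightarrow> E x = E' x" for l E E'
        unfolding S_def by (rule arg_cong[where f = "g l (\<eta> (l, i))"]) (rule layer_stat_cong[OF i that])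
    qed (auto simp: finite_node_edges, auto simp: node_edges_def)
    also have "\<dots> = (\<Prod>l<L. K l (\<eta> (l, i)))"
      unfolding K_def layer_pmf_def A_def
      by (intro prod.cong refl arg_cong[where f = "\<lambda>M. measure_pmf.expectation M _"] Pi_pmf_cong)
         (auto simp: node_edges_def edge_pmf_def layer_labels_def merge_on_def less_Suc_eq_le)
    finally show ?thesis unfolding edges .
  qed
  have "measure_pmf.expectation (node_law n L p q \<rho> z i \<xi>) (\<lambda>x. \<Prod>l<L. g l (fst x (l, i)) (S l (snd x)))
     = measure_pmf.expectation (Pi_pmf A False (\<lambda>_. bernoulli_pmf \<rho>)) (\<lambda>\<eta>. \<Prod>l<L. K l (\<eta> (l, i)))"
    unfolding node_law_def A_def[symmetric]
    by (subst expectation_bind_pmf_finite)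
       (simp_all add: finite_set_Pi_pmf finite_node_edges inner[unfolded A_def] A_def)
  also have "\<dots> = (\<Prod>l<L. measure_pmf.expectation (Pi_pmf {(l, i)} False (\<lambda>_. bernoulli_pmf \<rho>)) (\<lambda>\<eta>. K l (\<eta> (l, i))))"
    unfolding A by (rule expectation_Pi_pmf_blocks) auto
  also have "\<dots> = (\<Prod>l<L. K l True * \<rho> + K l False * (1 - \<rho>))"
    using \<rho> by (simp add: Pi_pmf_singleton)
  finally show ?thesis by (simp add: K_def)
qed

lemma node_law_expectation_layer:
  fixes g :: "bool \<Rightarrow> real \<Rightarrow> real"
    and n i :: nat and p q :: "nat \<Rightarrow> real" and zt :: "nat \<Rightarrow> int" and s :: int
  assumes i: "i < n" and \<rho>: "0 \<le> \<rho>" "\<rho> \<le> 1" and l: "l < L"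
  defines "S \<equiv> layer_stat n p q i zt s"
  shows "measure_pmf.expectation (node_law n L p q \<rho> z i \<xi>) (\<lambda>x. g (fst x (l, i)) (S l (snd x)))
    = measure_pmf.expectation (layer_pmf n L p q z i \<xi> l True) (\<lambda>E. g True (S l E)) * \<rho>
           + measure_pmf.expectation (layer_pmf n L p q z i \<xi> l False) (\<lambda>E. g False (S l E)) * (1 - \<rho>)"
proof -
  \<comment> \<open>Test functions equal to 1 in all other layers reduce the claim to the product
    formula.\<close>
  define g' where "g' k = (if k = l then g else (\<lambda>_ _. 1))" for k
  have 1: "(\<Prod>k<L. g' k (fst x (k, i)) (S k (snd x))) = g (fst x (l, i)) (S l (snd x))" for x
    using l by (subst prod.remove[of _ l]) (auto simp: g'_def)
  show ?thesis
    using node_law_expectation_prod[OF i \<rho>, of L p q z \<xi> g' zt s] l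
    unfolding S_def[symmetric] 1
    by (subst (asm) prod.remove[of _ l]) (auto simp: g'_def)
qed

lemma node_law_indep_layers:
  assumes i: "i < n" and \<rho>: "0 \<le> \<rho>" "\<rho> \<le> 1" and lam: "0 < lam" "\<rho> \<le> exp (- lam)"
  shows "indep_layers (node_law n L p q \<rho> z i \<xi>) L (\<lambda>l x. fst x (l, i))
     (\<lambda>l x. layer_stat n p q i zt s l (snd x)) lam"
proof
  show "finite (set_pmf (node_law n L p q \<rho> z i \<xi>))" by (rule finite_set_node_law)
  show "0 < lam" by (rule lam)
next
  fix g :: "nat \<Rightarrow> bool \<Rightarrow> real \<Rightarrow> real"
  show "measure_pmf.expectation (node_law n L p q \<rho> z i \<xi>)
      (\<lambda>x. \<Prod>l<L. g l (fst x (l, i)) (layer_stat n p q i zt s l (snd x)))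
     = (\<Prod>l<L. measure_pmf.expectation (node_law n L p q \<rho> z i \<xi>)
      (\<lambda>x. g l (fst x (l, i)) (layer_stat n p q i zt s l (snd x))))"
    unfolding node_law_expectation_prod[OF i \<rho>]
    by (intro prod.cong refl) (simp add: node_law_expectation_layer[OF i \<rho>, where g = "g _"])
next
  fix l assume l: "l < L"
  have "measure_pmf.prob (node_law n L p q \<rho> z i \<xi>) {x. fst x (l, i)}
     = measure_pmf.expectation (node_law n L p q \<rho> z i \<xi>) (indicator {x. fst x (l, i)})"
    by simp
  also have "\<dots> = measure_pmf.expectation (node_law n L p q \<rho> z i \<xi>) (\<lambda>x. of_bool (fst x (l, i)))"
    by (intro arg_cong[where f = "integral\<^sup>L _"] ext) (auto simp: indicator_def)
  also have "\<dots> = \<rho>"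
    using node_law_expectation_layer[OF i \<rho> l, of p q z \<xi> "\<lambda>b _. of_bool b"] by simp
  finally show "measure_pmf.prob (node_law n L p q \<rho> z i \<xi>) {x. fst x (l, i)} \<le> exp (- lam)"
    using lam by simp
qed

section \<open>Tilted moments of a single edge\<close>

lemma exp_le_chord: "0 \<le> t \<Longrightarrow> t \<le> 1 \<Longrightarrow> exp (t * x) \<le> 1 - t + t * exp (x :: real)"
  using Youngs_inequality_0[of t "1 - t" "exp x" 1] by (simp add: powr_def mult.commute)

text \<open>The chord of the exponential reduces \<open>t\<close> to 1, where the expectation is 1
  plus the chi-square divergence; \<open>a <= 1/2\<close> turns its denominator
  \<open>a * (1 - a)\<close> into \<open>a / 2\<close>.\<close>

lemma chi_square_bound:
  fixes a b t :: real
  assumes a: "0 < a" "a \<le> 1/2" and b: "0 < b" "b < 1" and t: "0 \<le> t" "t \<le> 1"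
  shows "b * exp (t * (ln b - ln a)) + (1 - b) * exp (t * (ln (1 - b) - ln (1 - a)))
         \<le> exp (2 * (b - a)\<^sup>2 / a)"
proof -
  define X Y where "X = b / a" and "Y = (1 - b) / (1 - a)"
  have XY: "exp (ln b - ln a) = X" "exp (ln (1 - b) - ln (1 - a)) = Y"
    using a b by (simp_all add: X_def Y_def exp_diff)
  have nz: "a \<noteq> 0" "1 - a \<noteq> 0" using a by auto
  have "b * exp (t * (ln b - ln a)) + (1 - b) * exp (t * (ln (1 - b) - ln (1 - a)))
    \<le> b * (1 - t + t * exp (ln b - ln a)) + (1 - b) * (1 - t + t * exp (ln (1 - b) - ln (1 - a)))"
    using b t by (intro add_mono mult_left_mono exp_le_chord) auto
  also have "\<dots> = 1 + t * (b * X + (1 - b) * Y - 1)"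
    unfolding XY by (simp add: algebra_simps)
  also have "b * X + (1 - b) * Y - 1 = (b * b * (1 - a) + (1 - b) * (1 - b) * a - a * (1 - a)) / (a * (1 - a))"
  proof -
    have "b * X = b * b * (1 - a) / (a * (1 - a))" "(1 - b) * Y = (1 - b) * (1 - b) * a / (a * (1 - a))"
      "a * (1 - a) / (a * (1 - a)) = 1"
      using nz by (simp_all add: X_def Y_def)
    thus ?thesis by (simp only: add_divide_distrib diff_divide_distrib)
  qed
  also have "b * b * (1 - a) + (1 - b) * (1 - b) * a - a * (1 - a) = (b - a)\<^sup>2"
    by (simp add: algebra_simps power2_eq_square)
  also have "1 + t * ((b - a)\<^sup>2 / (a * (1 - a))) \<le> 1 + 2 * (b - a)\<^sup>2 / a"
  proof -
    have "t * ((b - a)\<^sup>2 / (a * (1 - a))) \<le> 1 * ((b - a)\<^sup>2 / (a * (1 - a)))"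
      using a t by (intro mult_right_mono divide_nonneg_nonneg mult_nonneg_nonneg) auto
    also have "\<dots> \<le> (b - a)\<^sup>2 / (a * (1/2))"
      using a unfolding mult_1 by (intro divide_left_mono mult_left_mono mult_pos_pos) auto
    finally show ?thesis by (simp add: mult.commute)
  qed
  also have "\<dots> \<le> exp (2 * (b - a)\<^sup>2 / a)" by (rule exp_ge_add_one_self)
  finally show ?thesis .
qed

text \<open>If \<open>est\<close> and \<open>same\<close> agree, the tilt is applied under the law
  it is meant for and gives an affinity. If not, the factor may exceed 1 and is bounded by
  chi-square. In \<open>8 * C\<close>, the 2 is from \<open>chi_square_bound\<close>,
  \<open>C\<close> from replacing a denominator \<open>q\<close> by \<open>p\<close>, and 4 from
  \<open>Ilayer_half_lower\<close>.\<close>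

lemma edge_factor_bound:
  fixes p q :: real
  assumes pq: "0 < q" "q < p" "p \<le> 1/2" "p \<le> C * q" and t: "0 \<le> t" "t \<le> 1" and C: "1 \<le> C"
  defines "w \<equiv> ln (p * (1 - q) / (q * (1 - p)))" and "v \<equiv> ln ((1 - p) / (1 - q))"
  shows "measure_pmf.expectation (bernoulli_pmf (if same then p else q))
      (\<lambda>y. exp (- t * ((if est then 1 else -1) * (w * of_bool y + v))))
    \<le> (if est \<and> same then hell p q t else if \<not> est \<and> \<not> same then hell p q (1 - t)
       else exp (8 * C * Ilayer p q (1/2)))"
proof -
  have wv: "w + v = ln p - ln q" "v = ln (1 - p) - ln (1 - q)"
    using pq by (simp_all add: w_def v_def ln_div ln_mult)
  define pr where "pr = (if same then p else q)"
  have "measure_pmf.expectation (bernoulli_pmf pr)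
      (\<lambda>y. exp (- t * ((if est then 1 else -1) * (w * of_bool y + v))))
    = exp (- t * ((if est then 1 else -1) * (w + v))) * pr
     + exp (- t * ((if est then 1 else -1) * v)) * (1 - pr)"
    using pq by (simp add: pr_def)
  also have "- t * ((if est then 1 else -1) * (w + v)) = (if est then t * (ln q - ln p) else t * (ln p - ln q))"
    unfolding wv(1) by (simp add: algebra_simps)
  also have "- t * ((if est then 1 else -1) * v)
      = (if est then t * (ln (1 - q) - ln (1 - p)) else t * (ln (1 - p) - ln (1 - q)))"
    unfolding wv(2) by (simp add: algebra_simps)
  finally have E: "measure_pmf.expectation (bernoulli_pmf (if same then p else q))
      (\<lambda>y. exp (- t * ((if est then 1 else -1) * (w * of_bool y + v))))
    = exp (if est then t * (ln q - ln p) else t * (ln p - ln q)) * pr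
     + exp (if est then t * (ln (1 - q) - ln (1 - p)) else t * (ln (1 - p) - ln (1 - q))) * (1 - pr)"
    by (simp only: pr_def)
  have chi: "2 * (p - q)\<^sup>2 / q \<le> 8 * C * Ilayer p q (1/2)" "2 * (p - q)\<^sup>2 / p \<le> 8 * C * Ilayer p q (1/2)"
  proof -
    have I: "(p - q)\<^sup>2 / p \<le> 4 * Ilayer p q (1/2)"
      using Ilayer_half_lower[of q p] pq by simp
    hence CI: "C * ((p - q)\<^sup>2 / p) \<le> C * (4 * Ilayer p q (1/2))"
      using C by (intro mult_left_mono) auto
    have "(p - q)\<^sup>2 / q = C * ((p - q)\<^sup>2 / (C * q))" using C pq by simp
    also have "\<dots> \<le> C * ((p - q)\<^sup>2 / p)"
      using pq C by (intro mult_left_mono divide_left_mono) auto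
    finally show "2 * (p - q)\<^sup>2 / q \<le> 8 * C * Ilayer p q (1/2)" using CI by simp
    have "1 * ((p - q)\<^sup>2 / p) \<le> C * ((p - q)\<^sup>2 / p)"
      using C pq by (intro mult_right_mono) auto
    thus "2 * (p - q)\<^sup>2 / p \<le> 8 * C * Ilayer p q (1/2)" using CI by simp
  qed
  have powr: "exp (t * (ln b - ln a)) * a = a powr (1 - t) * b powr t" if "0 < a" "0 < b" for a b :: real
  proof -
    have "exp (t * (ln b - ln a)) * a = exp (t * (ln b - ln a)) * exp (ln a)" using that by simp
    also have "\<dots> = exp ((1 - t) * ln a + t * ln b)"
      unfolding exp_add[symmetric] by (simp add: algebra_simps)
    finally show ?thesis using that by (simp add: powr_def exp_add)
  qed
  consider "est" "same" | "\<not> est" "\<not> same" | "est" "\<not> same" | "\<not> est" "same" by blast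
  thus ?thesis
  proof cases
    case 1
    thus ?thesis unfolding E using powr[of p q] powr[of "1 - p" "1 - q"] pq by (simp add: hell_def pr_def)
  next
    case 2
    thus ?thesis unfolding E using powr[of q p] powr[of "1 - q" "1 - p"] pq
      by (simp add: hell_def pr_def mult.commute)
  next
    case 3
    have "q * exp (t * (ln q - ln p)) + (1 - q) * exp (t * (ln (1 - q) - ln (1 - p))) \<le> exp (2 * (q - p)\<^sup>2 / p)"
      using pq t by (intro chi_square_bound) auto
    also have "\<dots> \<le> exp (8 * C * Ilayer p q (1/2))"
      using chi(2) by (simp add: power2_commute)
    finally show ?thesis unfolding E using 3 by (simp add: pr_def mult.commute)
  next
    case 4
    have "p * exp (t * (ln p - ln q)) + (1 - p) * exp (t * (ln (1 - p) - ln (1 - q))) \<le> exp (2 * (p - q)\<^sup>2 / q)"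
      using pq t by (intro chi_square_bound) auto
    also have "\<dots> \<le> exp (8 * C * Ilayer p q (1/2))" using chi(1) by simp
    finally show ?thesis unfolding E using 4 by (simp add: pr_def mult.commute)
  qed
qed

section \<open>Error probability of a single node\<close>

text \<open>The edges at \<open>i\<close> are independent, so only the numbers of well placed and
  misplaced neighbours matter. \<open>same\<close> compares with \<open>z i\<close> because the flip
  at \<open>i\<close> is fixed to \<open>False\<close>.\<close>

lemma layer_mgf_le_counts:
  fixes p q :: "nat \<Rightarrow> real" and z zt :: "nat \<Rightarrow> int" and s :: int and \<xi> :: "nat \<times> nat \<Rightarrow> bool" and n i l :: nat
  assumes i: "i < n" and l: "l < L" and t: "0 \<le> t" "t \<le> 1" and C: "1 \<le> C"
    and pq: "0 < q l" "q l < p l" "p l \<le> 1/2" "p l \<le> C * q l"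
  defines "V \<equiv> {..<n} - {i}" and "same \<equiv> \<lambda>j. layer_labels z \<xi> l j = z i" and "est \<equiv> \<lambda>j. zt j = s"
  assumes N1: "real n / 2 * (1 - \<kappa>) \<le> card {j \<in> V. est j \<and> same j}"
    and N2: "real n / 2 * (1 - \<kappa>) \<le> card {j \<in> V. \<not> est j \<and> \<not> same j}"
    and N3: "card {j \<in> V. est j \<noteq> same j} \<le> real n * \<kappa>"
  shows "measure_pmf.expectation (layer_pmf n L p q z i \<xi> l False) (\<lambda>E. exp (- t * layer_stat n p q i zt s l E))
    \<le> exp (- (1 - \<kappa>) * rate_layer n p q l t + real n * \<kappa> * (8 * C * Ilayer (p l) (q l) (1/2)))"
proof -
  define w v where "w = ln (p l * (1 - q l) / (q l * (1 - p l)))" and "v = ln ((1 - p l) / (1 - q l))"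
  define F where "F j y = exp (- t * ((if est j then 1 else -1) * (w * of_bool y + v)))" for j y
  \<comment> \<open>Recovers the neighbour from the edge, so that the product over \<open>V\<close>
    can be rewritten over the index set of \<open>Pi_pmf\<close>.\<close>
  define oth where "oth = (\<lambda>(l' :: nat, a, b). if a = i then b else a)"
  define zl where "zl = layer_labels z (merge_on ({..<L} \<times> {i}) (\<lambda>_. False) \<xi>)"
  define h1 h2 c where "h1 = hell (p l) (q l) t" and "h2 = hell (p l) (q l) (1 - t)"
    and "c = 8 * C * Ilayer (p l) (q l) (1/2)"
  have q1: "p l < 1" "0 < p l" "q l < 1" using pq by linarith+
  have h: "0 < h1" "0 < h2" "h1 \<le> 1" "h2 \<le> 1"
    using pq q1 t by (simp_all add: h1_def h2_def hell_pos hell_le_1)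
  have c: "0 \<le> c" unfolding c_def using C pq q1 by (intro mult_nonneg_nonneg Ilayer_nonneg) auto
  have fV: "finite V" by (simp add: V_def)
  have oth: "oth (edge i l j) = j" if "j \<in> V" for j
    using that by (auto simp: oth_def edge_def V_def min_def max_def split: if_splits)
  have law: "edge_pmf p q zl (edge i l j) = bernoulli_pmf (if same j then p l else q l)" if j: "j \<in> V" for j
  proof -
    have "zl l i = z i" "zl l j = layer_labels z \<xi> l j"
      using j l by (auto simp: zl_def layer_labels_def merge_on_def V_def)
    thus ?thesis by (cases "i \<le> j") (auto simp: edge_pmf_def edge_def same_def min_def max_def)
  qed
  have "measure_pmf.expectation (layer_pmf n L p q z i \<xi> l False) (\<lambda>E. exp (- t * layer_stat n p q i zt s l E))
    = measure_pmf.expectation (Pi_pmf (edge i l ` V) False (edge_pmf p q zl))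
        (\<lambda>E. \<Prod>x\<in>edge i l ` V. F (oth x) (E x))"
  proof -
    have "exp (- t * layer_stat n p q i zt s l E) = (\<Prod>x\<in>edge i l ` V. F (oth x) (E x))" for E
    proof -
      have "(\<Prod>x\<in>edge i l ` V. F (oth x) (E x)) = (\<Prod>j\<in>V. F j (E (edge i l j)))"
        unfolding V_def by (subst prod.reindex[OF inj_on_edge]) (auto intro!: prod.cong simp: oth[unfolded V_def])
      also have "\<dots> = exp (\<Sum>j\<in>V. - t * ((if est j then 1 else -1) * (w * of_bool (E (edge i l j)) + v)))"
        unfolding F_def by (rule exp_sum[OF fV, symmetric])
      also have "(\<Sum>j\<in>V. - t * ((if est j then 1 else -1) * (w * of_bool (E (edge i l j)) + v)))
         = - t * layer_stat n p q i zt s l E"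
        unfolding layer_stat_def sum_distrib_left V_def est_def w_def v_def by simp
      finally show ?thesis by simp
    qed
    thus ?thesis unfolding layer_pmf_def zl_def V_def edge_image[OF i] by simp
  qed
  also have "\<dots> = (\<Prod>x\<in>edge i l ` V. measure_pmf.expectation (edge_pmf p q zl x) (F (oth x)))"
    using fV by (intro expectation_prod_Pi_pmf) (auto simp: F_def integrable_measure_pmf_finite)
  also have "\<dots> = (\<Prod>j\<in>V. measure_pmf.expectation (edge_pmf p q zl (edge i l j)) (F j))"
    unfolding V_def by (subst prod.reindex[OF inj_on_edge]) (auto intro!: prod.cong simp: oth[unfolded V_def])
  also have "\<dots> \<le> (\<Prod>j\<in>V. exp (of_bool (est j \<and> same j) * ln h1 + of_bool (\<not> est j \<and> \<not> same j) * ln h2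
        + of_bool (est j \<noteq> same j) * c))"
  proof (rule prod_mono, intro conjI)
    fix j assume j: "j \<in> V"
    show "0 \<le> measure_pmf.expectation (edge_pmf p q zl (edge i l j)) (F j)"
      by (rule integral_nonneg_AE) (simp add: F_def AE_measure_pmf_iff)
    have "measure_pmf.expectation (edge_pmf p q zl (edge i l j)) (F j)
       \<le> (if est j \<and> same j then h1 else if \<not> est j \<and> \<not> same j then h2 else exp c)"
      unfolding law[OF j] F_def w_def v_def h1_def h2_def c_def
      by (rule edge_factor_bound) (use pq t C in auto)
    also have "\<dots> = exp (of_bool (est j \<and> same j) * ln h1 + of_bool (\<not> est j \<and> \<not> same j) * ln h2
        + of_bool (est j \<noteq> same j) * c)"
      using h by auto
    finally show "measure_pmf.expectation (edge_pmf p q zl (edge i l j)) (F j) \<le> \<dots>" .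
  qed
  also have "\<dots> = exp (card {j \<in> V. est j \<and> same j} * ln h1 + card {j \<in> V. \<not> est j \<and> \<not> same j} * ln h2
      + card {j \<in> V. est j \<noteq> same j} * c)"
  proof -
    have cb: "(\<Sum>j\<in>V. of_bool (P j) * x) = card {j \<in> V. P j} * x" for P and x :: real
      unfolding sum_distrib_right[symmetric] using fV by (simp add: Int_def)
    show ?thesis unfolding exp_sum[OF fV, symmetric] sum.distrib cb ..
  qed
  also have "\<dots> \<le> exp (real n / 2 * (1 - \<kappa>) * ln h1 + real n / 2 * (1 - \<kappa>) * ln h2 + real n * \<kappa> * c)"
    using h c N1 N2 N3 unfolding exp_le_cancel_iff
    by (intro add_mono mult_right_mono_neg mult_right_mono) auto
  also have "real n / 2 * (1 - \<kappa>) * ln h1 + real n / 2 * (1 - \<kappa>) * ln h2 = - (1 - \<kappa>) * rate_layer n p q l t"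
  proof -
    have "Ilayer (p l) (q l) t = - ln h1 - ln h2"
      using h by (simp add: Ilayer_hell h1_def[symmetric] h2_def[symmetric] ln_mult)
    moreover have "N * (1 - \<kappa>) * a + N * (1 - \<kappa>) * b = - (1 - \<kappa>) * (N * (- a - b))" for N a b :: real
      by (simp add: algebra_simps)
    ultimately show ?thesis unfolding rate_layer_def by simp
  qed
  finally show ?thesis unfolding c_def .
qed

text \<open>A neighbour is misplaced only if its initial label is wrong or its layer label is
  flipped. The additional 1 accounts for \<open>i\<close> itself, which is in its own class but not
  in \<open>V\<close>.\<close>

lemma agreement_counts:
  fixes m d1 d2 :: real and z zt :: "nat \<Rightarrow> int" and s :: int and \<xi> :: "nat \<times> nat \<Rightarrow> bool" and n i l :: nat
  assumes i: "i < n" and z: "\<And>j. j < n \<Longrightarrow> z j \<in> {-1, 1}"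
    and bal: "\<And>a. a \<in> {-1, 1} \<Longrightarrow> m \<le> card {j. j < n \<and> z j = a}"
  defines "V \<equiv> {..<n} - {i}" and "same \<equiv> \<lambda>j. layer_labels z \<xi> l j = z i" and "est \<equiv> \<lambda>j. zt j = s"
  assumes bad1: "card {j \<in> V. (zt j = s) \<noteq> (z j = z i)} \<le> d1" and bad2: "card {j \<in> V. \<xi> (l, j)} \<le> d2"
  shows "m \<le> card {j \<in> V. est j \<and> same j} + d1 + d2 + (1 :: real)"
    "m \<le> card {j \<in> V. \<not> est j \<and> \<not> same j} + d1 + d2"
    "card {j \<in> V. est j \<noteq> same j} \<le> d1 + d2"
proof -
  define B1 B2 where "B1 = {j \<in> V. (zt j = s) \<noteq> (z j = z i)}" and "B2 = {j \<in> V. \<xi> (l, j)}"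
  have fin: "finite B1" "finite B2" by (auto simp: B1_def B2_def V_def)
  have zV: "z j = 1 \<or> z j = -1" if "j \<in> V" for j using z[of j] that by (auto simp: V_def)
  have zi: "z i = 1 \<or> z i = -1" using z[OF i] by auto
  have same: "same j \<longleftrightarrow> (z j = z i) \<noteq> \<xi> (l, j)" if "j \<in> V" for j
    using zV[OF that] zi by (auto simp: same_def layer_labels_def)
  have card3: "card X \<le> card Y + card B1 + card B2" if "X \<subseteq> Y \<union> B1 \<union> B2" "finite Y" for X Y :: "nat set"
  proof -
    have "card X \<le> card (Y \<union> B1 \<union> B2)" using that fin by (intro card_mono) auto
    also have "\<dots> \<le> card Y + card B1 + card B2"
      using card_Un_le[of "Y \<union> B1" B2] card_Un_le[of Y B1] by linarith
    finally show ?thesis .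
  qed
  note bads = bad1[folded B1_def] bad2[folded B2_def]
  have "card {j. j < n \<and> z j = z i} \<le> card (insert i {j \<in> V. est j \<and> same j}) + card B1 + card B2"
    using same by (intro card3) (auto simp: B1_def B2_def est_def V_def)
  also have "card (insert i {j \<in> V. est j \<and> same j}) = card {j \<in> V. est j \<and> same j} + 1"
    by (subst card_insert_disjoint) (auto simp: V_def)
  finally show "m \<le> card {j \<in> V. est j \<and> same j} + d1 + d2 + (1 :: real)"
    using bal[of "z i"] z[OF i] bads by linarith
  have "card {j. j < n \<and> z j = - z i} \<le> card {j \<in> V. \<not> est j \<and> \<not> same j} + card B1 + card B2"
    using same zi by (intro card3) (auto simp: B1_def B2_def est_def V_def)
  thus "m \<le> card {j \<in> V. \<not> est j \<and> \<not> same j} + d1 + d2"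
    using bal[of "- z i"] zi bads by force
  have "card {j \<in> V. est j \<noteq> same j} \<le> card ({} :: nat set) + card B1 + card B2"
    using same by (intro card3) (auto simp: B1_def B2_def est_def)
  thus "card {j \<in> V. est j \<noteq> same j} \<le> d1 + d2" using bads by simp
qed

text \<open>\<open>exp (- 2 * J)\<close> is 4 \<rho> (1 - \<rho>) and \<open>exp (- lam)\<close> is
  \<rho> / (1 - \<rho>), so \<open>2 * J <= lam\<close> says that the square of 2 (1 - \<rho>) is at
  least 1.\<close>

lemma Jrho_facts:
  assumes "0 < \<rho>" "\<rho> < 1/2"
  shows "0 \<le> Jrho \<rho>" "2 * Jrho \<rho> \<le> ln ((1 - \<rho>) / \<rho>)" "0 < ln ((1 - \<rho>) / \<rho>)" "\<rho> \<le> exp (- ln ((1 - \<rho>) / \<rho>))"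
proof -
  have pos: "0 < \<rho> * (1 - \<rho>)" using assms by simp
  have J: "2 * Jrho \<rho> = - ln (4 * (\<rho> * (1 - \<rho>)))"
    using pos by (simp add: Jrho_def ln_mult ln_sqrt) (use ln_realpow[of 2 2] in simp)
  have "4 * (\<rho> * (1 - \<rho>)) = 1 - (1 - 2 * \<rho>)\<^sup>2" by (simp add: power2_eq_square algebra_simps)
  hence "4 * (\<rho> * (1 - \<rho>)) \<le> 1" by simp
  hence "ln (4 * (\<rho> * (1 - \<rho>))) \<le> 0" using pos by simp
  thus "0 \<le> Jrho \<rho>" using J by simp
  have "1 * 1 \<le> (2 * (1 - \<rho>)) * (2 * (1 - \<rho>))" using assms by (intro mult_mono) auto
  hence "\<rho> * 1 \<le> \<rho> * ((2 * (1 - \<rho>)) * (2 * (1 - \<rho>)))" using assms by (intro mult_left_mono) auto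
  also have "\<dots> = 4 * (\<rho> * (1 - \<rho>)) * (1 - \<rho>)" by (simp add: algebra_simps)
  finally have "\<rho> / (1 - \<rho>) \<le> 4 * (\<rho> * (1 - \<rho>))"
    using assms by (subst pos_divide_le_eq) auto
  hence "ln (\<rho> / (1 - \<rho>)) \<le> ln (4 * (\<rho> * (1 - \<rho>)))" using assms by (intro ln_mono) auto
  thus "2 * Jrho \<rho> \<le> ln ((1 - \<rho>) / \<rho>)" using J assms by (simp add: ln_div)
  show "0 < ln ((1 - \<rho>) / \<rho>)" using assms by (simp add: less_divide_eq)
  have "\<rho> * (1 - \<rho>) \<le> \<rho> * 1" using assms by (intro mult_left_mono) auto
  hence "\<rho> \<le> \<rho> / (1 - \<rho>)" using assms by (simp add: le_divide_eq)
  also have "\<dots> = exp (- ln ((1 - \<rho>) / \<rho>))" using assms by (simp add: exp_minus exp_ln)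
  finally show "\<rho> \<le> exp (- ln ((1 - \<rho>) / \<rho>))" .
qed

text \<open>The condition on \<open>\<kappa> * (1 + 8 * C / \<eta>)\<close> covers both the missing
  good neighbours and the cost of the bad ones, after \<open>Ilayer_ge_half\<close> has converted
  information at 1/2 into information at \<open>t\<close>. The regimes are separated at
  \<open>J = \<eta> * I\<close>; in the second one \<open>\<eta> * K >= 1\<close> yields
  \<open>I <= K * J\<close>.\<close>

lemma node_error_prob:
  fixes zt :: "nat \<Rightarrow> int" and s :: int and m d1 d2 \<kappa> :: real
  assumes i: "i < n" and \<rho>: "0 < \<rho>" "\<rho> < 1/2" and L: "1 \<le> L"
    and pq: "\<And>l. l < L \<Longrightarrow> 0 < q l \<and> q l < p l \<and> p l \<le> 1/2 \<and> p l \<le> C * q l" and C: "1 \<le> C"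
    and z: "\<And>j. j < n \<Longrightarrow> z j \<in> {-1, 1}"
    and bal: "\<And>a. a \<in> {-1, 1} \<Longrightarrow> m \<le> card {j. j < n \<and> z j = a}"
    and bad1: "card {j \<in> {..<n} - {i}. (zt j = s) \<noteq> (z j = z i)} \<le> d1"
    and bad2: "\<And>l. l < L \<Longrightarrow> card {j \<in> {..<n} - {i}. \<xi> (l, j)} \<le> d2"
    and \<kappa>: "real n / 2 * (1 - \<kappa>) \<le> m - d1 - d2 - 1" "d1 + d2 \<le> real n * \<kappa>" "\<kappa> * (1 + 8 * C / \<eta>) \<le> \<eta>"
    and \<eta>: "0 < \<eta>" "\<eta> \<le> 1/2" and c': "c' < 1" and K: "1 \<le> \<eta> * real K"
    and J_large: "2 \<le> \<eta> * (1 - \<eta>) * (1 - c') * Jrho \<rho>"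
    and I: "0 \<le> minIS n L p q \<rho>" "2 * (real L * exp (- c' * Jrho \<rho>)) \<le> \<eta> * minIS n L p q \<rho>"
      "2 * real K * ln (3 * real L) + 2 * ln (real K) + ln 2 \<le> \<eta> * minIS n L p q \<rho>"
  shows "measure_pmf.prob (node_law n L p q \<rho> z i \<xi>)
      {x. (\<Sum>l<L. clip (ln ((1 - \<rho>) / \<rho>)) (layer_stat n p q i zt s l (snd x))) \<le> 0}
    \<le> exp (- (1 - 6 * \<eta>) * minIS n L p q \<rho>)"
proof -
  define lam where "lam = ln ((1 - \<rho>) / \<rho>)"
  note J = Jrho_facts[OF \<rho>, folded lam_def]
  have \<rho>01: "0 \<le> \<rho>" "\<rho> \<le> 1" using \<rho> by auto
  interpret indep_layers "node_law n L p q \<rho> z i \<xi>" L "\<lambda>l x. fst x (l, i)"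
    "\<lambda>l x. layer_stat n p q i zt s l (snd x)" lam
    by (rule node_law_indep_layers[OF i \<rho>01 J(3,4)])
  have pq1: "0 < q l \<and> q l < p l \<and> p l < 1" if "l < L" for l using pq[OF that] by linarith
  have mgf_le: "mgf l t \<le> exp (- (1 - \<eta>) * rate_layer n p q l t)"
    if l: "l < L" and t: "\<eta> \<le> t" "t \<le> 1 - \<eta>" for l t
  proof -
    have t01: "0 \<le> t" "t \<le> 1" using t \<eta> by auto
    note pql = pq[OF l] pq1[OF l]
    have r0: "0 \<le> rate_layer n p q l t" by (rule rate_nonneg[OF pq1 J(1) l t01])
    note cnt = agreement_counts[where n = n and z = z and \<xi> = \<xi> and l = l and m = m and zt = zt and s = s, OF i z bal bad1 bad2[OF l]]
    let ?E = "measure_pmf.expectation (layer_pmf n L p q z i \<xi> l False) (\<lambda>E. exp (- t * layer_stat n p q i zt s l E))"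
    have "mgf l t = ?E * (1 - \<rho>)"
      using node_law_expectation_layer[OF i \<rho>01 l, of p q z \<xi> "\<lambda>b d. of_bool (\<not> b) * exp (- t * d)" zt s]
      by (simp add: mgf_def)
    also have "\<dots> \<le> ?E"
      using \<rho>01 by (intro mult_left_le integral_nonneg_AE) (auto simp: AE_measure_pmf_iff)
    also have "\<dots> \<le> exp (- (1 - \<kappa>) * rate_layer n p q l t + real n * \<kappa> * (8 * C * Ilayer (p l) (q l) (1/2)))"
      using pql C \<kappa>(1,2) cnt by (intro layer_mgf_le_counts[OF i l t01]) auto
    also have "\<dots> \<le> exp (- (1 - \<eta>) * rate_layer n p q l t)"
    proof -
      have \<kappa>0: "0 \<le> real n * \<kappa>" using \<kappa>(2) cnt(3) by linarith
      have "2 * \<eta> * Ilayer (p l) (q l) (1/2) \<le> Ilayer (p l) (q l) t"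
        using pql t \<eta> by (intro Ilayer_ge_half) auto
      hence "Ilayer (p l) (q l) (1/2) \<le> Ilayer (p l) (q l) t / (2 * \<eta>)"
        using \<eta> by (simp add: le_divide_eq mult_ac)
      hence "real n * \<kappa> * (8 * C * Ilayer (p l) (q l) (1/2)) \<le> real n * \<kappa> * (8 * C * (Ilayer (p l) (q l) t / (2 * \<eta>)))"
        using \<kappa>0 C by (intro mult_left_mono) auto
      also have "\<dots> = \<kappa> * (8 * C / \<eta>) * rate_layer n p q l t" by (simp add: rate_layer_def)
      finally have "- (1 - \<kappa>) * rate_layer n p q l t + real n * \<kappa> * (8 * C * Ilayer (p l) (q l) (1/2))
          \<le> - rate_layer n p q l t + (\<kappa> * (1 + 8 * C / \<eta>)) * rate_layer n p q l t"
        by (simp add: algebra_simps)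
      also have "\<dots> \<le> - rate_layer n p q l t + \<eta> * rate_layer n p q l t"
        using \<kappa>(3) r0 by (intro add_left_mono mult_right_mono)
      finally show ?thesis by (simp add: algebra_simps)
    qed
    finally show ?thesis .
  qed
  have "measure_pmf.prob (node_law n L p q \<rho> z i \<xi>) err \<le> exp (- (1 - 6 * \<eta>) * minIS n L p q \<rho>)"
  proof (cases "Jrho \<rho> \<le> \<eta> * minIS n L p q \<rho>")
    case True
    have "measure_pmf.prob (node_law n L p q \<rho> z i \<xi>) err \<le> exp (- (1 - 4 * \<eta>) * minIS n L p q \<rho>)"
      using \<eta> c' J_large True I(2) mgf_le[of _ "1/2"]
      by (intro prob_err_le_many_layers[OF pq1 J(1,2)]) auto
    also have "\<dots> \<le> exp (- (1 - 6 * \<eta>) * minIS n L p q \<rho>)"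
      using I(1) \<eta> by (simp add: mult_right_mono)
    finally show ?thesis .
  next
    case False
    have "minIS n L p q \<rho> \<le> (\<eta> * real K) * minIS n L p q \<rho>"
      using K I(1) mult_right_mono[of 1 "\<eta> * real K" "minIS n L p q \<rho>"] by simp
    also have "\<dots> = real K * (\<eta> * minIS n L p q \<rho>)" by simp
    also have "\<dots> \<le> real K * Jrho \<rho>" using False by (intro mult_left_mono) auto
    finally have IK: "minIS n L p q \<rho> \<le> real K * Jrho \<rho>" .
    have "real L * exp (- Jrho \<rho>) \<le> real L * exp (- c' * Jrho \<rho>)"
      using c' J(1) mult_right_mono[of c' 1 "Jrho \<rho>"] by (intro mult_left_mono) auto
    hence "2 * (real L * exp (- Jrho \<rho>)) \<le> \<eta> * minIS n L p q \<rho>" using I(2) by linarith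
    moreover have "1 \<le> K" using K by (cases K) auto
    ultimately show ?thesis
      using \<eta> IK I L mgf_le by (intro prob_err_le_few_layers[OF pq1 J(1,2)]) auto
  qed
  thus ?thesis unfolding err_def unfolding lam_def .
qed

section \<open>Stage II, alignment and concentration of the flips\<close>

lemma max_diff_clip:
  assumes "0 \<le> lam"
  shows "max (lam + a) b - max (lam + b) a = clip lam (a - b)"
  using assms by (auto simp: clip_def max_def min_def)

text \<open>For a fixed global label the layer labels decouple and the optimum is a sum of maxima.
  By \<open>max_diff_clip\<close> the optimum for \<open>s\<close> minus the one for
  \<open>- s\<close> is the clipped sum, which is not positive if \<open>- s\<close> wins or
  ties.\<close>

lemma stage2_opposite_imp_clip:
  fixes s :: int and zt :: "nat \<Rightarrow> int"
  assumes lam: "0 \<le> ln ((1 - \<rho>) / \<rho>)" and s: "s \<in> {-1, 1}"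
    and zt: "\<And>j. j < n \<Longrightarrow> j \<noteq> i \<Longrightarrow> zt j \<in> {-1, 1}"
    and opt: "stage2_global_argmax n L p q \<rho> (adj_of E) i zt (- s)"
  shows "(\<Sum>l<L. clip (ln ((1 - \<rho>) / \<rho>)) (layer_stat n p q i zt s l E)) \<le> 0"
proof -
  define lam where "lam = ln ((1 - \<rho>) / \<rho>)"
  define Y where "Y l j = ln (p l * (1 - q l) / (q l * (1 - p l))) * of_bool (adj_of E l i j) + ln ((1 - p l) / (1 - q l))" for l j
  define X where "X l a = (\<Sum>j\<in>{j. j < n \<and> j \<noteq> i \<and> zt j = a}. Y l j)" for l a
  define V where "V = {..<n} - {i}"
  have f: "f_alg n p q \<rho> (adj_of E) i l a b zt = lam * of_bool (b = a) + X l b" for l a b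
    by (simp add: f_alg_def lam_def X_def Y_def)
  have stat: "layer_stat n p q i zt s l E = X l s - X l (- s)" for l
  proof -
    have ztV: "zt j = - s \<longleftrightarrow> zt j \<noteq> s" if "j < n" "j \<noteq> i" for j
      using zt[OF that] s by auto
    have Vs: "{j. j < n \<and> j \<noteq> i \<and> zt j = s} = {j \<in> V. zt j = s}"
      by (auto simp: V_def)
    have Vs': "{j. j < n \<and> j \<noteq> i \<and> zt j = - s} = {j \<in> V. \<not> zt j = s}"
      using ztV unfolding V_def by blast
    have "layer_stat n p q i zt s l E = (\<Sum>j\<in>V. (if zt j = s then Y l j else - Y l j))"
      unfolding layer_stat_def V_def by (intro sum.cong) (auto simp: Y_def adj_of_def edge_def)
    also have "\<dots> = (\<Sum>j\<in>V \<inter> {j. zt j = s}. Y l j) + (\<Sum>j\<in>V \<inter> - {j. zt j = s}. - Y l j)"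
      by (rule sum.If_cases) (simp add: V_def)
    also have "\<dots> = X l s - X l (- s)"
      unfolding X_def Vs Vs' by (simp add: sum_negf Int_def Compl_eq)
    finally show ?thesis .
  qed
  obtain s' where s': "\<And>l. l < L \<Longrightarrow> s' l \<in> {-1, 1}"
    and max: "\<And>t t'. t \<in> {-1, 1} \<Longrightarrow> (\<forall>l<L. t' l \<in> {-1, 1}) \<Longrightarrow>
       stage2_obj n L p q \<rho> (adj_of E) i zt t t' \<le> stage2_obj n L p q \<rho> (adj_of E) i zt (- s) s'"
    using opt unfolding stage2_global_argmax_def by blast
  \<comment> \<open>The layerwise best labels when the global label is \<open>s\<close>.\<close>
  define t' where "t' l = (if X l (- s) \<le> lam + X l s then s else - s)" for l
  have ss: "s \<noteq> - s" "- s \<noteq> s" using s by auto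
  have "(\<Sum>l<L. max (lam + X l s) (X l (- s))) = stage2_obj n L p q \<rho> (adj_of E) i zt s t'"
    unfolding stage2_obj_def f using ss by (intro sum.cong) (auto simp: t'_def max_def)
  also have "\<dots> \<le> stage2_obj n L p q \<rho> (adj_of E) i zt (- s) s'"
    using s by (intro max) (auto simp: t'_def)
  also have "\<dots> \<le> (\<Sum>l<L. max (lam + X l (- s)) (X l s))"
    unfolding stage2_obj_def f
  proof (rule sum_mono)
    fix l assume "l \<in> {..<L}"
    hence "s' l = s \<or> s' l = - s" using s' s by fastforce
    thus "lam * of_bool (s' l = - s) + X l (s' l) \<le> max (lam + X l (- s)) (X l s)"
      using ss by auto
  qed
  finally have "(\<Sum>l<L. max (lam + X l s) (X l (- s))) - (\<Sum>l<L. max (lam + X l (- s)) (X l s)) \<le> 0" by simp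
  thus ?thesis
    using lam unfolding sum_subtractf[symmetric] lam_def[symmetric] by (simp add: max_diff_clip stat)
qed

text \<open>Completed by their Stage II label, the vectors of nodes 0 and \<open>i\<close> each
  differ from a signed copy of \<open>z\<close> in at most \<open>d + 1\<close> places. Hence the
  correct sign collects more than \<open>2 * d + 2\<close> common nodes and the wrong one at most
  that many.\<close>

lemma alignment_correct:
  fixes z zh \<sigma> :: "nat \<Rightarrow> int"
  assumes out: "alg3_global_output n L p q \<rho> Init A zh"
    and z: "\<And>j. j < n \<Longrightarrow> z j \<in> {-1, 1}" and \<sigma>: "\<And>i. i < n \<Longrightarrow> \<sigma> i \<in> {-1, 1}"
    and init: "\<And>i. i < n \<Longrightarrow> card {j \<in> {..<n} - {i}. init_minus Init n i A j \<noteq> \<sigma> i * z j} \<le> d"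
    and bal: "\<And>a. a \<in> {-1, 1} \<Longrightarrow> 4 * d + 4 < card {j. j < n \<and> z j = a}"
  obtains sb where "\<And>i. i < n \<Longrightarrow> stage2_global_argmax n L p q \<rho> A i (init_minus Init n i A) (sb i)"
    "\<And>i. i < n \<Longrightarrow> zh i = \<sigma> 0 * \<sigma> i * sb i"
proof -
  obtain sb where sb: "\<And>i. i < n \<Longrightarrow> stage2_global_argmax n L p q \<rho> A i (init_minus Init n i A) (sb i)"
    and zh0: "0 < n \<Longrightarrow> zh 0 = sb 0"
    and zh: "\<And>i. 1 \<le> i \<Longrightarrow> i < n \<Longrightarrow> zh i \<in> {-1, 1} \<and> (\<forall>s\<in>{-1, 1}.
        card {j. j < n \<and> (if j = 0 then sb 0 else init_minus Init n 0 A j) = s \<and>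
                 (if j = i then sb i else init_minus Init n i A j) = sb i}
      \<le> card {j. j < n \<and> (if j = 0 then sb 0 else init_minus Init n 0 A j) = zh i \<and>
                 (if j = i then sb i else init_minus Init n i A j) = sb i})"
    using out unfolding alg3_global_output_def Let_def by auto
  define zb where "zb i j = (if j = i then sb i else init_minus Init n i A j)" for i j
  define M where "M i = {j. j < n \<and> zb i j \<noteq> \<sigma> i * z j}" for i
  have sb1: "sb i = 1 \<or> sb i = -1" if "i < n" for i
    using sb[OF that] by (auto simp: stage2_global_argmax_def)
  have \<sigma>1: "\<sigma> i = 1 \<or> \<sigma> i = -1" if "i < n" for i using \<sigma>[OF that] by auto
  have M: "card (M i) \<le> d + 1" if "i < n" for i
  proof -
    have "M i \<subseteq> insert i {j \<in> {..<n} - {i}. init_minus Init n i A j \<noteq> \<sigma> i * z j}"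
      by (auto simp: M_def zb_def)
    hence "card (M i) \<le> card (insert i {j \<in> {..<n} - {i}. init_minus Init n i A j \<noteq> \<sigma> i * z j})"
      by (intro card_mono) auto
    also have "\<dots> \<le> card {j \<in> {..<n} - {i}. init_minus Init n i A j \<noteq> \<sigma> i * z j} + 1"
      by (subst card_insert_disjoint) auto
    finally show ?thesis using init[OF that] by linarith
  qed
  have "zh i = \<sigma> 0 * \<sigma> i * sb i" if i: "i < n" for i
  proof (cases "i = 0")
    case True
    thus ?thesis using zh0 i \<sigma>1[of 0] by auto
  next
    case False
    have n0: "0 < n" using i by simp
    \<comment> \<open>The Stage II label of \<open>i\<close> with the sign of its own initialisation
      undone.\<close>
    define a where "a = \<sigma> i * sb i"
    define T where "T s = {j. j < n \<and> zb 0 j = s \<and> zb i j = sb i}" for s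
    have a: "a = 1 \<or> a = -1" using \<sigma>1[OF i] sb1[OF i] by (auto simp: a_def)
    have sba: "sb i = \<sigma> i * a" using \<sigma>1[OF i] by (auto simp: a_def)
    have fin: "finite (T s)" "finite (M k)" for s k by (auto simp: T_def M_def)
    have MM: "card (M 0 \<union> M i) \<le> 2 * d + 2"
      using card_Un_le[of "M 0" "M i"] M[OF n0] M[OF i] by linarith
    have "{j. j < n \<and> z j = a} \<subseteq> T (\<sigma> 0 * a) \<union> (M 0 \<union> M i)"
      by (auto simp: T_def M_def sba)
    hence "card {j. j < n \<and> z j = a} \<le> card (T (\<sigma> 0 * a) \<union> (M 0 \<union> M i))"
      using fin by (intro card_mono) auto
    also have "\<dots> \<le> card (T (\<sigma> 0 * a)) + (2 * d + 2)"
      using card_Un_le[of "T (\<sigma> 0 * a)" "M 0 \<union> M i"] MM by linarith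
    finally have big: "2 * d + 2 < card (T (\<sigma> 0 * a))" using bal[of a] a by auto
    have "T (- (\<sigma> 0 * a)) \<subseteq> M 0 \<union> M i"
    proof
      fix j assume j: "j \<in> T (- (\<sigma> 0 * a))"
      show "j \<in> M 0 \<union> M i"
      proof (rule ccontr)
        assume "j \<notin> M 0 \<union> M i"
        hence "zb 0 j = \<sigma> 0 * z j" "zb i j = \<sigma> i * z j" using j by (auto simp: T_def M_def)
        hence "\<sigma> i * z j = \<sigma> i * a" "\<sigma> 0 * z j = - (\<sigma> 0 * a)" using j sba by (auto simp: T_def)
        thus False using \<sigma>1[OF i] \<sigma>1[OF n0] a by auto
      qed
    qed
    hence "card (T (- (\<sigma> 0 * a))) \<le> 2 * d + 2"
      using card_mono[of "M 0 \<union> M i" "T (- (\<sigma> 0 * a))"] fin MM by auto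
    hence small: "card (T (- (\<sigma> 0 * a))) < card (T (\<sigma> 0 * a))" using big by linarith
    have "\<sigma> 0 * a \<in> {-1, 1}" using \<sigma>1[OF n0] a by auto
    moreover have "zh i \<in> {-1, 1} \<and> (\<forall>s\<in>{-1, 1}. card (T s) \<le> card (T (zh i)))"
    proof -
      have "1 \<le> i" using False by simp
      from zh[OF this i] show ?thesis unfolding T_def zb_def .
    qed
    ultimately have "zh i = 1 \<or> zh i = -1" "card (T (\<sigma> 0 * a)) \<le> card (T (zh i))"
      by auto
    hence "zh i = \<sigma> 0 * a"
      using small \<sigma>1[OF n0] a by auto
    thus ?thesis by (simp add: a_def)
  qed
  thus thesis using sb that by blast
qed

text \<open>After alignment the unknown sign \<open>\<sigma> 0\<close> is the same for all nodes, so
  the minimum in the loss removes it.\<close>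

lemma loss_le_misclassified:
  fixes z zh \<sigma> :: "nat \<Rightarrow> int"
  assumes "\<And>i. i < n \<Longrightarrow> zh i = \<sigma> 0 * \<sigma> i * sb i" and "\<And>i. i < n \<Longrightarrow> \<sigma> i \<in> {-1, 1}" and n: "0 < n"
  shows "loss n zh z \<le> card {i. i < n \<and> sb i \<noteq> \<sigma> i * z i} / n"
proof -
  define B where "B = {i. i < n \<and> sb i \<noteq> \<sigma> i * z i}"
  have fin: "finite B" by (simp add: B_def)
  have *: "zh i = \<sigma> 0 * z i" if "i < n" "i \<notin> B" for i
    using that assms(1)[of i] assms(2)[of i] by (auto simp: B_def)
  have "\<sigma> 0 = 1 \<or> \<sigma> 0 = -1" using assms(2)[of 0] n by auto
  hence "hamming {..<n} zh z \<le> card B \<or> hamming {..<n} (\<lambda>i. - zh i) z \<le> card B"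
  proof
    assume "\<sigma> 0 = 1"
    hence "{j \<in> {..<n}. zh j \<noteq> z j} \<subseteq> B" using * by force
    hence "hamming {..<n} zh z \<le> card B"
      unfolding hamming_def by (rule card_mono[OF fin])
    thus ?thesis ..
  next
    assume "\<sigma> 0 = -1"
    hence "{j \<in> {..<n}. - zh j \<noteq> z j} \<subseteq> B" using * by force
    hence "hamming {..<n} (\<lambda>i. - zh i) z \<le> card B"
      unfolding hamming_def by (rule card_mono[OF fin])
    thus ?thesis ..
  qed
  hence "min (hamming {..<n} zh z) (hamming {..<n} (\<lambda>i. - zh i) z) \<le> card B" by auto
  thus ?thesis unfolding loss_def B_def[symmetric] by (intro divide_right_mono) auto
qed

lemma init_minus_merge:
  "init_minus Init n i (adj_of (merge_on (node_edges n i 0 L) E' E)) = init_minus Init n i (adj_of E)"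
proof -
  have "delete_node i (adj_of (merge_on (node_edges n i 0 L) E' E)) = delete_node i (adj_of E)"
  proof (intro ext)
    fix l j k
    have "(l, min j k, max j k) \<notin> node_edges n i 0 L" if "j \<noteq> i" "k \<noteq> i"
      using that by (auto simp: node_edges_def min_def max_def split: if_splits)
    thus "delete_node i (adj_of (merge_on (node_edges n i 0 L) E' E)) l j k = delete_node i (adj_of E) l j k"
      by (auto simp: delete_node_def adj_of_def merge_on_def)
  qed
  thus ?thesis by (simp add: init_minus_def)
qed

lemma finite_set_joint: "finite (set_pmf (joint_pmf n L p q \<rho> z))"
proof -
  have "finite {(l, i, j). l < L \<and> i < j \<and> j < n}"
    by (rule finite_subset[of _ "{..<L} \<times> {..<n} \<times> {..<n}"]) auto
  thus ?thesis by (simp add: joint_pmf_def flips_pmf_def edges_pmf_def finite_set_Pi_pmf)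
qed

text \<open>Exponential Markov with parameter 1; since e is at most 3, one flip has moment at most 1
  + 2 \<rho>.\<close>

lemma flips_count_tail:
  fixes d :: real
  assumes \<rho>: "0 \<le> \<rho>" "\<rho> \<le> 1" and l: "l < L"
  shows "measure_pmf.prob (flips_pmf n L \<rho>) {\<xi>. d < card {j. j < n \<and> \<xi> (l, j)}} \<le> exp (2 * real n * \<rho> - d)"
proof -
  define F where "F = {l} \<times> {..<n}"
  have fin: "finite (set_pmf (flips_pmf n L \<rho>))" by (simp add: flips_pmf_def finite_set_Pi_pmf)
  have int [simp]: "integrable (measure_pmf (flips_pmf n L \<rho>)) (f :: _ \<Rightarrow> real)" for f
    by (rule integrable_measure_pmf_finite[OF fin])
  have card_eq: "exp (real (card {j. j < n \<and> \<xi> (l, j)})) = (\<Prod>x\<in>F. exp (of_bool (\<xi> x)))" for \<xi> :: "nat \<times> nat \<Rightarrow> bool"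
  proof -
    have "(\<Prod>x\<in>F. exp (of_bool (\<xi> x) :: real)) = exp (\<Sum>x\<in>F. of_bool (\<xi> x))"
      by (rule exp_sum[symmetric]) (simp add: F_def)
    also have "(\<Sum>x\<in>F. of_bool (\<xi> x) :: real) = (\<Sum>j<n. of_bool (\<xi> (l, j)))"
      unfolding F_def by (rule sum.reindex_bij_witness[of _ "Pair l" snd]) auto
    also have "\<dots> = real (card {j. j < n \<and> \<xi> (l, j)})"
      by (simp add: Int_def)
    finally show ?thesis by simp
  qed
  have "measure_pmf.prob (flips_pmf n L \<rho>) {\<xi>. d < card {j. j < n \<and> \<xi> (l, j)}}
     = measure_pmf.expectation (flips_pmf n L \<rho>) (indicator {\<xi>. d < card {j. j < n \<and> \<xi> (l, j)}})" by simp
  also have "\<dots> \<le> measure_pmf.expectation (flips_pmf n L \<rho>) (\<lambda>\<xi>. exp (- d) * (\<Prod>x\<in>F. exp (of_bool (\<xi> x))))"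
    unfolding card_eq[symmetric] exp_add[symmetric]
    by (intro integral_mono) (auto simp: indicator_def)
  also have "\<dots> = exp (- d) * measure_pmf.expectation (flips_pmf n L \<rho>) (\<lambda>\<xi>. \<Prod>x\<in>F. exp (of_bool (\<xi> x)))"
    by simp
  also have "measure_pmf.expectation (flips_pmf n L \<rho>) (\<lambda>\<xi>. \<Prod>x\<in>F. exp (of_bool (\<xi> x)) :: real)
     = measure_pmf.expectation (Pi_pmf F False (\<lambda>_. bernoulli_pmf \<rho>)) (\<lambda>\<xi>. \<Prod>x\<in>F. exp (of_bool (\<xi> x)))"
    unfolding flips_pmf_def using l by (intro expectation_Pi_pmf_restrict) (auto simp: F_def)
  also have "\<dots> = (\<Prod>x\<in>F. measure_pmf.expectation (bernoulli_pmf \<rho>) (\<lambda>b. exp (of_bool b)))"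
    by (intro expectation_prod_Pi_pmf) (auto simp: F_def integrable_measure_pmf_finite)
  also have "\<dots> = (exp 1 * \<rho> + (1 - \<rho>)) ^ n" using \<rho> by (simp add: F_def)
  also have "\<dots> \<le> exp (2 * \<rho>) ^ n"
  proof (rule power_mono)
    have "exp 1 * \<rho> \<le> 3 * \<rho>" using \<rho> exp_le by (intro mult_right_mono)
    thus "exp 1 * \<rho> + (1 - \<rho>) \<le> exp (2 * \<rho>)" using exp_ge_add_one_self[of "2 * \<rho>"] by linarith
  qed (use \<rho> in simp)
  also have "exp (2 * \<rho>) ^ n = exp (2 * real n * \<rho>)" by (simp add: exp_of_nat_mult[symmetric] mult_ac)
  finally show ?thesis by (simp add: exp_diff exp_minus field_simps)
qed

section \<open>Bad events of a node and the resulting loss\<close>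

definition init_dist :: "nat \<Rightarrow> nat \<Rightarrow> (nat \<Rightarrow> int) \<Rightarrow> (nat \<Rightarrow> int) \<Rightarrow> nat" where
  "init_dist n i y z = min (hamming ({..<n} - {i}) y z) (hamming ({..<n} - {i}) (\<lambda>j. - y j) z)"

definition init_sign :: "nat \<Rightarrow> nat \<Rightarrow> (nat \<Rightarrow> int) \<Rightarrow> (nat \<Rightarrow> int) \<Rightarrow> int" where
  "init_sign n i y z = (if hamming ({..<n} - {i}) y z \<le> hamming ({..<n} - {i}) (\<lambda>j. - y j) z then 1 else -1)"

lemma init_sign_dist:
  "card {j \<in> {..<n} - {i}. y j \<noteq> init_sign n i y z * z j} = init_dist n i y z"
proof -
  have "(- y j \<noteq> z j) = (y j \<noteq> - z j)" for j by auto
  thus ?thesis by (auto simp: init_sign_def init_dist_def hamming_def)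
qed

lemma init_sign_range: "init_sign n i y z \<in> {-1, 1}"
  by (simp add: init_sign_def)

text \<open>The conditions on \<open>d1\<close> and \<open>d2\<close> involve neither edges nor
  flips at \<open>i\<close>, so after conditioning they are deterministic.\<close>

definition node_bad :: "nat \<Rightarrow> nat \<Rightarrow> (nat \<Rightarrow> real) \<Rightarrow> (nat \<Rightarrow> real) \<Rightarrow> real \<Rightarrow> (nat \<Rightarrow> int)
    \<Rightarrow> (nat \<Rightarrow> nat set \<Rightarrow> mnet \<Rightarrow> (nat \<Rightarrow> int)) \<Rightarrow> real \<Rightarrow> real \<Rightarrow> nat
    \<Rightarrow> ((nat \<times> nat \<Rightarrow> bool) \<times> (nat \<times> nat \<times> nat \<Rightarrow> bool)) set" where
  "node_bad n L p q \<rho> z Init d1 d2 i = {(\<xi>, E).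
     let y = init_minus Init n i (adj_of E) in
       real (init_dist n i y z) \<le> d1 \<and> (\<forall>l<L. real (card {j \<in> {..<n} - {i}. \<xi> (l, j)}) \<le> d2) \<and>
       (\<Sum>l<L. clip (ln ((1 - \<rho>) / \<rho>)) (layer_stat n p q i y (init_sign n i y z * z i) l E)) \<le> 0}"

text \<open>Given everything away from \<open>i\<close>, the initialiser and its sign are constants
  by \<open>init_minus_merge\<close>, and \<open>node\<close> applies to them. If the error counts
  are too large the event is empty.\<close>

lemma prob_node_bad:
  fixes d1 d2 B :: real
  assumes i: "i < n"
    and node: "\<And>zt s \<xi>. card {j \<in> {..<n} - {i}. (zt j = s) \<noteq> (z j = z i)} \<le> d1 \<Longrightarrow>
        (\<And>l. l < L \<Longrightarrow> card {j \<in> {..<n} - {i}. \<xi> (l, j)} \<le> d2) \<Longrightarrow>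
        measure_pmf.prob (node_law n L p q \<rho> z i \<xi>)
          {x. (\<Sum>l<L. clip (ln ((1 - \<rho>) / \<rho>)) (layer_stat n p q i zt s l (snd x))) \<le> 0} \<le> B"
    and B: "0 \<le> B"
  shows "measure_pmf.prob (joint_pmf n L p q \<rho> z) (node_bad n L p q \<rho> z Init d1 d2 i) \<le> B"
  unfolding joint_node_decomposition[OF i]
proof (intro prob_bind_pmf_le B)
  fix \<xi> :: "nat \<times> nat \<Rightarrow> bool" and E :: "nat \<times> nat \<times> nat \<Rightarrow> bool"
  define X where "X = node_bad n L p q \<rho> z Init d1 d2 i"
  define f where "f = (\<lambda>(\<eta>, E'). (merge_on ({..<L} \<times> {i}) \<eta> \<xi>, merge_on (node_edges n i 0 L) E' E))"
  define y where "y = init_minus Init n i (adj_of E)"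
  define s where "s = init_sign n i y z * z i"
  have stat: "layer_stat n p q i y s l (merge_on (node_edges n i 0 L) E' E) = layer_stat n p q i y s l E'"
    if "l < L" for l E'
    using that by (intro layer_stat_cong[OF i]) (auto simp: merge_on_def node_edges_def)
  have flips: "{j \<in> {..<n} - {i}. merge_on ({..<L} \<times> {i}) \<eta> \<xi> (l, j)} = {j \<in> {..<n} - {i}. \<xi> (l, j)}" for \<eta> l
    by (auto simp: merge_on_def)
  have sum_stat: "(\<Sum>l<L. clip (ln ((1 - \<rho>) / \<rho>)) (layer_stat n p q i y s l (merge_on (node_edges n i 0 L) E' E)))
      = (\<Sum>l<L. clip (ln ((1 - \<rho>) / \<rho>)) (layer_stat n p q i y s l E'))" for E'
    by (intro sum.cong refl) (simp add: stat)
  have X: "f (\<eta>, E') \<in> X \<longleftrightarrow> real (init_dist n i y z) \<le> d1 \<and>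
      (\<forall>l<L. real (card {j \<in> {..<n} - {i}. \<xi> (l, j)}) \<le> d2) \<and>
      (\<Sum>l<L. clip (ln ((1 - \<rho>) / \<rho>)) (layer_stat n p q i y s l E')) \<le> 0" for \<eta> E'
    unfolding X_def node_bad_def f_def Let_def mem_Collect_eq prod.case init_minus_merge y_def[symmetric] flips
      s_def[symmetric] sum_stat ..
  have "measure_pmf.prob (map_pmf f (node_law n L p q \<rho> z i \<xi>)) X
     = measure_pmf.prob (node_law n L p q \<rho> z i \<xi>) (f -` X)" by (simp add: measure_map_pmf)
  also have "\<dots> \<le> B"
  proof (cases "real (init_dist n i y z) \<le> d1 \<and> (\<forall>l<L. real (card {j \<in> {..<n} - {i}. \<xi> (l, j)}) \<le> d2)")
    case True
    have "card {j \<in> {..<n} - {i}. (y j = s) \<noteq> (z j = z i)} \<le> card {j \<in> {..<n} - {i}. y j \<noteq> init_sign n i y z * z j}"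
      using init_sign_range[of n i y z] by (intro card_mono) (auto simp: s_def)
    also have "\<dots> = init_dist n i y z" by (rule init_sign_dist)
    finally have c: "card {j \<in> {..<n} - {i}. (y j = s) \<noteq> (z j = z i)} \<le> d1" using True by linarith
    have "measure_pmf.prob (node_law n L p q \<rho> z i \<xi>) (f -` X)
      \<le> measure_pmf.prob (node_law n L p q \<rho> z i \<xi>)
          {x. (\<Sum>l<L. clip (ln ((1 - \<rho>) / \<rho>)) (layer_stat n p q i y s l (snd x))) \<le> 0}"
    proof (rule measure_pmf.finite_measure_mono)
      show "f -` X \<subseteq> {x. (\<Sum>l<L. clip (ln ((1 - \<rho>) / \<rho>)) (layer_stat n p q i y s l (snd x))) \<le> 0}"
      proof
        fix x assume "x \<in> f -` X"
        thus "x \<in> {x. (\<Sum>l<L. clip (ln ((1 - \<rho>) / \<rho>)) (layer_stat n p q i y s l (snd x))) \<le> 0}"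
          using X[of "fst x" "snd x"] by simp
      qed
    qed simp
    also have "\<dots> \<le> B" using True by (intro node[OF c]) auto
    finally show ?thesis .
  next
    case False
    have "f -` X = {}"
    proof (rule equals0I)
      fix x assume "x \<in> f -` X"
      thus False using X[of "fst x" "snd x"] False by simp
    qed
    thus ?thesis using B by simp
  qed
  finally show "measure_pmf.prob (map_pmf (\<lambda>(\<eta>, E'). (merge_on ({..<L} \<times> {i}) \<eta> \<xi>, merge_on (node_edges n i 0 L) E' E))
      (node_law n L p q \<rho> z i \<xi>)) (node_bad n L p q \<rho> z Init d1 d2 i) \<le> B"
    by (simp only: f_def X_def)
qed

lemma joint_fst: "measure_pmf.prob (joint_pmf n L p q \<rho> z) {x. Q (fst x)} = measure_pmf.prob (flips_pmf n L \<rho>) {\<xi>. Q \<xi>}"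
proof -
  have "map_pmf fst (joint_pmf n L p q \<rho> z) = flips_pmf n L \<rho>"
    by (simp add: joint_pmf_def map_bind_pmf pmf.map_comp o_def map_pmf_const bind_return_pmf')
  hence "measure_pmf.prob (flips_pmf n L \<rho>) {\<xi>. Q \<xi>} = measure_pmf.prob (map_pmf fst (joint_pmf n L p q \<rho> z)) {\<xi>. Q \<xi>}"
    by simp
  thus ?thesis by (simp add: measure_map_pmf vimage_def)
qed

lemma count_Markov:
  fixes M :: "'a pmf" and X :: "nat \<Rightarrow> 'a set"
  assumes fin: "finite (set_pmf M)" and \<theta>: "0 < \<theta>" and n: "0 < n"
    and X: "\<And>i. i < n \<Longrightarrow> measure_pmf.prob M (X i) \<le> B"
  shows "measure_pmf.prob M {x. real n * \<theta> < card {i. i < n \<and> x \<in> X i}} \<le> B / \<theta>"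
proof -
  have int [simp]: "integrable (measure_pmf M) (f :: 'a \<Rightarrow> real)" for f
    by (rule integrable_measure_pmf_finite[OF fin])
  have cnt: "real (card {i. i < n \<and> x \<in> X i}) = (\<Sum>i<n. indicator (X i) x)" for x
    by (simp add: indicator_def of_bool_def[symmetric] Int_def)
  have "measure_pmf.prob M {x. real n * \<theta> < card {i. i < n \<and> x \<in> X i}}
     = measure_pmf.expectation M (indicator {x. real n * \<theta> < card {i. i < n \<and> x \<in> X i}})" by simp
  also have "\<dots> \<le> measure_pmf.expectation M (\<lambda>x. (\<Sum>i<n. indicator (X i) x) / (real n * \<theta>))"
    unfolding cnt[symmetric] using n \<theta>
    by (intro integral_mono) (auto simp: indicator_def)
  also have "\<dots> = (\<Sum>i<n. measure_pmf.prob M (X i)) / (real n * \<theta>)" by simp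
  also have "\<dots> \<le> (\<Sum>i<n. B) / (real n * \<theta>)"
    using X n \<theta> by (intro divide_right_mono sum_mono) auto
  also have "\<dots> = B / \<theta>" using n by simp
  finally show ?thesis .
qed

text \<open>If no layer has too many flips and all initialisations are good, alignment succeeds and
  every misclassified node lies in its \<open>node_bad\<close>. The number of such nodes is
  controlled through its expectation, which gives \<open>B / \<theta>\<close>.\<close>

lemma loss_failure_bound:
  fixes d1 d2 r B \<theta> :: real
  assumes n: "0 < n" and \<rho>: "0 < \<rho>" "\<rho> < 1/2"
    and z: "\<And>j. j < n \<Longrightarrow> z j \<in> {-1, 1}"
    and bal: "\<And>a. a \<in> {-1, 1} \<Longrightarrow> 4 * d1 + 4 < card {j. j < n \<and> z j = a}" and d1: "0 \<le> d1"
    and init_range: "\<And>V A j. j \<in> V \<Longrightarrow> Init n V A j \<in> {-1, 1}"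
    and init: "\<And>i. i < n \<Longrightarrow> prob_event n L p q \<rho> z (\<lambda>A. d1 < init_dist n i (init_minus Init n i A) z) \<le> r"
    and out: "\<And>A. alg3_global_output n L p q \<rho> Init A (zh A)"
    and bad: "\<And>i. i < n \<Longrightarrow> measure_pmf.prob (joint_pmf n L p q \<rho> z) (node_bad n L p q \<rho> z Init d1 d2 i) \<le> B"
    and \<theta>: "0 < \<theta>"
  shows "1 - (real L * exp (2 * real n * \<rho> - d2) + real n * r + B / \<theta>)
    \<le> prob_event n L p q \<rho> z (\<lambda>A. loss n (zh A) z \<le> \<theta>)"
proof -
  define M where "M = joint_pmf n L p q \<rho> z"
  define F where "F = (\<Union>l<L. {x :: (nat \<times> nat \<Rightarrow> bool) \<times> (nat \<times> nat \<times> nat \<Rightarrow> bool). d2 < card {j. j < n \<and> fst x (l, j)}})"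
  define G where "G = (\<Union>i<n. {(\<xi> :: nat \<times> nat \<Rightarrow> bool, E). d1 < init_dist n i (init_minus Init n i (adj_of E)) z})"
  define X where "X i = node_bad n L p q \<rho> z Init d1 d2 i" for i
  define H where "H = {x. real n * \<theta> < card {i. i < n \<and> x \<in> X i}}"
  define S where "S = {(\<xi> :: nat \<times> nat \<Rightarrow> bool, E). loss n (zh (adj_of E)) z \<le> \<theta>}"
  have "- S \<subseteq> F \<union> G \<union> H"
  proof (rule subsetI, rule ccontr)
    fix x assume xS: "x \<in> - S" and xF: "x \<notin> F \<union> G \<union> H"
    obtain \<xi> E where x: "x = (\<xi>, E)" by (cases x)
    define A where "A = adj_of E"
    define y where "y i = init_minus Init n i A" for i
    define \<sigma> where "\<sigma> i = init_sign n i (y i) z" for i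
    \<comment> \<open>\<open>alignment_correct\<close> counts errors with a natural number, so the
      real bound is rounded down.\<close>
    define d where "d = nat \<lfloor>d1\<rfloor>"
    have d: "real d \<le> d1" using d1 by (simp add: d_def)
    have flips: "real (card {j. j < n \<and> \<xi> (l, j)}) \<le> d2" if "l < L" for l
      using xF that by (auto simp: F_def x not_less)
    have dist: "real (init_dist n i (y i) z) \<le> d1" if "i < n" for i
      using xF that by (auto simp: G_def x y_def A_def not_less)
    have \<sigma>: "\<sigma> i \<in> {-1, 1}" for i unfolding \<sigma>_def by (rule init_sign_range)
    obtain sb where sb: "\<And>i. i < n \<Longrightarrow> stage2_global_argmax n L p q \<rho> A i (y i) (sb i)"
      and zh: "\<And>i. i < n \<Longrightarrow> zh A i = \<sigma> 0 * \<sigma> i * sb i"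
    proof (rule alignment_correct[OF out[of A], where z = z and \<sigma> = \<sigma> and d = d, folded y_def])
      show "card {j \<in> {..<n} - {i}. y i j \<noteq> \<sigma> i * z j} \<le> d" if "i < n" for i
        using dist[OF that] unfolding \<sigma>_def init_sign_dist d_def by (simp add: le_nat_floor)
      show "4 * d + 4 < card {j. j < n \<and> z j = a}" if "a \<in> {-1, 1}" for a
      proof -
        have "real (4 * d + 4) \<le> 4 * d1 + 4" using d by simp
        also have "\<dots> < real (card {j. j < n \<and> z j = a})" by (rule bal[OF that])
        finally show ?thesis by (simp only: of_nat_less_iff)
      qed
    qed (use z \<sigma> in auto)
    have "loss n (zh A) z \<le> card {i. i < n \<and> sb i \<noteq> \<sigma> i * z i} / n"
      using zh \<sigma> n by (rule loss_le_misclassified)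
    also have "card {i. i < n \<and> sb i \<noteq> \<sigma> i * z i} \<le> card {i. i < n \<and> x \<in> X i}"
    proof (intro card_mono subsetI)
      fix i assume "i \<in> {i. i < n \<and> sb i \<noteq> \<sigma> i * z i}"
      hence i: "i < n" and ne: "sb i \<noteq> \<sigma> i * z i" by auto
      define s where "s = \<sigma> i * z i"
      have s: "s \<in> {-1, 1}" using \<sigma>[of i] z[OF i] by (auto simp: s_def)
      have "sb i \<in> {-1, 1}" using sb[OF i] by (simp add: stage2_global_argmax_def)
      hence sbs: "sb i = - s" using ne s by (auto simp: s_def[symmetric])
      have "(\<Sum>l<L. clip (ln ((1 - \<rho>) / \<rho>)) (layer_stat n p q i (y i) s l E)) \<le> 0"
      proof (rule stage2_opposite_imp_clip)
        show "0 \<le> ln ((1 - \<rho>) / \<rho>)" using Jrho_facts(3)[OF \<rho>] by simp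
        show "stage2_global_argmax n L p q \<rho> (adj_of E) i (y i) (- s)" using sb[OF i] sbs by (simp add: A_def)
        show "y i j \<in> {-1, 1}" if "j < n" "j \<noteq> i" for j
          using that unfolding y_def init_minus_def by (intro init_range) auto
      qed (rule s)
      moreover have "real (card {j \<in> {..<n} - {i}. \<xi> (l, j)}) \<le> d2" if "l < L" for l
      proof -
        have "card {j \<in> {..<n} - {i}. \<xi> (l, j)} \<le> card {j. j < n \<and> \<xi> (l, j)}"
          by (intro card_mono) auto
        thus ?thesis using flips[OF that] by linarith
      qed
      ultimately have "x \<in> X i"
        using dist[OF i] unfolding X_def node_bad_def x s_def \<sigma>_def y_def A_def by (simp add: Let_def)
      thus "i \<in> {i. i < n \<and> x \<in> X i}" using i by simp
    qed simp
    finally have "loss n (zh A) z \<le> real (card {i. i < n \<and> x \<in> X i}) / n"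
      using n by (simp add: divide_right_mono)
    also have "\<dots> \<le> real n * \<theta> / n" using xF by (intro divide_right_mono) (auto simp: H_def)
    finally have "loss n (zh A) z \<le> \<theta>" using n by simp
    thus False using xS by (simp add: S_def x A_def)
  qed
  hence "measure_pmf.prob M (- S) \<le> measure_pmf.prob M (F \<union> G \<union> H)"
    by (intro measure_pmf.finite_measure_mono) auto
  also have "\<dots> \<le> measure_pmf.prob M F + measure_pmf.prob M G + measure_pmf.prob M H"
    using measure_Un_le[of "F \<union> G" "measure_pmf M" H] measure_Un_le[of F "measure_pmf M" G] by simp
  also have "measure_pmf.prob M F \<le> real L * exp (2 * real n * \<rho> - d2)"
  proof -
    have "measure_pmf.prob M F \<le> (\<Sum>l<L. measure_pmf.prob M {x. d2 < card {j. j < n \<and> fst x (l, j)}})"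
      unfolding F_def by (intro measure_UNION_le) auto
    also have "\<dots> \<le> (\<Sum>l<L. exp (2 * real n * \<rho> - d2))"
    proof (rule sum_mono)
      fix l assume "l \<in> {..<L}"
      thus "measure_pmf.prob M {x. d2 < card {j. j < n \<and> fst x (l, j)}} \<le> exp (2 * real n * \<rho> - d2)"
        unfolding M_def joint_fst[where Q = "\<lambda>\<xi>. d2 < card {j. j < n \<and> \<xi> (l, j)}"]
        using \<rho> by (intro flips_count_tail) auto
    qed
    finally show ?thesis by simp
  qed
  also have "measure_pmf.prob M G \<le> real n * r"
  proof -
    have "measure_pmf.prob M G \<le> (\<Sum>i<n. measure_pmf.prob M {(\<xi>, E). d1 < init_dist n i (init_minus Init n i (adj_of E)) z})"
      unfolding G_def by (intro measure_UNION_le) auto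
    also have "\<dots> \<le> (\<Sum>i<n. r)"
      using init unfolding prob_event_joint M_def by (intro sum_mono) auto
    finally show ?thesis by simp
  qed
  also have "measure_pmf.prob M H \<le> B / \<theta>"
    unfolding H_def using bad by (intro count_Markov \<theta> n) (auto simp: M_def X_def finite_set_joint)
  finally have "measure_pmf.prob M (- S) \<le> real L * exp (2 * real n * \<rho> - d2) + real n * r + B / \<theta>" by simp
  moreover have "measure_pmf.prob M (- S) = 1 - measure_pmf.prob M S"
    using measure_pmf.prob_compl[of S M] by (simp add: Compl_eq_Diff_UNIV)
  ultimately show ?thesis unfolding prob_event_joint M_def[symmetric] S_def[symmetric] by linarith
qed

section \<open>Asymptotics\<close>

text \<open>\<open>k n\<close> is the largest index up to \<open>n\<close> whose threshold has been
  passed. Inserting 0 keeps the set nonempty; that value is justified only from \<open>N 0\<close>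
  on.\<close>

lemma diagonal_sequence:
  fixes Q :: "real \<Rightarrow> nat \<Rightarrow> bool"
  assumes "\<And>k::nat. \<forall>\<^sub>F n in sequentially. Q (inverse (real (Suc k))) n"
  obtains \<delta> where "\<delta> \<longlonglongrightarrow> 0" "\<forall>\<^sub>F n in sequentially. Q (\<delta> n) n"
proof -
  have "\<forall>k. \<exists>N. \<forall>n\<ge>N. Q (inverse (real (Suc k))) n"
    using assms by (simp add: eventually_sequentially)
  then obtain N where N: "\<And>k n. N k \<le> n \<Longrightarrow> Q (inverse (real (Suc k))) n" by metis
  define A where "A n = insert 0 {k. k \<le> n \<and> N k \<le> n}" for n
  define k where "k n = Max (A n)" for n
  have fin: "finite (A n)" for n by (simp add: A_def)
  have kA: "k n \<in> A n" for n unfolding k_def by (intro Max_in fin) (simp add: A_def)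
  have "filterlim k at_top sequentially"
    unfolding filterlim_at_top
  proof
    fix Z
    show "\<forall>\<^sub>F n in sequentially. Z \<le> k n"
      using eventually_ge_at_top[of "max Z (N Z)"]
      by eventually_elim (auto simp: k_def A_def intro!: Max_ge)
  qed
  hence "(\<lambda>n. inverse (real (Suc (k n)))) \<longlonglongrightarrow> 0"
    by (rule filterlim_compose[OF LIMSEQ_inverse_real_of_nat])
  moreover have "\<forall>\<^sub>F n in sequentially. Q (inverse (real (Suc (k n)))) n"
    using eventually_ge_at_top[of "N 0"]
  proof eventually_elim
    case (elim n)
    hence "N (k n) \<le> n" using kA[of n] by (auto simp: A_def)
    thus ?case by (rule N)
  qed
  ultimately show thesis by (rule that)
qed

lemma Jrho_ge:
  assumes "0 < \<rho>" "\<rho> < 1/2" "\<rho> \<le> exp (- 2 * Z) / 4"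
  shows "Z \<le> Jrho \<rho>"
proof -
  have pos: "0 < \<rho> * (1 - \<rho>)" using assms by simp
  have "\<rho> * (1 - \<rho>) \<le> \<rho> * 1" using assms by (intro mult_left_mono) auto
  hence "4 * (\<rho> * (1 - \<rho>)) \<le> exp (- 2 * Z)" using assms(3) by linarith
  hence "sqrt (4 * (\<rho> * (1 - \<rho>))) \<le> sqrt ((exp (- Z))\<^sup>2)"
    by (intro real_sqrt_le_mono) (simp add: power2_eq_square exp_add[symmetric])
  hence "2 * sqrt (\<rho> * (1 - \<rho>)) \<le> exp (- Z)" by (simp add: real_sqrt_mult)
  hence "ln (2 * sqrt (\<rho> * (1 - \<rho>))) \<le> ln (exp (- Z))" using pos by (intro ln_mono) auto
  thus ?thesis by (simp add: Jrho_def)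
qed

lemma prob_event_mono:
  assumes "\<And>A. P A \<Longrightarrow> P' A"
  shows "prob_event n L p q \<rho> z P \<le> prob_event n L p q \<rho> z P'"
  unfolding prob_event_def using assms by (intro measure_pmf.finite_measure_mono) auto

text \<open>Six multiples of \<eta> are lost in \<open>node_error_prob\<close> and one in Markov's
  inequality, where the quotient \<open>exp (- \<eta> * I n)\<close> still tends to 0. All
  thresholds in \<open>n\<close> are found before \<open>z\<close> is fixed, which gives uniformity
  over \<open>z\<close>.\<close>

lemma loss_rate_eventually:
  fixes L :: "nat \<Rightarrow> nat"
    and p q :: "nat \<Rightarrow> nat \<Rightarrow> real"
    and \<rho> \<beta> \<delta> :: "nat \<Rightarrow> real"
    and c c' C C' \<epsilon>0 \<eta> :: real
    and Init :: "nat \<Rightarrow> nat set \<Rightarrow> mnet \<Rightarrow> (nat \<Rightarrow> int)"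
    and zhat :: "nat \<Rightarrow> mnet \<Rightarrow> (nat \<Rightarrow> int)"
  assumes rho_range: "\<And>n. 0 < \<rho> n \<and> \<rho> n < 1/2"
    and rho_o1: "\<rho> \<longlonglongrightarrow> 0"
    and L_pos: "\<And>n. 1 \<le> L n"
    and pq_range: "\<And>n l. l < L n \<Longrightarrow> 0 < q n l \<and> q n l < p n l \<and> p n l < 1"
    and pq_asymp: "\<And>n l. l < L n \<Longrightarrow> p n l \<le> C * q n l" and C: "1 \<le> C"
    and p_o1: "(\<lambda>n. Max (p n ` {..<L n})) \<longlonglongrightarrow> 0"
    and beta_lim: "\<beta> \<longlonglongrightarrow> 1"
    and L_poly: "\<And>n. 1 \<le> n \<Longrightarrow> real (L n) \<le> real n powr c" and c: "0 < c"
    and Init_range: "\<And>n V A j. j \<in> V \<Longrightarrow> Init n V A j \<in> {-1, 1}"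
    and delta: "\<delta> \<longlonglongrightarrow> 0" and eps0: "0 < \<epsilon>0" and C': "0 < C'"
    and init: "\<And>n z i. in_Pn n (\<beta> n) z \<Longrightarrow> i < n \<Longrightarrow>
           prob_event n (L n) (p n) (q n) (\<rho> n) z
             (\<lambda>A. real n * \<delta> n < init_dist n i (init_minus Init n i A) z)
           \<le> C' * real n powr (- (1 + \<epsilon>0))"
    and c': "0 < c'" "c' < 1"
    and rate: "(\<lambda>n. ln (real (L n)) + real (L n) * exp (- c' * Jrho (\<rho> n)))
          \<in> o(\<lambda>n. minIS n (L n) (p n) (q n) (\<rho> n))"
    and minI_inf: "filterlim (\<lambda>n. minIS n (L n) (p n) (q n) (\<rho> n)) at_top sequentially"
    and zhat_alg3: "\<And>n A. alg3_global_output n (L n) (p n) (q n) (\<rho> n) Init A (zhat n A)"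
    and \<eta>: "0 < \<eta>" "\<eta> \<le> 1/2"
  shows "\<forall>\<^sub>F n in sequentially. \<forall>z. in_Pn n (\<beta> n) z \<longrightarrow>
    1 - 7 * \<eta> \<le> prob_event n (L n) (p n) (q n) (\<rho> n) z
      (\<lambda>A. loss n (zhat n A) z \<le> exp (- (1 - 7 * \<eta>) * minIS n (L n) (p n) (q n) (\<rho> n)))"
proof -
  define J where "J n = Jrho (\<rho> n)" for n
  define I where "I n = minIS n (L n) (p n) (q n) (\<rho> n)" for n
  define K where "K = nat \<lceil>1 / \<eta>\<rceil>"
  \<comment> \<open>The absolute value guards against a negative \<open>\<delta> n\<close>.\<close>
  define d1 where "d1 n = real n * \<bar>\<delta> n\<bar>" for n
  \<comment> \<open>Leaves an exponent of at most minus \<open>sqrt n\<close> in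
    \<open>flips_count_tail\<close>, which beats the polynomial number of layers, while
    \<open>d2 n\<close> is still of smaller order than \<open>n\<close>.\<close>
  define d2 where "d2 n = 3 * (real n * \<rho> n) + sqrt (real n)" for n
  define m where "m n = real n / (2 * \<beta> n)" for n
  \<comment> \<open>Chosen so that half of \<open>n * \<kappa> n\<close> is the class imbalance plus
    \<open>d1 n + d2 n + 1\<close>, as \<open>agreement_counts\<close> demands.\<close>
  define \<kappa> where "\<kappa> n = \<bar>1 - 1 / \<beta> n\<bar> + 2 * \<bar>\<delta> n\<bar> + 6 * \<rho> n + 2 / sqrt (real n) + 2 / real n" for n
  define rest where "rest n = real n powr c * exp (- sqrt (real n)) + real n * (C' * real n powr (- (1 + \<epsilon>0)))
      + exp (- \<eta> * I n)" for n
  have K: "1 \<le> \<eta> * real K" "1 \<le> K"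
  proof -
    have "1 / \<eta> \<le> real K" unfolding K_def by (rule real_nat_ceiling_ge)
    thus 1: "1 \<le> \<eta> * real K" using \<eta> by (simp add: divide_le_eq mult.commute)
    show "1 \<le> K" using 1 by (cases K) auto
  qed
  have kappa_lim: "\<kappa> \<longlonglongrightarrow> 0"
  proof -
    have "(\<lambda>n. 1 - 1 / \<beta> n) \<longlonglongrightarrow> 1 - 1 / 1" by (intro tendsto_intros beta_lim) auto
    hence "(\<lambda>n. \<bar>1 - 1 / \<beta> n\<bar> + 2 * \<bar>\<delta> n\<bar> + 6 * \<rho> n + 2 / sqrt (real n) + 2 / real n)
        \<longlonglongrightarrow> \<bar>1 - 1 / 1\<bar> + 2 * \<bar>0\<bar> + 6 * 0 + 0 + 0"
      by (intro tendsto_add tendsto_mult tendsto_rabs delta rho_o1 tendsto_const) (assumption | real_asymp)+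
    thus ?thesis unfolding \<kappa>_def by simp
  qed
  have ev_kappa: "\<forall>\<^sub>F n in sequentially. \<kappa> n * (1 + 8 * C / \<eta>) < \<eta>"
  proof -
    have "(\<lambda>n. \<kappa> n * (1 + 8 * C / \<eta>)) \<longlonglongrightarrow> 0 * (1 + 8 * C / \<eta>)"
      by (intro tendsto_mult kappa_lim tendsto_const)
    thus ?thesis using \<eta>(1) by (intro order_tendstoD(2)) auto
  qed
  have ev_bal: "\<forall>\<^sub>F n in sequentially. 4 * d1 n + 4 < m n"
  proof -
    have "(\<lambda>n. 4 * \<bar>\<delta> n\<bar> + 4 / real n - 1 / (2 * \<beta> n)) \<longlonglongrightarrow> 4 * \<bar>0\<bar> + 0 - 1 / (2 * 1)"
      by (intro tendsto_diff tendsto_add tendsto_mult tendsto_rabs delta tendsto_divide tendsto_const beta_lim)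
         (simp | real_asymp)+
    hence "\<forall>\<^sub>F n in sequentially. 4 * \<bar>\<delta> n\<bar> + 4 / real n - 1 / (2 * \<beta> n) < 0"
      by (intro order_tendstoD(2)) auto
    thus ?thesis using eventually_gt_at_top[of 0]
    proof eventually_elim
      case (elim n)
      hence "real n * (4 * \<bar>\<delta> n\<bar> + 4 / real n) < real n * (1 / (2 * \<beta> n))"
        by (intro mult_strict_left_mono) auto
      thus ?case using elim by (simp add: d1_def m_def algebra_simps)
    qed
  qed
  have ev_J: "\<forall>\<^sub>F n in sequentially. 2 \<le> \<eta> * (1 - \<eta>) * (1 - c') * J n"
  proof -
    define w where "w = \<eta> * (1 - \<eta>) * (1 - c')"
    have w: "0 < w" unfolding w_def using \<eta> c' by (intro mult_pos_pos) auto
    have "\<forall>\<^sub>F n in sequentially. \<rho> n < exp (- 2 * (2 / w)) / 4"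
      using rho_o1 by (rule order_tendstoD) simp
    thus ?thesis
    proof eventually_elim
      case (elim n)
      hence "2 / w \<le> J n" unfolding J_def using rho_range[of n] by (intro Jrho_ge) auto
      hence "2 \<le> w * J n" using w by (simp add: divide_le_eq mult.commute)
      thus ?case by (simp only: w_def)
    qed
  qed
  \<comment> \<open>The constant offsets the factor \<open>2 * K\<close> in front of the logarithm
    of \<open>L\<close>, so that this term takes half of \<open>\<eta> * I n\<close>; the other half
    is kept for the constants depending on \<open>K\<close>.\<close>
  have ev_rate: "\<forall>\<^sub>F n in sequentially. ln (real (L n)) + real (L n) * exp (- c' * J n) \<le> \<eta> / (4 * K) * \<bar>I n\<bar>"
  proof -
    have "0 < \<eta> / (4 * real K)" using \<eta> K by simp
    from landau_o.smallD[OF rate this] show ?thesis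
      unfolding I_def J_def by eventually_elim auto
  qed
  have ev_I: "\<forall>\<^sub>F n in sequentially. max 0 ((2 * real K * ln 3 + 2 * ln (real K) + ln 2) * (2 / \<eta>)) \<le> I n"
    using minI_inf unfolding I_def filterlim_at_top by blast
  have ev_p: "\<forall>\<^sub>F n in sequentially. Max (p n ` {..<L n}) < 1/2"
    using p_o1 by (rule order_tendstoD) simp
  have "rest \<longlonglongrightarrow> 0 + 0 + 0"
    unfolding rest_def
  proof (intro tendsto_add)
    show "(\<lambda>n. real n powr c * exp (- sqrt (real n))) \<longlonglongrightarrow> 0" using c by real_asymp
    show "(\<lambda>n. real n * (C' * real n powr (- (1 + \<epsilon>0)))) \<longlonglongrightarrow> 0" using eps0 C' by real_asymp
    have "filterlim (\<lambda>n. - \<eta> * I n) at_bot sequentially"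
      using minI_inf \<eta> unfolding I_def by (intro filterlim_tendsto_neg_mult_at_bot[OF tendsto_const]) auto
    thus "(\<lambda>n. exp (- \<eta> * I n)) \<longlonglongrightarrow> 0" by (rule filterlim_compose[OF exp_at_bot])
  qed
  hence ev_rest: "\<forall>\<^sub>F n in sequentially. rest n < 7 * \<eta>"
    using \<eta> by (intro order_tendstoD(2)) auto
  show ?thesis
    using ev_kappa ev_bal ev_J ev_rate ev_I ev_p ev_rest eventually_gt_at_top[of 0]
  proof eventually_elim
    case (elim n)
    note ek = elim(1) and ebal = elim(2) and eJ = elim(3) and erate = elim(4) and eI = elim(5)
      and ep = elim(6) and erest = elim(7) and n0 = elim(8)
    have I0: "0 \<le> I n" using eI by simp
    have n1: "1 \<le> n" using n0 by simp
    have rhon: "0 < \<rho> n" "\<rho> n < 1/2" using rho_range[of n] by auto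
    have L1: "1 \<le> L n" by (rule L_pos)
    have lnL: "0 \<le> ln (real (L n))" using L1 by simp
    have Lexp: "0 \<le> real (L n) * exp (- c' * J n)" by simp
    have aI: "\<bar>I n\<bar> = I n" using I0 by simp
    have small_K: "\<eta> / (4 * K) * I n \<le> \<eta> / 4 * I n"
      using \<eta> K I0 by (intro mult_right_mono divide_left_mono) auto
    have cond2: "2 * (real (L n) * exp (- c' * J n)) \<le> \<eta> * I n"
    proof -
      have "real (L n) * exp (- c' * J n) \<le> \<eta> / 4 * I n"
        using erate lnL small_K unfolding aI by linarith
      moreover have "0 \<le> \<eta> * I n" using \<eta> I0 by simp
      ultimately show ?thesis by linarith
    qed
    have cond3: "2 * real K * ln (3 * real (L n)) + 2 * ln (real K) + ln 2 \<le> \<eta> * I n"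
    proof -
      have "ln (real (L n)) \<le> \<eta> / (4 * K) * I n" using erate Lexp unfolding aI by linarith
      hence "2 * real K * ln (real (L n)) \<le> 2 * real K * (\<eta> / (4 * K) * I n)"
        by (intro mult_left_mono) auto
      also have "\<dots> = \<eta> / 2 * I n" using K by simp
      finally have 1: "2 * real K * ln (real (L n)) \<le> \<eta> / 2 * I n" .
      have "(2 * real K * ln 3 + 2 * ln (real K) + ln 2) * (2 / \<eta>) \<le> I n" using eI by simp
      hence "(2 * real K * ln 3 + 2 * ln (real K) + ln 2) * (2 / \<eta>) * (\<eta> / 2) \<le> I n * (\<eta> / 2)"
        using \<eta> by (intro mult_right_mono) auto
      hence 2: "2 * real K * ln 3 + 2 * ln (real K) + ln 2 \<le> \<eta> / 2 * I n"
        using \<eta> by (simp add: mult.commute)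
      have "2 * real K * ln (3 * real (L n)) = 2 * real K * ln 3 + 2 * real K * ln (real (L n))"
        using L1 by (simp add: ln_mult algebra_simps)
      thus ?thesis using 1 2 by linarith
    qed
    have pq: "0 < q n l \<and> q n l < p n l \<and> p n l \<le> 1/2 \<and> p n l \<le> C * q n l" if "l < L n" for l
    proof -
      have "p n l \<le> Max (p n ` {..<L n})" using that by (intro Max_ge) auto
      thus ?thesis using ep pq_range[OF that] pq_asymp[OF that] by linarith
    qed
    show ?case
    proof (intro allI impI)
      fix z assume zP: "in_Pn n (\<beta> n) z"
      have z: "z j \<in> {-1, 1}" if "j < n" for j using zP that by (auto simp: in_Pn_def)
      have bal: "m n \<le> card {j. j < n \<and> z j = a}" if "a \<in> {-1, 1}" for a
        using zP that unfolding in_Pn_def m_def by blast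
      have "real n * (2 / sqrt (real n)) = 2 * (real n / sqrt (real n))" by simp
      also have "real n / sqrt (real n) = sqrt (real n)" by (rule real_div_sqrt) simp
      finally have sq: "real n * (2 / sqrt (real n)) = 2 * sqrt (real n)" .
      have rr: "real n * (6 * \<rho> n) = 6 * (real n * \<rho> n)" "real n * (2 * \<bar>\<delta> n\<bar>) = 2 * (real n * \<bar>\<delta> n\<bar>)"
        "real n * (2 / real n) = 2"
        using n0 by simp_all
      have kn: "real n * \<kappa> n = real n * \<bar>1 - 1 / \<beta> n\<bar> + 2 * d1 n + 6 * (real n * \<rho> n) + 2 * sqrt (real n) + 2"
        unfolding \<kappa>_def d1_def distrib_left sq rr ..
      have d10: "0 \<le> d1 n" by (simp add: d1_def)
      have node: "measure_pmf.prob (node_law n (L n) (p n) (q n) (\<rho> n) z i \<xi>)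
          {x. (\<Sum>l<L n. clip (ln ((1 - \<rho> n) / \<rho> n)) (layer_stat n (p n) (q n) i zt s l (snd x))) \<le> 0}
          \<le> exp (- (1 - 6 * \<eta>) * I n)"
        if i: "i < n" and b1: "card {j \<in> {..<n} - {i}. (zt j = s) \<noteq> (z j = z i)} \<le> d1 n"
          and b2: "\<And>l. l < L n \<Longrightarrow> card {j \<in> {..<n} - {i}. \<xi> (l, j)} \<le> d2 n" for i zt s \<xi>
        unfolding I_def
      proof (rule node_error_prob[where m = "m n" and \<kappa> = "\<kappa> n" and C = C and K = K and c' = c'
            and ?d1.0 = "d1 n" and ?d2.0 = "d2 n", OF i rhon L1 pq C z bal b1 b2])
        have lin: "x / 2 - (a + 2 * d + 6 * r + 2 * s + 2) / 2 = x / 2 - a / 2 - d - 3 * r - s - 1"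
          for x a d r s :: real by (simp add: field_simps)
        have e: "real n / 2 * (1 - \<kappa> n) = real n / 2 - real n * \<kappa> n / 2"
          by (simp add: right_diff_distrib)
        have "real n / 2 * (1 - \<kappa> n) = real n / 2 - real n * \<bar>1 - 1 / \<beta> n\<bar> / 2 - d1 n - 3 * (real n * \<rho> n) - sqrt (real n) - 1"
          unfolding e kn by (rule lin)
        also have "\<dots> = real n / 2 - real n * \<bar>1 - 1 / \<beta> n\<bar> / 2 - d1 n - d2 n - 1" by (simp add: d2_def)
        also have "real n / 2 - real n * \<bar>1 - 1 / \<beta> n\<bar> / 2 \<le> m n"
        proof -
          have "real n / 2 * (1 - 1 / \<beta> n) \<le> real n / 2 * \<bar>1 - 1 / \<beta> n\<bar>"
            by (intro mult_left_mono) auto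
          thus ?thesis by (simp add: m_def algebra_simps)
        qed
        finally show "real n / 2 * (1 - \<kappa> n) \<le> m n - d1 n - d2 n - 1" by simp
        have "0 \<le> real n * \<bar>1 - 1 / \<beta> n\<bar>" "0 \<le> real n * \<rho> n" "0 \<le> sqrt (real n)" using rhon by auto
        thus "d1 n + d2 n \<le> real n * \<kappa> n" unfolding kn d2_def using d10 by linarith
      qed (use ek \<eta> c' K eJ I0 cond2 cond3 in \<open>simp_all add: I_def J_def\<close>)
      have "1 - (real (L n) * exp (2 * real n * \<rho> n - d2 n) + real n * (C' * real n powr (- (1 + \<epsilon>0)))
           + exp (- (1 - 6 * \<eta>) * I n) / exp (- (1 - 7 * \<eta>) * I n))
        \<le> prob_event n (L n) (p n) (q n) (\<rho> n) z (\<lambda>A. loss n (zhat n A) z \<le> exp (- (1 - 7 * \<eta>) * I n))"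
      proof (rule loss_failure_bound[where ?d1.0 = "d1 n" and Init = Init, OF n0 rhon z])
        show "4 * d1 n + 4 < card {j. j < n \<and> z j = a}" if "a \<in> {-1, 1}" for a
          using bal[OF that] ebal by linarith
        show "alg3_global_output n (L n) (p n) (q n) (\<rho> n) Init A (zhat n A)" for A by (rule zhat_alg3)
        show "prob_event n (L n) (p n) (q n) (\<rho> n) z (\<lambda>A. d1 n < init_dist n i (init_minus Init n i A) z)
            \<le> C' * real n powr (- (1 + \<epsilon>0))" if "i < n" for i
        proof -
          have "real n * \<delta> n \<le> d1 n" unfolding d1_def by (intro mult_left_mono) auto
          hence "prob_event n (L n) (p n) (q n) (\<rho> n) z (\<lambda>A. d1 n < init_dist n i (init_minus Init n i A) z)
            \<le> prob_event n (L n) (p n) (q n) (\<rho> n) z (\<lambda>A. real n * \<delta> n < init_dist n i (init_minus Init n i A) z)"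
            by (intro prob_event_mono) linarith
          also have "\<dots> \<le> C' * real n powr (- (1 + \<epsilon>0))" by (rule init[OF zP that])
          finally show ?thesis .
        qed
        show "measure_pmf.prob (joint_pmf n (L n) (p n) (q n) (\<rho> n) z)
            (node_bad n (L n) (p n) (q n) (\<rho> n) z Init (d1 n) (d2 n) i) \<le> exp (- (1 - 6 * \<eta>) * I n)"
          if "i < n" for i
          using that by (intro prob_node_bad node) auto
      qed (use d10 Init_range in auto)
      moreover have "real (L n) * exp (2 * real n * \<rho> n - d2 n) \<le> real n powr c * exp (- sqrt (real n))"
      proof (rule mult_mono)
        have "0 \<le> real n * \<rho> n" using rhon by simp
        thus "exp (2 * real n * \<rho> n - d2 n) \<le> exp (- sqrt (real n))" by (simp add: d2_def)
      qed (use L_poly[OF n1] in auto)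
      moreover have "exp (- (1 - 6 * \<eta>) * I n) / exp (- (1 - 7 * \<eta>) * I n) = exp (- \<eta> * I n)"
        unfolding exp_diff[symmetric] by (simp add: algebra_simps)
      ultimately have "1 - rest n
        \<le> prob_event n (L n) (p n) (q n) (\<rho> n) z (\<lambda>A. loss n (zhat n A) z \<le> exp (- (1 - 7 * \<eta>) * I n))"
        unfolding rest_def by linarith
      thus "1 - 7 * \<eta> \<le> prob_event n (L n) (p n) (q n) (\<rho> n) z
          (\<lambda>A. loss n (zhat n A) z \<le> exp (- (1 - 7 * \<eta>) * minIS n (L n) (p n) (q n) (\<rho> n)))"
        using erest unfolding I_def by linarith
    qed
  qed
qed

theorem mainTheorem17:
  fixes L :: "nat \<Rightarrow> nat"
    and p q :: "nat \<Rightarrow> nat \<Rightarrow> real"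
    and \<rho> \<beta> :: "nat \<Rightarrow> real"
    and c :: real
    and Init :: "nat \<Rightarrow> nat set \<Rightarrow> mnet \<Rightarrow> (nat \<Rightarrow> int)"
    and zhat :: "nat \<Rightarrow> mnet \<Rightarrow> (nat \<Rightarrow> int)"
  assumes rho_range: "\<And>n. 0 < \<rho> n \<and> \<rho> n < 1/2"
    and rho_o1: "\<rho> \<longlonglongrightarrow> 0"
    and L_pos: "\<And>n. 1 \<le> L n"
    and pq_range: "\<And>n l. l < L n \<Longrightarrow> 0 < q n l \<and> q n l < p n l \<and> p n l < 1"
    and pq_asymp: "\<exists>C. \<forall>n l. l < L n \<longrightarrow> p n l \<le> C * q n l"
    and p_o1: "(\<lambda>n. Max (p n ` {..<L n})) \<longlonglongrightarrow> 0"
    and beta_lim: "\<beta> \<longlonglongrightarrow> 1"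
    and c_pos: "0 < c"
    and L_poly: "\<And>n. 1 \<le> n \<Longrightarrow> real (L n) \<le> real n powr c"
    and Init_range: "\<And>n V A j. j \<in> V \<Longrightarrow> Init n V A j \<in> {-1, 1}"
    and Init_consistent: "\<exists>\<delta> \<epsilon> C'. \<delta> \<longlonglongrightarrow> 0 \<and> 0 < \<epsilon> \<and> 0 < C' \<and>
        (\<forall>n z i. in_Pn n (\<beta> n) z \<longrightarrow> i < n \<longrightarrow>
           prob_event n (L n) (p n) (q n) (\<rho> n) z
             (\<lambda>A. real (min (hamming ({..<n} - {i}) (init_minus Init n i A) z)
                             (hamming ({..<n} - {i}) (\<lambda>j. - init_minus Init n i A j) z))
                   > real n * \<delta> n)
           \<le> C' * real n powr (- (1 + \<epsilon>)))"
    and rate: "\<exists>c'. 0 < c' \<and> c' < 1 \<and>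
        (\<lambda>n. ln (real (L n)) + real (L n) * exp (- c' * Jrho (\<rho> n)))
          \<in> o(\<lambda>n. minIS n (L n) (p n) (q n) (\<rho> n))"
    and minI_inf: "filterlim (\<lambda>n. minIS n (L n) (p n) (q n) (\<rho> n)) at_top sequentially"
    and zhat_alg3: "\<And>n A. alg3_global_output n (L n) (p n) (q n) (\<rho> n) Init A (zhat n A)"
  shows "\<exists>\<delta>bar. \<delta>bar \<longlonglongrightarrow> 0 \<and>
           (\<forall>\<epsilon>>0. \<forall>\<^sub>F n in sequentially. \<forall>z. in_Pn n (\<beta> n) z \<longrightarrow>
              prob_event n (L n) (p n) (q n) (\<rho> n) z
                (\<lambda>A. loss n (zhat n A) z \<le> exp (- (1 - \<delta>bar n) * minIS n (L n) (p n) (q n) (\<rho> n)))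
              \<ge> 1 - \<epsilon>)"
proof -
  obtain C where C: "\<And>n l. l < L n \<Longrightarrow> p n l \<le> C * q n l" using pq_asymp by blast
  have C1: "p n l \<le> max 1 C * q n l" if "l < L n" for n l
  proof -
    have "C * q n l \<le> max 1 C * q n l" using pq_range[OF that] by (intro mult_right_mono) auto
    thus ?thesis using C[OF that] by linarith
  qed
  obtain \<delta> \<epsilon>0 C' where init: "\<delta> \<longlonglongrightarrow> 0" "0 < \<epsilon>0" "0 < C'"
    "\<And>n z i. in_Pn n (\<beta> n) z \<Longrightarrow> i < n \<Longrightarrow>
           prob_event n (L n) (p n) (q n) (\<rho> n) z
             (\<lambda>A. real n * \<delta> n < init_dist n i (init_minus Init n i A) z)
           \<le> C' * real n powr (- (1 + \<epsilon>0))"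
    using Init_consistent unfolding init_dist_def[symmetric] by blast
  obtain c' where c': "0 < c'" "c' < 1" and rate':
    "(\<lambda>n. ln (real (L n)) + real (L n) * exp (- c' * Jrho (\<rho> n))) \<in> o(\<lambda>n. minIS n (L n) (p n) (q n) (\<rho> n))"
    using rate by blast
  \<comment> \<open>The same \<open>e\<close> bounds the loss in the exponent and the failure
    probability, so one diagonal sequence settles both.\<close>
  define Q where "Q e n \<longleftrightarrow> (\<forall>z. in_Pn n (\<beta> n) z \<longrightarrow>
    1 - e \<le> prob_event n (L n) (p n) (q n) (\<rho> n) z
      (\<lambda>A. loss n (zhat n A) z \<le> exp (- (1 - e) * minIS n (L n) (p n) (q n) (\<rho> n))))" for e n
  have "\<forall>\<^sub>F n in sequentially. Q (inverse (real (Suc k))) n" for k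
  proof -
    define \<eta> where "\<eta> = inverse (real (Suc k)) / 7"
    have "inverse (real (Suc k)) \<le> inverse 1" by (intro le_imp_inverse_le) auto
    hence \<eta>: "0 < \<eta>" "\<eta> \<le> 1/2" by (auto simp: \<eta>_def)
    have "7 * \<eta> = inverse (real (Suc k))" by (simp add: \<eta>_def)
    thus ?thesis
      using loss_rate_eventually[where C = "max 1 C", OF rho_range rho_o1 L_pos pq_range C1 _ p_o1 beta_lim L_poly c_pos
          Init_range init c' rate' minI_inf zhat_alg3 \<eta>]
      unfolding Q_def by simp
  qed
  then obtain \<delta>bar where \<delta>bar: "\<delta>bar \<longlonglongrightarrow> 0" "\<forall>\<^sub>F n in sequentially. Q (\<delta>bar n) n"
    by (rule diagonal_sequence)
  show ?thesis
  proof (intro exI conjI allI impI)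
    show "\<delta>bar \<longlonglongrightarrow> 0" by (rule \<delta>bar)
    fix \<epsilon> :: real assume "0 < \<epsilon>"
    hence "\<forall>\<^sub>F n in sequentially. \<delta>bar n < \<epsilon>" using \<delta>bar(1) by (intro order_tendstoD(2))
    thus "\<forall>\<^sub>F n in sequentially. \<forall>z. in_Pn n (\<beta> n) z \<longrightarrow>
              prob_event n (L n) (p n) (q n) (\<rho> n) z
                (\<lambda>A. loss n (zhat n A) z \<le> exp (- (1 - \<delta>bar n) * minIS n (L n) (p n) (q n) (\<rho> n)))
              \<ge> 1 - \<epsilon>"
      using \<delta>bar(2) unfolding Q_def by eventually_elim force
  qed
qed

end
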